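(* In the algebraic computation-tree model, the time complexity of the problem EvenRankSum is $\Theta(n\log n)$. That is, for $n\ge 1$ let $T(n)$ denote the minimum depth of an algebraic computation tree which, on every input $A=(a_1,a_2,\ldots,a_{2n})\in\mathbb{R}^{2n}$, outputs the even-rank-sum of $A$; then $T(n)=\Theta(n\log n)$ as $n\to\infty$.
   Context: Even-rank-sum: for a sequence $A=(a_1,\ldots,a_{2n})$ of $2n$ real numbers, let $\pi$ be a permutation of $\{1,2,\ldots,2n\}$ with $a_{\pi(1)}\le a_{\pi(2)}\le\ldots\le a_{\pi(2n)}$. The even-rank-sum of $A$ is the real number $a_{\pi(2)}+a_{\pi(4)}+\ldots+a_{\pi(2n)}$; it does not depend on the choice of the sorting permutation $\pi$. Problem EvenRankSum: given a sequence $A$ of $2n$ real numbers, compute the even-rank-sum of $A$. Algebraic computation-tree model (the standard model of Ben-Or): an algebraic computation tree with input variables $z_1,\ldots,z_m$ (taking real values) is a finite rooted tree in which every vertex has at most two children, as follows. (1) Each vertex $v$ with exactly one child (computation vertex) is assigned an operation of the form $f_v:=f_1\circ f_2$, $f_v:=c\circ f_1$, or $f_v:=\sqrt{f_1}$, where $\circ\in\{+,-,\times,/\}$, $c\in\mathbb{R}$ is a constant, and each $f_i$ is either an input variable or the value $f_u$ computed at a proper ancestor $u$ of $v$. (2) Each vertex with exactly two children (branching vertex) is assigned a test of the form $f_1>0$, $f_1\ge 0$, or $f_1=0$, where $f_1$ is an input variable or a value computed at a proper ancestor; the computation proceeds to one child or the other according to the outcome of the test. (3) Each leaf is assigned an output;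 for the problem of computing a real-valued function, the output is an input variable, a real constant, or a value computed at an ancestor of the leaf. For every input, following the path from the root determined by the tests must never lead to a division by zero or to the square root of a negative number. The tree solves a problem if, for every input, the output at the leaf reached is the correct answer. The (worst-case) running time of the tree is its depth, that is, the maximum number of edges on a root-to-leaf path. The time complexity of a problem on $m$ inputs is the minimum depth of an algebraic computation tree with $m$ input variables that solves it. *)

theory Defs
  imports Complex_Main "HOL-Library.Landau_Symbols" "HOL-Combinatorics.Permutations"
begin

section \<open>The even-rank-sum\<close>

text \<open>
  Sequences are lists, indexed from 0: the term of 1-based rank \<open>2 * k\<close> sits at
  position \<open>2 * k - 1\<close> of the sorted sequence.
\<close>

definition sorting_permutation :: "(nat \<Rightarrow> nat) \<Rightarrow> real list \<Rightarrow> bool" where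
  "sorting_permutation \<pi> A \<longleftrightarrow>
     \<pi> permutes {..<length A} \<and>
     (\<forall>i j. i \<le> j \<and> j < length A \<longrightarrow> A ! \<pi> i \<le> A ! \<pi> j)"

definition even_rank_sum :: "real list \<Rightarrow> real" where
  "even_rank_sum A =
     (let \<pi> = (SOME \<pi>. sorting_permutation \<pi> A)
      in \<Sum>k = 1..length A div 2. A ! \<pi> (2 * k - 1))"

lemma sorting_permutation_exists: "\<exists>\<pi>. sorting_permutation \<pi> A"
proof -
  obtain \<pi> where \<pi>: "\<pi> permutes {..<length A}" "permute_list \<pi> A = sort A"
    by (rule mset_eq_permutation[of "sort A" A]) simp_all
  have "A ! \<pi> i \<le> A ! \<pi> j" if "i \<le> j" "j < length A" for i j
    using sorted_nth_mono[of "sort A" i j] that permute_list_nth[OF \<pi>(1)] \<pi>(2) by simp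
  with \<pi>(1) show ?thesis unfolding sorting_permutation_def by blast
qed

lemma sorting_permutation_nth:
  assumes "sorting_permutation \<pi> A" and "i < length A"
  shows "A ! \<pi> i = sort A ! i"
proof -
  have \<pi>: "\<pi> permutes {..<length A}" using assms by (simp add: sorting_permutation_def)
  have "sorted (permute_list \<pi> A)"
    using assms(1) permute_list_nth[OF \<pi>]
    by (auto simp: sorted_iff_nth_mono sorting_permutation_def)
  with \<pi> have "sort A = permute_list \<pi> A"
    by (intro properties_for_sort) simp_all
  with assms(2) \<pi> show ?thesis by (simp add: permute_list_nth)
qed

lemma even_rank_sum_eq:
  assumes "sorting_permutation \<pi> A"
  shows "even_rank_sum A = (\<Sum>k = 1..length A div 2. A ! \<pi> (2 * k - 1))"
proof -
  have "sorting_permutation (SOME \<pi>. sorting_permutation \<pi> A) A"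
    using sorting_permutation_exists by (rule someI_ex)
  then show ?thesis
    unfolding even_rank_sum_def Let_def
    using assms by (intro sum.cong) (auto simp: sorting_permutation_nth)
qed


section \<open>Algebraic computation trees\<close>

text \<open>
  A proper ancestor carrying a value is a computation vertex on the path from the root, so
  \<open>Computed j\<close> names it by its position: the (\<open>j + 1\<close>)-th computation vertex on that path,
  counted from the root.
\<close>

datatype operand = Input nat | Computed nat

datatype arith_op = Plus | Minus | Times | Divide

datatype computation =
    Binary arith_op operand operand
  | Const_Binary arith_op real operand
  | Sqrt operand

datatype test = Positive operand | Nonnegative operand | Is_Zero operand

datatype leaf_output = Output operand | Output_Const real

text \<open>The first subtree of a branching vertex is taken when the test succeeds.\<close>

datatype act =
    Leaf leaf_output
  | Compute computation act
  | Branch test act act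

primrec operands_computation :: "computation \<Rightarrow> operand set" where
  "operands_computation (Binary _ p q) = {p, q}"
| "operands_computation (Const_Binary _ _ p) = {p}"
| "operands_computation (Sqrt p) = {p}"

primrec operands_test :: "test \<Rightarrow> operand set" where
  "operands_test (Positive p) = {p}"
| "operands_test (Nonnegative p) = {p}"
| "operands_test (Is_Zero p) = {p}"

primrec operands_output :: "leaf_output \<Rightarrow> operand set" where
  "operands_output (Output p) = {p}"
| "operands_output (Output_Const _) = {}"

primrec wf_operand :: "nat \<Rightarrow> nat \<Rightarrow> operand \<Rightarrow> bool" where
  "wf_operand m k (Input i) \<longleftrightarrow> i < m"
| "wf_operand m k (Computed j) \<longleftrightarrow> j < k"

text \<open>
  \<open>m\<close> is the number of input variables and \<open>k\<close> the number of computation vertices above the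
  root of the tree.
\<close>

primrec wf_act :: "nat \<Rightarrow> nat \<Rightarrow> act \<Rightarrow> bool" where
  "wf_act m k (Leaf out) \<longleftrightarrow> (\<forall>p \<in> operands_output out. wf_operand m k p)"
| "wf_act m k (Compute f t) \<longleftrightarrow>
     (\<forall>p \<in> operands_computation f. wf_operand m k p) \<and> wf_act m (Suc k) t"
| "wf_act m k (Branch c t u) \<longleftrightarrow>
     (\<forall>p \<in> operands_test c. wf_operand m k p) \<and> wf_act m k t \<and> wf_act m k u"

primrec depth :: "act \<Rightarrow> nat" where
  "depth (Leaf _) = 0"
| "depth (Compute _ t) = Suc (depth t)"
| "depth (Branch _ t u) = Suc (max (depth t) (depth u))"

text \<open>
  In the following, \<open>xs\<close> are the inputs and \<open>vs\<close> the values computed so far; \<open>None\<close> signals a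
  division by zero or the square root of a negative number.
\<close>

primrec operand_value :: "real list \<Rightarrow> real list \<Rightarrow> operand \<Rightarrow> real" where
  "operand_value xs vs (Input i) = xs ! i"
| "operand_value xs vs (Computed j) = vs ! j"

primrec arith_value :: "arith_op \<Rightarrow> real \<Rightarrow> real \<Rightarrow> real option" where
  "arith_value Plus x y = Some (x + y)"
| "arith_value Minus x y = Some (x - y)"
| "arith_value Times x y = Some (x * y)"
| "arith_value Divide x y = (if y = 0 then None else Some (x / y))"

primrec computation_value :: "real list \<Rightarrow> real list \<Rightarrow> computation \<Rightarrow> real option" where
  "computation_value xs vs (Binary f p q) =
     arith_value f (operand_value xs vs p) (operand_value xs vs q)"
| "computation_value xs vs (Const_Binary f c p) = arith_value f c (operand_value xs vs p)"
| "computation_value xs vs (Sqrt p) =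
     (if operand_value xs vs p < 0 then None else Some (sqrt (operand_value xs vs p)))"

primrec test_holds :: "real list \<Rightarrow> real list \<Rightarrow> test \<Rightarrow> bool" where
  "test_holds xs vs (Positive p) \<longleftrightarrow> operand_value xs vs p > 0"
| "test_holds xs vs (Nonnegative p) \<longleftrightarrow> operand_value xs vs p \<ge> 0"
| "test_holds xs vs (Is_Zero p) \<longleftrightarrow> operand_value xs vs p = 0"

primrec output_value :: "real list \<Rightarrow> real list \<Rightarrow> leaf_output \<Rightarrow> real" where
  "output_value xs vs (Output p) = operand_value xs vs p"
| "output_value xs vs (Output_Const c) = c"

primrec run :: "real list \<Rightarrow> real list \<Rightarrow> act \<Rightarrow> real option" where
  "run xs vs (Leaf out) = Some (output_value xs vs out)"
| "run xs vs (Compute f t) =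
     (case computation_value xs vs f of None \<Rightarrow> None | Some v \<Rightarrow> run xs (vs @ [v]) t)"
| "run xs vs (Branch c t u) = (if test_holds xs vs c then run xs vs t else run xs vs u)"

definition solves :: "act \<Rightarrow> nat \<Rightarrow> (real list \<Rightarrow> real) \<Rightarrow> bool" where
  "solves t m F \<longleftrightarrow>
     wf_act m 0 t \<and> (\<forall>xs. length xs = m \<longrightarrow> run xs [] t = Some (F xs))"

text \<open>The value is meaningful only if some tree solves the problem.\<close>

definition time_complexity :: "nat \<Rightarrow> (real list \<Rightarrow> real) \<Rightarrow> nat" where
  "time_complexity m F = (LEAST d. \<exists>t. solves t m F \<and> depth t = d)"

end

theory Submission
  imports Defs "HOL-Complex_Analysis.Complex_Analysis"
begin

text \<open>
  The upper bound is binary insertion sort. For the lower bound, follow a tree of depth \<open>T\<close> from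
  a small open set inside each of the \<open>(2 * n)!\<close> cones \<open>x (\<pi> 0) < x (\<pi> 1) < \<dots>\<close>, shrinking the set
  at every sign test. There are at most \<open>3 ^ T\<close> sign patterns. Along one pattern all computed values
  are analytic, and where the output equals the sum of the even-rank terms of the order \<open>\<pi>\<close> it does so
  on a whole neighbourhood; but the even-rank sum is not linear near a tie. Hence the part of the
  domain of the pattern that lies in a given cone is relatively closed, and the sum of the squares of
  all computed values, which includes the reciprocals of the tested values, attains a minimum there.

  The minimum survives small perturbations of all instructions and of the objective, and the
  Lagrange multiplier conditions form a square system of \<open>N = O(n + T)\<close> quadratic equations with
  an arbitrary small right-hand side. Such a system has at most \<open>256 ^ N\<close> solutions for some right-hand
  side: by counting dimensions, the equations and a generic linear form in the unknowns satisfy a nontrivial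
  polynomial relation of degree less than \<open>256 ^ N\<close> in the linear form. This replaces the
  Milnor-Thom bound, and \<open>(2 * n)! \<le> 3 ^ T * 256 ^ N\<close> gives the claim.
\<close>

section \<open>Preimages under quadratic maps\<close>

text \<open>An equality test, or any test of a value that vanishes identically, prevents the inputs
  of a leaf from being described by strict inequalities alone. Hence cones are counted per sign
  pattern, and each cone is charged one solution of a polynomial system. The unperturbed Lagrange
  system may have degenerate or infinitely many solutions. Transversality is replaced by a choice of
  the right-hand side at which one fixed nonzero polynomial does not vanish; such a choice exists in
  every product of infinite sets, so in every neighbourhood of 0. The linear form has to separate
  the chosen solutions, which are known only after the right-hand side. Its coefficients are
  therefore adjoined as \<open>N\<close> further variables, which turns the degree bound 16 ^ V into
  16 ^ (2 * N) = 256 ^ N. A vertex takes at most two instructions, and an instruction contributes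
  one variable and one multiplier, so \<open>N\<close> is at most 2 * n + 4 * T.\<close>

lemma homogeneous_system_nontrivial:
  fixes a :: "'e \<Rightarrow> 'i \<Rightarrow> real"
  assumes "finite E" "finite I" "card E < card I"
  shows "\<exists>c. (\<exists>i\<in>I. c i \<noteq> 0) \<and> (\<forall>e\<in>E. (\<Sum>i\<in>I. a e i * c i) = 0)"
  using assms
proof (induction E arbitrary: I a rule: finite_induct)
  case empty
  then obtain i where "i \<in> I" by fastforce
  then show ?case by (intro exI[of _ "\<lambda>_. 1"]) auto
next
  case (insert e E)
  show ?case
  proof (cases "\<forall>i\<in>I. a e i = 0")
    case True
    have "card E < card I" using insert by simp
    from insert.IH[OF insert.prems(1) this, of a] True show ?thesis by auto
  next
    case False
    then obtain p where p: "p \<in> I" "a e p \<noteq> 0" by auto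
    define J where "J = I - {p}"
    \<comment> \<open>The coefficients that remain after equation \<open>e\<close> has been used to
      eliminate the unknown \<open>p\<close>; \<open>d\<close> below restores the value of that
      unknown.\<close>
    define b where "b = (\<lambda>f i. a f i - a f p * a e i / a e p)"
    have "finite J" "card E < card J" using insert p by (auto simp: J_def)
    from insert.IH[OF this, of b] obtain c where
      c: "\<exists>i\<in>J. c i \<noteq> 0" "\<forall>f\<in>E. (\<Sum>i\<in>J. b f i * c i) = 0" by blast
    define s where "s = (\<Sum>i\<in>J. a e i * c i)"
    define d where "d = c(p := - s / a e p)"
    have split: "(\<Sum>i\<in>I. a f i * d i) = (\<Sum>i\<in>J. a f i * c i) - a f p * s / a e p" for f
    proof -
      have "(\<Sum>i\<in>I. a f i * d i) = a f p * d p + (\<Sum>i\<in>J. a f i * d i)"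
        unfolding J_def using p insert.prems by (simp add: sum.remove)
      moreover have "(\<Sum>i\<in>J. a f i * d i) = (\<Sum>i\<in>J. a f i * c i)"
        by (rule sum.cong) (auto simp: J_def d_def)
      ultimately show ?thesis by (simp add: d_def)
    qed
    have "(\<Sum>i\<in>I. a f i * d i) = 0" if "f \<in> E" for f
    proof -
      have "0 = (\<Sum>i\<in>J. a f i * c i - a f p / a e p * (a e i * c i))"
        using c(2) that by (auto simp: b_def algebra_simps)
      also have "\<dots> = (\<Sum>i\<in>J. a f i * c i) - a f p / a e p * s"
        by (simp add: sum_subtractf sum_distrib_left s_def)
      finally show ?thesis by (simp add: split)
    qed
    moreover have "(\<Sum>i\<in>I. a e i * d i) = 0" using p by (simp add: split s_def)
    moreover have "\<exists>i\<in>I. d i \<noteq> 0" using c(1) by (auto simp: J_def d_def)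
    ultimately show ?thesis by (intro exI[of _ d]) auto
  qed
qed

text \<open>The last of the \<open>Suc N\<close> entries is slack. It pads the degree of a monomial
  in \<open>N\<close> variables up to \<open>K\<close>, so that "degree at most \<open>K\<close>"
  becomes an exact sum, which stars and bars count.\<close>

definition exponents :: "nat \<Rightarrow> nat \<Rightarrow> nat list set" where
  "exponents N K = {e. length e = Suc N \<and> sum_list e = K}"

definition monomial :: "nat \<Rightarrow> nat list \<Rightarrow> (nat \<Rightarrow> real) \<Rightarrow> real" where
  "monomial N e z = (\<Prod>i<N. z i ^ (e ! i))"

definition polyfun :: "nat \<Rightarrow> nat \<Rightarrow> ((nat \<Rightarrow> real) \<Rightarrow> real) \<Rightarrow> bool" where
  "polyfun N K f \<longleftrightarrow> (\<exists>a. \<forall>z. f z = (\<Sum>e\<in>exponents N K. a e * monomial N e z))"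

section \<open>Arithmetic of polynomial functions of bounded total degree\<close>

lemma card_exponents: "card (exponents N K) = (K + N) choose K"
  unfolding exponents_def by (subst card_length_sum_list) simp

lemma finite_exponents [simp]: "finite (exponents N K)"
  by (rule card_ge_0_finite) (simp add: card_exponents)

lemma polyfun_monomial: "e \<in> exponents N K \<Longrightarrow> polyfun N K (monomial N e)"
  unfolding polyfun_def
  by (intro exI[of _ "\<lambda>e'. if e' = e then 1 else 0"])
    (simp add: if_distrib[of "\<lambda>x. x * _"] cong: if_cong)

lemma polyfun_cong: "(\<And>z. f z = g z) \<Longrightarrow> polyfun N K f \<Longrightarrow> polyfun N K g"
  unfolding polyfun_def by simp

lemma polyfun_scale: "polyfun N K f \<Longrightarrow> polyfun N K (\<lambda>z. c * f z)"
  unfolding polyfun_def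
proof (elim exE)
  fix a assume "\<forall>z. f z = (\<Sum>e\<in>exponents N K. a e * monomial N e z)"
  then show "\<exists>a. \<forall>z. c * f z = (\<Sum>e\<in>exponents N K. a e * monomial N e z)"
    by (intro exI[of _ "\<lambda>e. c * a e"]) (simp add: sum_distrib_left mult.assoc)
qed

lemma polyfun_add: "polyfun N K f \<Longrightarrow> polyfun N K g \<Longrightarrow> polyfun N K (\<lambda>z. f z + g z)"
  unfolding polyfun_def
proof (elim exE)
  fix a b assume "\<forall>z. f z = (\<Sum>e\<in>exponents N K. a e * monomial N e z)"
    "\<forall>z. g z = (\<Sum>e\<in>exponents N K. b e * monomial N e z)"
  then show "\<exists>a. \<forall>z. f z + g z = (\<Sum>e\<in>exponents N K. a e * monomial N e z)"
    by (intro exI[of _ "\<lambda>e. a e + b e"]) (simp add: sum.distrib algebra_simps)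
qed

lemma polyfun_zero: "polyfun N K (\<lambda>z. 0)"
  unfolding polyfun_def by (intro exI[of _ "\<lambda>_. 0"]) simp

lemma polyfun_sum: "(\<And>i. i \<in> I \<Longrightarrow> polyfun N K (f i)) \<Longrightarrow> polyfun N K (\<lambda>z. \<Sum>i\<in>I. f i z)"
  by (induction I rule: infinite_finite_induct) (auto simp: polyfun_zero intro: polyfun_add)

lemma polyfun_diff: "polyfun N K f \<Longrightarrow> polyfun N K g \<Longrightarrow> polyfun N K (\<lambda>z. f z - g z)"
  using polyfun_add[OF _ polyfun_scale[of N K g "-1"], of f] by simp

lemma monomial_mult:
  assumes "e \<in> exponents N K" "e' \<in> exponents N L"
  shows "map2 (+) e e' \<in> exponents N (K + L)"
    "monomial N (map2 (+) e e') z = monomial N e z * monomial N e' z"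
proof -
  have "sum_list (map2 (+) e e') = sum_list e + sum_list e'" if "length e = length e'"
    using that by (induction e e' rule: list_induct2) auto
  then show "map2 (+) e e' \<in> exponents N (K + L)" using assms by (auto simp: exponents_def)
  show "monomial N (map2 (+) e e') z = monomial N e z * monomial N e' z"
    using assms by (auto simp: monomial_def exponents_def power_add prod.distrib[symmetric]
        intro!: prod.cong)
qed

lemma polyfun_mult:
  assumes "polyfun N K f" "polyfun N L g"
  shows "polyfun N (K + L) (\<lambda>z. f z * g z)"
proof -
  obtain a where a: "\<And>z. f z = (\<Sum>e\<in>exponents N K. a e * monomial N e z)"
    using assms(1) unfolding polyfun_def by blast
  obtain b where b: "\<And>z. g z = (\<Sum>e\<in>exponents N L. b e * monomial N e z)"
    using assms(2) unfolding polyfun_def by blast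
  have "polyfun N (K + L) (\<lambda>z. \<Sum>e\<in>exponents N K. \<Sum>e'\<in>exponents N L.
      (a e * b e') * monomial N (map2 (+) e e') z)"
    by (intro polyfun_sum polyfun_scale polyfun_monomial monomial_mult)
  then show ?thesis
    by (rule polyfun_cong[rotated])
      (auto simp: a b sum_product monomial_mult algebra_simps intro!: sum.cong)
qed

lemma polyfun_one: "polyfun N K (\<lambda>z. 1)"
proof (rule polyfun_cong)
  show "polyfun N K (monomial N (replicate N 0 @ [K]))"
    by (rule polyfun_monomial) (simp add: exponents_def sum_list_replicate)
  show "monomial N (replicate N 0 @ [K]) z = 1" for z by (simp add: monomial_def nth_append)
qed

lemma polyfun_const: "polyfun N K (\<lambda>z. c)"
  using polyfun_scale[OF polyfun_one, of N K c] by simp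

lemma polyfun_mono: "polyfun N K f \<Longrightarrow> K \<le> L \<Longrightarrow> polyfun N L f"
  using polyfun_mult[OF _ polyfun_one, of N K f "L - K"] by simp

lemma polyfun_var1: assumes "i < N" shows "polyfun N (Suc 0) (\<lambda>z. z i)"
proof (rule polyfun_cong)
  show "polyfun N (Suc 0) (monomial N ((replicate (Suc N) 0)[i := Suc 0]))"
    by (rule polyfun_monomial) (use assms in \<open>simp add: exponents_def sum_list_update sum_list_replicate del: replicate.simps\<close>)
  show "monomial N ((replicate (Suc N) 0)[i := Suc 0]) z = z i" for z
  proof -
    have "(\<Prod>j<N. z j ^ ((replicate (Suc N) 0)[i := Suc 0] ! j)) = (\<Prod>j<N. if j = i then z j else 1)"
      using assms by (intro prod.cong) (auto simp: nth_list_update simp del: replicate.simps)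
    then show ?thesis using assms by (simp add: monomial_def del: replicate.simps)
  qed
qed

lemma polyfun_var: "i < N \<Longrightarrow> 1 \<le> K \<Longrightarrow> polyfun N K (\<lambda>z. z i)"
  using polyfun_mono[OF polyfun_var1] by simp

lemma polyfun_power: "polyfun N K f \<Longrightarrow> polyfun N (K * d) (\<lambda>z. f z ^ d)"
proof (induction d)
  case (Suc d)
  then show ?case using polyfun_mult[of N K f "K * d"] by simp
qed (simp add: polyfun_one)

lemma polyfun_prod:
  assumes "finite I" "\<And>i. i \<in> I \<Longrightarrow> polyfun N K (f i)"
  shows "polyfun N (K * card I) (\<lambda>z. \<Prod>i\<in>I. f i z)"
  using assms
proof (induction I rule: finite_induct)
  case (insert i I)
  then show ?case using polyfun_mult[of N K "f i" "K * card I"] by simp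
qed (simp add: polyfun_one)

lemma polyfun_rename:
  assumes "polyfun N K f" "N \<le> N'"
  shows "polyfun N' K f"
proof -
  obtain a where a: "\<And>z. f z = (\<Sum>e\<in>exponents N K. a e * monomial N e z)"
    using assms unfolding polyfun_def by blast
  \<comment> \<open>The new variables get exponent 0, inserted in front of the slack entry.\<close>
  define ext where "ext = (\<lambda>e::nat list. take N e @ replicate (N' - N) 0 @ [e ! N])"
  have "polyfun N' K (\<lambda>z. \<Sum>e\<in>exponents N K. a e * monomial N' (ext e) z)"
  proof (intro polyfun_sum polyfun_scale polyfun_monomial)
    fix e assume "e \<in> exponents N K"
    then have e: "length e = Suc N" "sum_list e = K" by (auto simp: exponents_def)
    then have "e = take N e @ [e ! N]" by (metis lessI take_Suc_conv_app_nth take_all_iff order_refl)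
    then have "sum_list (take N e) + e ! N = K" using e(2) by (metis sum_list_append sum_list.Nil sum_list.Cons add_0_right)
    then show "ext e \<in> exponents N' K"
      using e assms(2) by (simp add: exponents_def ext_def sum_list_replicate)
  qed
  moreover have "monomial N' (ext e) z = monomial N e z" if "e \<in> exponents N K" for e z
  proof -
    have "length e = Suc N" using that by (simp add: exponents_def)
    then have "(\<Prod>i<N'. z i ^ (ext e ! i)) = (\<Prod>i<N. z i ^ (e ! i))"
      using assms(2) by (intro prod.mono_neutral_cong_right) (auto simp: ext_def nth_append)
    then show ?thesis by (simp add: monomial_def)
  qed
  ultimately show ?thesis by (intro polyfun_cong[rotated, where g = f]) (auto simp: a)
qed

text \<open>All variables but \<open>p\<close> are fixed so that the coefficient of the power
  \<open>\<alpha> p\<close> survives. What remains is a nonzero polynomial in one variable with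
  finitely many roots, whereas \<open>A p\<close> is infinite.\<close>

lemma exists_nonzero_value:
  fixes c :: "('i \<Rightarrow> nat) \<Rightarrow> real"
  assumes "finite I" "\<alpha> \<in> PiE I (\<lambda>_. {..<D})" "c \<alpha> \<noteq> 0"
    and "\<And>i. i \<in> I \<Longrightarrow> infinite (A i)"
  shows "\<exists>w. (\<forall>i\<in>I. w i \<in> A i) \<and> (\<Sum>\<alpha>\<in>PiE I (\<lambda>_. {..<D}). c \<alpha> * (\<Prod>i\<in>I. w i ^ \<alpha> i)) \<noteq> 0"
  using assms
proof (induction I arbitrary: \<alpha> c rule: finite_induct)
  case empty
  then show ?case by simp
next
  case (insert p I)
  define \<beta> where "\<beta> = restrict \<alpha> I"
  have \<beta>: "\<beta> \<in> PiE I (\<lambda>_. {..<D})" and \<alpha>: "\<alpha> = \<beta>(p := \<alpha> p)" and ap: "\<alpha> p < D"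
    using insert.prems(1) insert.hyps
    by (auto simp: \<beta>_def PiE_iff extensional_def restrict_def fun_eq_iff)
  have "\<exists>w. (\<forall>i\<in>I. w i \<in> A i) \<and>
    (\<Sum>\<gamma>\<in>PiE I (\<lambda>_. {..<D}). c (\<gamma>(p := \<alpha> p)) * (\<Prod>i\<in>I. w i ^ \<gamma> i)) \<noteq> 0"
    by (rule insert.IH[OF \<beta>]) (use \<alpha> insert.prems in auto)
  then obtain w where w: "\<forall>i\<in>I. w i \<in> A i"
    "(\<Sum>\<gamma>\<in>PiE I (\<lambda>_. {..<D}). c (\<gamma>(p := \<alpha> p)) * (\<Prod>i\<in>I. w i ^ \<gamma> i)) \<noteq> 0" by blast
  \<comment> \<open>The coefficient at index \<open>D\<close> is set to 0 because the theorem on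
    roots speaks of sums up to and including \<open>D\<close>.\<close>
  define q where "q = (\<lambda>d. if d < D then \<Sum>\<gamma>\<in>PiE I (\<lambda>_. {..<D}). c (\<gamma>(p := d)) * (\<Prod>i\<in>I. w i ^ \<gamma> i) else 0)"
  have "q (\<alpha> p) \<noteq> 0" using w(2) ap by (simp add: q_def)
  then have "finite {t. (\<Sum>d\<le>D. q d * t ^ d) = 0}"
    by (subst polyfun_finite_roots) (use ap in \<open>auto intro!: exI[of _ "\<alpha> p"]\<close>)
  with insert.prems(3)[of p] obtain t where t: "t \<in> A p" "(\<Sum>d\<le>D. q d * t ^ d) \<noteq> 0"
    by (smt (verit) finite_subset insertI1 mem_Collect_eq subsetI)
  define w' where "w' = w(p := t)"
  have "(\<Sum>\<alpha>\<in>PiE (insert p I) (\<lambda>_. {..<D}). c \<alpha> * (\<Prod>i\<in>insert p I. w' i ^ \<alpha> i))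
     = (\<Sum>(d,\<gamma>)\<in>{..<D} \<times> PiE I (\<lambda>_. {..<D}). c (\<gamma>(p := d)) * (\<Prod>i\<in>insert p I. w' i ^ (\<gamma>(p := d)) i))"
    unfolding PiE_insert_eq
    by (subst sum.reindex[OF inj_combinator[OF insert.hyps(2)]]) (simp add: case_prod_beta')
  also have "\<dots> = (\<Sum>d<D. \<Sum>\<gamma>\<in>PiE I (\<lambda>_. {..<D}). c (\<gamma>(p := d)) * (\<Prod>i\<in>insert p I. w' i ^ (\<gamma>(p := d)) i))"
    by (simp add: sum.cartesian_product)
  also have "\<dots> = (\<Sum>d<D. q d * t ^ d)"
  proof (intro sum.cong refl)
    fix d assume "d \<in> {..<D}"
    have "(\<Prod>i\<in>insert p I. w' i ^ (\<gamma>(p := d)) i) = t ^ d * (\<Prod>i\<in>I. w i ^ \<gamma> i)" for \<gamma>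
    proof -
      have "(\<Prod>i\<in>I. w' i ^ (\<gamma>(p := d)) i) = (\<Prod>i\<in>I. w i ^ \<gamma> i)"
        using insert.hyps by (intro prod.cong) (auto simp: w'_def)
      then show ?thesis using insert.hyps by (simp add: w'_def)
    qed
    then show "(\<Sum>\<gamma>\<in>PiE I (\<lambda>_. {..<D}). c (\<gamma>(p := d)) * (\<Prod>i\<in>insert p I. w' i ^ (\<gamma>(p := d)) i)) = q d * t ^ d"
      using \<open>d \<in> _\<close> by (simp add: q_def sum_distrib_left sum_distrib_right mult.commute mult.left_commute)
  qed
  also have "\<dots> = (\<Sum>d\<le>D. q d * t ^ d)" by (rule sum.mono_neutral_left) (auto simp: q_def)
  finally have "(\<Sum>\<alpha>\<in>PiE (insert p I) (\<lambda>_. {..<D}). c \<alpha> * (\<Prod>i\<in>insert p I. w' i ^ \<alpha> i)) \<noteq> 0"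
    using t(2) by simp
  moreover have "\<forall>i\<in>insert p I. w' i \<in> A i" using w(1) t(1) insert.hyps by (auto simp: w'_def)
  ultimately show ?case by blast
qed

text \<open>The exponential series at \<open>n\<close> has nonnegative terms and contains n ^ n /
  fact n; moreover e \<le> 3.\<close>

lemma power_self_le_fact: "real n ^ n \<le> 3 ^ n * fact n"
proof -
  have "real n ^ n / fact n \<le> exp (real n)"
  proof -
    have "(\<Sum>k\<in>{n}. inverse (fact k) * real n ^ k) \<le> (\<Sum>k. inverse (fact k) * real n ^ k)"
      by (rule sum_le_suminf) (auto intro: summable_exp)
    then show ?thesis by (simp add: exp_def field_simps)
  qed
  also have "\<dots> = exp 1 ^ n" using exp_of_nat_mult[of n "1::real"] by simp
  also have "\<dots> \<le> 3 ^ n" by (intro power_mono exp_le) simp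
  finally show ?thesis by (simp add: field_simps)
qed

text \<open>Left: the number of monomials of degree at most \<open>2 * V * J + 2 * J\<close> in
  \<open>V\<close> variables. Right: the number of products of powers of \<open>V + 1\<close>
  polynomials with all exponents below \<open>J\<close>. The base 16 is the first integer above 5 *
  3, where 5 bounds the top of the binomial by 5 * V * J and 3 comes from the bound on V ^
  V.\<close>

lemma binomial_less_power:
  assumes "V \<ge> 1"
  defines "J \<equiv> 16 ^ V"
  shows "((2 * V * J + 2 * J) + V) choose (2 * V * J + 2 * J) < J * J ^ V"
proof -
  define n where "n = (2 * V * J + 2 * J) + V"
  have J: "J \<ge> 1" by (simp add: J_def)
  have "n \<le> 5 * V * J"
  proof -
    have "J \<le> V * J" "V \<le> V * J" using assms(1) J mult_le_mono[of 1 V J J] mult_le_mono[of V V 1 J] by simp_all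
    moreover have "n = 2 * (V * J) + 2 * J + V" "5 * V * J = 5 * (V * J)" by (simp_all add: n_def)
    ultimately show ?thesis by linarith
  qed
  have "n choose (2 * V * J + 2 * J) = n choose V"
    by (subst binomial_symmetric) (simp_all add: n_def)
  moreover have "real (n choose V) * fact V \<le> 15 ^ V * real J ^ V * fact V"
  proof -
    have "(n choose V) * fact V \<le> n ^ V" by (rule binomial_fact_pow)
    also have "\<dots> \<le> (5 * V * J) ^ V" using \<open>n \<le> _\<close> by (rule power_mono) simp
    finally have "real ((n choose V) * fact V) \<le> real ((5 * V * J) ^ V)" by (rule of_nat_mono)
    then have "real (n choose V) * fact V \<le> 5 ^ V * real J ^ V * real V ^ V"
      by (simp add: power_mult_distrib algebra_simps)
    also have "\<dots> \<le> 5 ^ V * real J ^ V * (3 ^ V * fact V)"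
      by (intro mult_left_mono power_self_le_fact) simp
    also have "\<dots> = 15 ^ V * real J ^ V * fact V"
      using power_mult_distrib[of "5::real" 3 V] by simp
    finally show ?thesis .
  qed
  then have "real (n choose V) \<le> 15 ^ V * real J ^ V" by simp
  also have "\<dots> < 16 ^ V * real J ^ V"
    using assms(1) J by (intro mult_strict_right_mono power_strict_mono) auto
  also have "\<dots> = real (J * J ^ V)" by (simp add: J_def)
  ultimately show ?thesis unfolding n_def by (metis of_nat_less_iff)
qed

text \<open>The products of powers of these \<open>V + 1\<close> quadratic polynomials outnumber the
  monomials that can occur in them, hence they are linearly dependent. The dependence is sorted by
  powers of \<open>u\<close>, the polynomial that later carries the linear form.\<close>

lemma polynomial_relation:
  assumes V: "V \<ge> 1" and J: "J = 16 ^ V"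
    and g: "\<And>k. k < V \<Longrightarrow> polyfun V 2 (g k)" and u: "polyfun V 2 u"
  shows "\<exists>c. (\<exists>\<alpha>\<in>PiE {..<V} (\<lambda>_. {..<J}). \<exists>j<J. c \<alpha> j \<noteq> 0) \<and>
    (\<forall>z. (\<Sum>j<J. (\<Sum>\<alpha>\<in>PiE {..<V} (\<lambda>_. {..<J}). c \<alpha> j * (\<Prod>k<V. g k z ^ \<alpha> k)) * u z ^ j) = 0)"
proof -
  define K where "K = 2 * V * J + 2 * J"
  let ?P = "PiE {..<V} (\<lambda>_. {..<J})"
  have fin: "finite ?P" by (rule finite_PiE) auto
  have "polyfun V K (\<lambda>z. (\<Prod>k<V. g k z ^ \<alpha> k) * u z ^ j)" if "\<alpha> \<in> ?P" "j < J" for \<alpha> j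
  proof -
    have "polyfun V ((2 * J) * card {..<V}) (\<lambda>z. \<Prod>k<V. g k z ^ \<alpha> k)"
    proof (rule polyfun_prod)
      fix k assume "k \<in> {..<V}"
      with that have "\<alpha> k < J" by auto
      then show "polyfun V (2 * J) (\<lambda>z. g k z ^ \<alpha> k)"
        using polyfun_mono[OF polyfun_power[OF g], of k "\<alpha> k" "2 * J"] \<open>k \<in> _\<close> by simp
    qed simp
    moreover have "polyfun V (2 * J) (\<lambda>z. u z ^ j)"
      using polyfun_mono[OF polyfun_power[OF u], of j "2 * J"] that by simp
    ultimately have "polyfun V ((2 * J) * card {..<V} + 2 * J) (\<lambda>z. (\<Prod>k<V. g k z ^ \<alpha> k) * u z ^ j)"
      by (rule polyfun_mult)
    then show ?thesis by (rule polyfun_mono) (simp add: K_def)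
  qed
  then have "\<forall>x\<in>?P \<times> {..<J}. \<exists>a. \<forall>z. (\<Prod>k<V. g k z ^ fst x k) * u z ^ snd x
      = (\<Sum>e\<in>exponents V K. a e * monomial V e z)"
    unfolding polyfun_def by auto
  from bchoice[OF this] obtain a where a: "\<And>x z. x \<in> ?P \<times> {..<J} \<Longrightarrow> (\<Prod>k<V. g k z ^ fst x k) * u z ^ snd x
      = (\<Sum>e\<in>exponents V K. a x e * monomial V e z)"
    by blast
  have "card (exponents V K) < card (?P \<times> {..<J})"
    using binomial_less_power[OF V] by (simp add: card_exponents K_def J card_PiE card_cartesian_product mult.commute)
  from homogeneous_system_nontrivial[OF finite_exponents _ this, of "\<lambda>e x. a x e"] fin
  obtain c where c: "\<exists>x\<in>?P \<times> {..<J}. c x \<noteq> 0"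
    "\<And>e. e \<in> exponents V K \<Longrightarrow> (\<Sum>x\<in>?P \<times> {..<J}. a x e * c x) = 0" by auto
  have "(\<Sum>j<J. (\<Sum>\<alpha>\<in>?P. c (\<alpha>, j) * (\<Prod>k<V. g k z ^ \<alpha> k)) * u z ^ j) = 0" for z
  proof -
    have "(\<Sum>j<J. (\<Sum>\<alpha>\<in>?P. c (\<alpha>, j) * (\<Prod>k<V. g k z ^ \<alpha> k)) * u z ^ j)
        = (\<Sum>\<alpha>\<in>?P. \<Sum>j<J. c (\<alpha>, j) * ((\<Prod>k<V. g k z ^ \<alpha> k) * u z ^ j))"
      by (subst sum.swap) (simp add: sum_distrib_right mult.assoc)
    also have "\<dots> = (\<Sum>x\<in>?P \<times> {..<J}. c x * ((\<Prod>k<V. g k z ^ fst x k) * u z ^ snd x))"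
      by (simp add: sum.cartesian_product case_prod_beta')
    also have "\<dots> = (\<Sum>x\<in>?P \<times> {..<J}. c x * (\<Sum>e\<in>exponents V K. a x e * monomial V e z))"
      by (intro sum.cong) (auto simp: a)
    also have "\<dots> = (\<Sum>e\<in>exponents V K. (\<Sum>x\<in>?P \<times> {..<J}. a x e * c x) * monomial V e z)"
      unfolding sum_distrib_left sum_distrib_right
      by (subst sum.swap) (simp only: mult.assoc mult.commute mult.left_commute)
    also have "\<dots> = 0" by (simp add: c(2))
    finally show ?thesis .
  qed
  then show ?thesis using c(1) by (intro exI[of _ "\<lambda>\<alpha> j. c (\<alpha>, j)"]) auto
qed


text \<open>The direction (1, s, s ^ 2, ...) on the moment curve separates any two given points for
  all but finitely many \<open>s\<close>. Moving from \<open>c\<close> by \<open>t\<close> in this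
  direction, each pair excludes at most one \<open>t\<close>, while \<open>Q\<close> stays nonzero
  on a whole interval around t = 0.\<close>

lemma separating_perturbation:
  fixes Q :: "(nat \<Rightarrow> real) \<Rightarrow> real" and X :: "(nat \<Rightarrow> real) set"
  assumes Q: "Q c \<noteq> 0" and cont: "\<And>e. continuous_on UNIV (\<lambda>t. Q (\<lambda>i. c i + t * e i))"
    and X: "finite X" "inj_on (\<lambda>v. restrict v {..<N}) X"
  shows "\<exists>c'. Q c' \<noteq> 0 \<and> inj_on (\<lambda>v. \<Sum>i<N. v i * c' i) X"
proof -
  define P where "P = {(v, v'). v \<in> X \<and> v' \<in> X \<and> v \<noteq> v'}"
  have finP: "finite P" by (rule finite_subset[of _ "X \<times> X"]) (use X in \<open>auto simp: P_def\<close>)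
  have "finite {s. (\<Sum>i\<le>N. (if i < N then fst p i - snd p i else 0) * s ^ i) = 0}" if "p \<in> P" for p
  proof -
    obtain v v' where p: "p = (v, v')" "v \<in> X" "v' \<in> X" "v \<noteq> v'" using \<open>p \<in> P\<close> unfolding P_def by blast
    then have "restrict v {..<N} \<noteq> restrict v' {..<N}" using X(2) by (auto dest: inj_onD)
    then obtain i where "i < N" "v i \<noteq> v' i" by (auto simp: restrict_def fun_eq_iff split: if_splits)
    then show ?thesis by (subst polyfun_finite_roots) (auto simp: p intro!: exI[of _ i])
  qed
  with finP have "finite (\<Union>p\<in>P. {s. (\<Sum>i\<le>N. (if i < N then fst p i - snd p i else 0) * s ^ i) = 0})"
    by blast
  from ex_new_if_finite[OF infinite_UNIV_char_0 this]
  obtain s :: real where s: "\<And>p. p \<in> P \<Longrightarrow> (\<Sum>i\<le>N. (if i < N then fst p i - snd p i else 0) * s ^ i) \<noteq> 0"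
    by blast
  have s': "(\<Sum>i<N. (v i - v' i) * s ^ i) \<noteq> 0" if "(v, v') \<in> P" for v v'
  proof -
    have "(\<Sum>i\<le>N. (if i < N then v i - v' i else 0) * s ^ i) = (\<Sum>i<N. (v i - v' i) * s ^ i)"
      by (rule sum.mono_neutral_cong_right) auto
    then show ?thesis using s[OF that] by (simp only: fst_conv snd_conv not_False_eq_True)
  qed
  define q where "q = (\<lambda>t. Q (\<lambda>i. c i + t * s ^ i))"
  have "open {t. q t \<noteq> 0}"
    unfolding q_def by (intro open_Collect_neq cont continuous_intros)
  moreover have "0 \<in> {t. q t \<noteq> 0}" using Q by (simp add: q_def)
  ultimately have inf: "infinite {t. q t \<noteq> 0}"
    by (metis finite_imp_not_open empty_iff)
  have fin: "finite {t. (\<Sum>i<N. (fst p i - snd p i) * (c i + t * s ^ i)) = 0}" if "p \<in> P" for p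
  proof -
    let ?a = "\<Sum>i<N. (fst p i - snd p i) * c i" and ?b = "\<Sum>i<N. (fst p i - snd p i) * s ^ i"
    have b: "?b \<noteq> 0" using s'[of "fst p" "snd p"] that by simp
    have "(\<Sum>i<N. (fst p i - snd p i) * (c i + t * s ^ i)) = ?a + t * ?b" for t
      by (simp add: sum_distrib_left sum.distrib[symmetric] algebra_simps)
    then have "{t. (\<Sum>i<N. (fst p i - snd p i) * (c i + t * s ^ i)) = 0} \<subseteq> {- ?a / ?b}"
      using b by (auto simp: field_simps)
    then show ?thesis by (rule finite_subset) simp
  qed
  have "finite (\<Union>p\<in>P. {t. (\<Sum>i<N. (fst p i - snd p i) * (c i + t * s ^ i)) = 0})"
    using finP fin by blast
  from infinite_imp_nonempty[OF Diff_infinite_finite[OF this inf]]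
  obtain t where t: "q t \<noteq> 0" "\<And>p. p \<in> P \<Longrightarrow> (\<Sum>i<N. (fst p i - snd p i) * (c i + t * s ^ i)) \<noteq> 0"
    by blast
  have "inj_on (\<lambda>v. \<Sum>i<N. v i * (c i + t * s ^ i)) X"
  proof (rule inj_onI, rule ccontr)
    fix v v' assume "v \<in> X" "v' \<in> X" "v \<noteq> v'"
      and eq: "(\<Sum>i<N. v i * (c i + t * s ^ i)) = (\<Sum>i<N. v' i * (c i + t * s ^ i))"
    then have "(v, v') \<in> P" by (simp add: P_def)
    from t(2)[OF this] eq show False by (simp add: left_diff_distrib sum_subtractf)
  qed
  with t(1) show ?thesis unfolding q_def by blast
qed

text \<open>The value \<open>w\<close> is chosen before \<open>X\<close>, but a linear form that is
  injective on \<open>X\<close> depends on \<open>X\<close>. So the relation is formed in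
  \<open>2 * N\<close> variables: the unknowns and the coefficients of the form, with the bilinear
  \<open>u\<close> as the value of the form. Over \<open>w\<close>, and for suitable coefficients,
  it becomes a nonzero polynomial in one variable whose roots include all values of the form on
  \<open>X\<close>.\<close>

theorem quadratic_map_fibre_bound:
  fixes F :: "nat \<Rightarrow> (nat \<Rightarrow> real) \<Rightarrow> real"
  assumes N: "N \<ge> 1" and F: "\<And>k. k < N \<Longrightarrow> polyfun N 2 (F k)"
    and A: "\<And>k. k < N \<Longrightarrow> infinite (A k)"
  shows "\<exists>w. (\<forall>k<N. w k \<in> A k) \<and>
    (\<forall>X. finite X \<longrightarrow> inj_on (\<lambda>v. restrict v {..<N}) X \<longrightarrow>
      (\<forall>v\<in>X. \<forall>k<N. F k v = w k) \<longrightarrow> card X \<le> 256 ^ N)"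
proof -
  define V where "V = 2 * N"
  define J :: nat where "J = 16 ^ V"
  define g where "g = (\<lambda>k v. if k < N then F k v else v k :: real)"
  define u where "u = (\<lambda>v. \<Sum>i<N. v i * v (N + i) :: real)"
  let ?P = "PiE {..<V} (\<lambda>_. {..<J})"
  have g: "polyfun V 2 (g k)" if "k < V" for k
  proof (cases "k < N")
    case True
    then have "g k = F k" by (auto simp: g_def)
    then show ?thesis using polyfun_rename[OF F[OF True], of V] by (simp add: V_def)
  next
    case False
    then have "g k = (\<lambda>v. v k)" by (auto simp: g_def)
    then show ?thesis using polyfun_var[OF that, of 2] by simp
  qed
  have u: "polyfun V 2 u"
    unfolding u_def
  proof (rule polyfun_sum)
    fix i assume "i \<in> {..<N}"
    then show "polyfun V 2 (\<lambda>v. v i * v (N + i))"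
      using polyfun_mult[OF polyfun_var1 polyfun_var1, of i V "N + i"] by (simp add: V_def numeral_2_eq_2)
  qed
  have "V \<ge> 1" using N by (simp add: V_def)
  from polynomial_relation[of V J g u, OF this J_def g u] obtain c where
    c: "\<exists>\<alpha>\<in>?P. \<exists>j<J. c \<alpha> j \<noteq> 0" and
    rel: "\<And>v. (\<Sum>j<J. (\<Sum>\<alpha>\<in>?P. c \<alpha> j * (\<Prod>k<V. g k v ^ \<alpha> k)) * u v ^ j) = 0"
    by blast
  define q where "q = (\<lambda>j w. \<Sum>\<alpha>\<in>?P. c \<alpha> j * (\<Prod>k<V. w k ^ \<alpha> k) :: real)"
  from c obtain \<alpha> j0 where j0: "\<alpha> \<in> ?P" "j0 < J" "c \<alpha> j0 \<noteq> 0" by blast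
  have "\<exists>w. (\<forall>k\<in>{..<V}. w k \<in> (if k < N then A k else UNIV)) \<and>
      (\<Sum>\<alpha>\<in>?P. c \<alpha> j0 * (\<Prod>k<V. w k ^ \<alpha> k)) \<noteq> 0"
    by (rule exists_nonzero_value[where c = "\<lambda>\<alpha>. c \<alpha> j0", OF _ j0(1) j0(3)])
      (use A in \<open>auto simp: infinite_UNIV_char_0\<close>)
  \<comment> \<open>Only the first \<open>N\<close> entries are the right-hand side. The others are
    provisional coefficients of the linear form, to be adjusted for each \<open>X\<close>.\<close>
  then obtain w where w: "\<And>k. k < V \<Longrightarrow> w k \<in> (if k < N then A k else UNIV)" "q j0 w \<noteq> 0"
    unfolding q_def by blast
  have wA: "w k \<in> A k" if "k < N" for k using w(1)[of k] that by (simp add: V_def)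
  have "card X \<le> 256 ^ N"
    if X: "finite X" "inj_on (\<lambda>v. restrict v {..<N}) X" "\<forall>v\<in>X. \<forall>k<N. F k v = w k" for X
  proof -
    \<comment> \<open>Appends the coefficients \<open>d\<close> of the linear form to the first
      \<open>N\<close> entries.\<close>
    define join where "join = (\<lambda>(v::nat \<Rightarrow> real) d k. if k < N then v k else d (k - N) :: real)"
    define Q where "Q = (\<lambda>d. q j0 (join w d))"
    have "Q (\<lambda>i. w (N + i)) = q j0 w" by (simp add: Q_def join_def q_def cong: if_cong)
    then have "Q (\<lambda>i. w (N + i)) \<noteq> 0" using w(2) by simp
    moreover have "continuous_on UNIV (\<lambda>t. Q (\<lambda>i. w (N + i) + t * e i))" for e
    proof -
      have "continuous_on UNIV (\<lambda>t. join w (\<lambda>i. w (N + i) + t * e i) k)" for k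
        by (cases "k < N") (auto simp: join_def intro!: continuous_intros)
      then show ?thesis unfolding Q_def q_def by (intro continuous_intros)
    qed
    ultimately obtain d where d: "Q d \<noteq> 0" "inj_on (\<lambda>v. \<Sum>i<N. v i * d i) X"
      using separating_perturbation[OF _ _ X(1,2)] by blast
    let ?l = "\<lambda>v. \<Sum>i<N. v i * d i"
    have root: "(\<Sum>j\<le>J - 1. q j (join w d) * ?l v ^ j) = 0" if "v \<in> X" for v
    proof -
      have vF: "F k (join v d) = w k" if "k < N" for k
      proof -
        obtain a where "\<And>z. F k z = (\<Sum>e\<in>exponents N 2. a e * monomial N e z)"
          using F[OF \<open>k < N\<close>] unfolding polyfun_def by blast
        moreover have "monomial N e (join v d) = monomial N e v" for e
          by (auto simp: monomial_def join_def intro!: prod.cong)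
        ultimately have "F k (join v d) = F k v" by simp
        then show ?thesis using X(3) \<open>v \<in> X\<close> that by simp
      qed
      have "g k (join v d) = join w d k" for k using vF by (auto simp: g_def join_def)
      moreover have "u (join v d) = ?l v" by (auto simp: u_def join_def intro!: sum.cong)
      ultimately have "(\<Sum>j<J. q j (join w d) * ?l v ^ j) = 0"
        using rel[of "join v d"] by (simp add: q_def)
      moreover have "{..J - 1} = {..<J}" using j0(2) by auto
      ultimately show ?thesis by simp
    qed
    let ?R = "{t. (\<Sum>j\<le>J - 1. q j (join w d) * t ^ j) = 0}"
    have nz: "q j0 (join w d) \<noteq> 0" "j0 \<le> J - 1" using d(1) j0(2) by (auto simp: Q_def)
    have "card (?l ` X) \<le> card ?R"
      by (rule card_mono) (use nz root in \<open>auto simp: polyfun_finite_roots\<close>)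
    also have "\<dots> \<le> J - 1" using Transcendental.polyfun_rootbound[of "\<lambda>j. q j (join w d)" j0 "J - 1"] nz by blast
    finally have "card X \<le> J" using card_image[OF d(2)] by simp
    also have "J = 256 ^ N" by (simp add: J_def V_def power_mult)
    finally show ?thesis .
  qed
  with wA show ?thesis by blast
qed

section \<open>Perturbed straight-line programs\<close>

text \<open>\<open>Inv s a\<close> writes the reciprocal of variable \<open>a\<close>; its domain is restricted to the sign \<open>s\<close>, so
  that it also records the outcome of a test.\<close>

datatype instr = Lin real real nat real nat | Mul nat nat | Inv real nat | Root nat

primrec operands :: "instr \<Rightarrow> nat set" where
  "operands (Lin c r a s b) = {a, b}"
| "operands (Mul a b) = {a, b}"
| "operands (Inv s a) = {a}"
| "operands (Root a) = {a}"

text \<open>The error enters the numerator of a reciprocal and the radicand of a root, so that it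
  stands alone after denominators and roots have been cleared.\<close>

primrec instr_value :: "instr \<Rightarrow> real \<Rightarrow> (nat \<Rightarrow> real) \<Rightarrow> real" where
  "instr_value (Lin c r a s b) e z = c + r * z a + s * z b + e"
| "instr_value (Mul a b) e z = z a * z b + e"
| "instr_value (Inv s a) e z = (1 + e) / z a"
| "instr_value (Root a) e z = sqrt (z a + e)"

text \<open>Strict also for roots: the domain is then open and all values are analytic on it. A
  radicand that vanishes identically is treated by another instruction.\<close>

primrec admissible :: "instr \<Rightarrow> real \<Rightarrow> (nat \<Rightarrow> real) \<Rightarrow> bool" where
  "admissible (Lin c r a s b) e z \<longleftrightarrow> True"
| "admissible (Mul a b) e z \<longleftrightarrow> True"
| "admissible (Inv s a) e z \<longleftrightarrow> s * z a > 0"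
| "admissible (Root a) e z \<longleftrightarrow> z a + e > 0"

text \<open>The closed counterpart of \<open>admissible\<close> for error 0. With a positive margin
  the instructions remain continuous, and limits of admissible points stay in the domain.\<close>

primrec admissible_margin :: "real \<Rightarrow> instr \<Rightarrow> (nat \<Rightarrow> real) \<Rightarrow> bool" where
  "admissible_margin \<beta> (Lin c r a s b) z \<longleftrightarrow> True"
| "admissible_margin \<beta> (Mul a b) z \<longleftrightarrow> True"
| "admissible_margin \<beta> (Inv s a) z \<longleftrightarrow> s * z a \<ge> \<beta>"
| "admissible_margin \<beta> (Root a) z \<longleftrightarrow> z a \<ge> \<beta>"

text \<open>If instruction \<open>i\<close> writes variable \<open>k\<close> with error \<open>e\<close>, then \<open>residual i k z = e\<close>. Every
  residual is a quadratic polynomial, and the errors are the perturbation parameters.\<close>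

primrec residual :: "instr \<Rightarrow> nat \<Rightarrow> (nat \<Rightarrow> real) \<Rightarrow> real" where
  "residual (Lin c r a s b) k z = z k - (c + r * z a + s * z b)"
| "residual (Mul a b) k z = z k - z a * z b"
| "residual (Inv s a) k z = z k * z a - 1"
| "residual (Root a) k z = z k * z k - z a"

definition delta :: "nat \<Rightarrow> nat \<Rightarrow> real" where
  "delta i j = (if j = i then 1 else 0)"

primrec residual_deriv :: "instr \<Rightarrow> nat \<Rightarrow> (nat \<Rightarrow> real) \<Rightarrow> nat \<Rightarrow> real" where
  "residual_deriv (Lin c r a s b) k z j = delta k j - (r * delta a j + s * delta b j)"
| "residual_deriv (Mul a b) k z j = delta k j - (delta a j * z b + delta b j * z a)"
| "residual_deriv (Inv s a) k z j = delta k j * z a + delta a j * z k"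
| "residual_deriv (Root a) k z j = delta k j * (2 * z k) - delta a j"

primrec exec :: "instr list \<Rightarrow> nat \<Rightarrow> (nat \<Rightarrow> real) \<Rightarrow> (nat \<Rightarrow> real) \<Rightarrow> nat \<Rightarrow> real" where
  "exec [] k \<epsilon> z = z"
| "exec (i # p) k \<epsilon> z = exec p (Suc k) \<epsilon> (z(k := instr_value i (\<epsilon> k) z))"

primrec exec_defined :: "instr list \<Rightarrow> nat \<Rightarrow> (nat \<Rightarrow> real) \<Rightarrow> (nat \<Rightarrow> real) \<Rightarrow> bool" where
  "exec_defined [] k \<epsilon> z \<longleftrightarrow> True"
| "exec_defined (i # p) k \<epsilon> z \<longleftrightarrow> admissible i (\<epsilon> k) z \<and> exec_defined p (Suc k) \<epsilon> (z(k := instr_value i (\<epsilon> k) z))"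

primrec exec_margin :: "real \<Rightarrow> instr list \<Rightarrow> nat \<Rightarrow> (nat \<Rightarrow> real) \<Rightarrow> bool" where
  "exec_margin \<beta> [] k z \<longleftrightarrow> True"
| "exec_margin \<beta> (i # p) k z \<longleftrightarrow> admissible_margin \<beta> i z \<and> exec_margin \<beta> p (Suc k) (z(k := instr_value i 0 z))"

primrec wf_prog :: "nat \<Rightarrow> instr list \<Rightarrow> bool" where
  "wf_prog k [] \<longleftrightarrow> True"
| "wf_prog k (i # p) \<longleftrightarrow> operands i \<subseteq> {..<k} \<and> wf_prog (Suc k) p"

section \<open>Instructions verified on the final values\<close>

lemma wf_prog_nth: "wf_prog k p \<Longrightarrow> i < length p \<Longrightarrow> operands (p ! i) \<subseteq> {..<k + i}"
proof (induction p arbitrary: k i)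
  case (Cons a p)
  then show ?case by (cases i) force+
qed simp

lemma exec_below: "i < k \<Longrightarrow> exec p k \<epsilon> z i = z i"
  by (induction p arbitrary: k z) auto

lemma admissible_cong: "(\<And>a. a \<in> operands i \<Longrightarrow> z a = z' a) \<Longrightarrow> admissible i e z = admissible i e z'"
  by (cases i) auto

lemma admissible_margin_cong: "(\<And>a. a \<in> operands i \<Longrightarrow> z a = z' a) \<Longrightarrow> admissible_margin \<beta> i z = admissible_margin \<beta> i z'"
  by (cases i) auto

lemma instr_value_cong: "(\<And>a. a \<in> operands i \<Longrightarrow> z a = z' a) \<Longrightarrow> instr_value i e z = instr_value i e z'"
  by (cases i) auto

lemma residual_instr_value:
  assumes "admissible i e z" "operands i \<subseteq> {..<k}" "z k = instr_value i e z"
  shows "residual i k z = e"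
  using assms by (cases i) auto

text \<open>Operands have smaller indices than the variable being written, and the run never writes
  to them again. Every instruction may therefore be checked on the final values, which is what turns
  a run into a system of equations.\<close>

lemma exec_nth:
  assumes "exec_defined p k \<epsilon> z" "wf_prog k p" "i < length p"
  defines "y \<equiv> exec p k \<epsilon> z"
  shows "admissible (p ! i) (\<epsilon> (k + i)) y \<and> y (k + i) = instr_value (p ! i) (\<epsilon> (k + i)) y"
  using assms(1-3) unfolding y_def
proof (induction p arbitrary: k z i)
  case (Cons q p)
  show ?case
  proof (cases i)
    case 0
    let ?y = "exec (q # p) k \<epsilon> z"
    have "?y a = z a" if "a \<in> operands q" for a
      using that Cons.prems(2) by (auto simp: exec_below)
    then have "admissible q (\<epsilon> k) ?y = admissible q (\<epsilon> k) z" "instr_value q (\<epsilon> k) ?y = instr_value q (\<epsilon> k) z"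
      by - (rule admissible_cong instr_value_cong, blast)+
    moreover have "?y k = instr_value q (\<epsilon> k) z" by (simp add: exec_below)
    ultimately show ?thesis using Cons.prems(1) 0 by simp
  next
    case (Suc j)
    then show ?thesis using Cons.IH[of "Suc k" "z(k := instr_value q (\<epsilon> k) z)" j] Cons.prems by (simp del: fun_upd_apply)
  qed
qed simp

lemma exec_residual:
  assumes "exec_defined p k \<epsilon> z" "wf_prog k p" "i < length p"
  shows "residual (p ! i) (k + i) (exec p k \<epsilon> z) = \<epsilon> (k + i)"
  using residual_instr_value exec_nth[OF assms] wf_prog_nth[OF assms(2,3)] by blast

text \<open>Together with \<open>residual_deriv_above\<close> this makes the Jacobian of the
  residuals in the computed variables triangular with nonzero diagonal. Lagrange multipliers then
  exist without any rank condition.\<close>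

lemma residual_deriv_diag_nonzero:
  assumes "admissible i e z" "operands i \<subseteq> {..<k}" "z k = instr_value i e z"
  shows "residual_deriv i k z k \<noteq> 0"
  using assms by (cases i) (auto simp: delta_def)

lemma residual_deriv_above:
  assumes "operands i \<subseteq> {..<k}" "k < j"
  shows "residual_deriv i k z j = 0"
  using assms by (cases i) (auto simp: delta_def)

section \<open>Differentiability, continuity and domains of runs\<close>

lemma sum_delta: "i < L \<Longrightarrow> (\<Sum>j<L. delta i j * f j) = f i"
  by (simp add: delta_def if_distrib[of "\<lambda>x. x * _"] cong: if_cong)

lemma residual_has_derivative_along:
  assumes "\<And>j. ((\<lambda>t. z t j) has_real_derivative z' j) (at t0)"
    and "k < L" "operands i \<subseteq> {..<L}"
  shows "((\<lambda>t. residual i k (z t)) has_real_derivative (\<Sum>j<L. residual_deriv i k (z t0) j * z' j)) (at t0)"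
proof -
  note d = sum_subtractf sum.distrib left_diff_distrib distrib_right sum_distrib_left[symmetric]
  have e: "(\<Sum>j<L. delta a j * f j * g j) = f a * g a" if "a < L" for a f g
    using sum_delta[OF that, of "\<lambda>j. f j * g j"] by (simp add: mult.assoc)
  have e': "(\<Sum>j<L. delta a j * c * g j) = c * g a" if "a < L" for a c g
    using sum_delta[OF that, of "\<lambda>j. c * g j"] by (simp add: mult.assoc)
  have e'': "(\<Sum>j<L. c * delta a j * g j) = c * g a" if "a < L" for a c g
    using e'[OF that] by (simp add: mult.commute)
  show ?thesis
    using assms(2,3)
    by (cases i) (auto intro!: derivative_eq_intros assms(1) simp: d e' e'' sum_delta)
qed

lemma exec_differentiable:
  assumes "\<And>i. (\<lambda>t. z t i) differentiable (at t0)" "exec_defined p k \<epsilon> (z t0)"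
  shows "(\<lambda>t. exec p k \<epsilon> (z t) i) differentiable (at (t0::real))"
  using assms
proof (induction p arbitrary: k z)
  case (Cons q p)
  have "(\<lambda>t. instr_value q (\<epsilon> k) (z t)) differentiable (at t0)"
  proof (cases q)
    case (Inv s a)
    then show ?thesis using Cons.prems by (auto intro!: derivative_intros)
  next
    case (Root a)
    have "(\<lambda>t. z t a + \<epsilon> k) differentiable (at t0)" using Cons.prems(1) by (auto intro!: derivative_intros)
    then obtain D where "((\<lambda>t. z t a + \<epsilon> k) has_real_derivative D) (at t0)"
      by (auto simp: real_differentiable_def)
    moreover have "z t0 a + \<epsilon> k > 0" using Cons.prems(2) Root by simp
    ultimately have "((\<lambda>t. sqrt (z t a + \<epsilon> k)) has_real_derivative inverse (sqrt (z t0 a + \<epsilon> k)) / 2 * D) (at t0)"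
      using DERIV_chain2[OF DERIV_real_sqrt, of "\<lambda>t. z t a + \<epsilon> k" t0 D UNIV] by simp
    then show ?thesis unfolding Root instr_value.simps real_differentiable_def by blast
  qed (use Cons.prems in \<open>auto intro!: derivative_intros\<close>)
  then have "(\<lambda>t. ((z t)(k := instr_value q (\<epsilon> k) (z t))) i) differentiable (at t0)" for i
    using Cons.prems(1) by (cases "i = k") auto
  from Cons.IH[of "\<lambda>t. (z t)(k := instr_value q (\<epsilon> k) (z t))", OF this] Cons.prems(2) show ?case by (simp del: fun_upd_apply)
qed simp

text \<open>The errors may vary together with the inputs, as the tube argument for perturbed minima
  requires. Openness and continuity are proved in one induction, since the domain of an instruction
  is cut out by values computed earlier.\<close>

lemma exec_continuous:
  fixes z :: "'a :: topological_space \<Rightarrow> nat \<Rightarrow> real"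
  assumes "open U" "\<And>i. continuous_on U (\<lambda>y. z y i)" "\<And>i. continuous_on U (\<lambda>y. \<epsilon> y i)"
  shows "open {y\<in>U. exec_defined p k (\<epsilon> y) (z y)}"
    and "continuous_on {y\<in>U. exec_defined p k (\<epsilon> y) (z y)} (\<lambda>y. exec p k (\<epsilon> y) (z y) i)"
proof -
  have "open {y\<in>U. exec_defined p k (\<epsilon> y) (z y)} \<and>
    continuous_on {y\<in>U. exec_defined p k (\<epsilon> y) (z y)} (\<lambda>y. exec p k (\<epsilon> y) (z y) i)"
    using assms
  proof (induction p arbitrary: k z U)
    case (Cons q p)
    define U' where "U' = {y\<in>U. admissible q (\<epsilon> y k) (z y)}"
    have *: "open {y \<in> U. 0 < f y}" if "continuous_on U f" for f :: "'a \<Rightarrow> real"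
    proof -
      have "{y \<in> U. 0 < f y} = U \<inter> f -` {0<..}" by auto
      then show ?thesis using that Cons.prems(1) by (simp add: continuous_on_open_vimage Int_commute)
    qed
    have "open U'" unfolding U'_def
      by (cases q) (auto intro!: * continuous_intros Cons.prems)
    moreover have c: "continuous_on U' (\<lambda>y. z y i)" "continuous_on U' (\<lambda>y. \<epsilon> y i)" for i
      using Cons.prems(2,3)[of i] by (auto intro: continuous_on_subset simp: U'_def)
    moreover have "admissible q (\<epsilon> y k) (z y)" if "y \<in> U'" for y using that by (simp add: U'_def)
    then have "continuous_on U' (\<lambda>y. instr_value q (\<epsilon> y k) (z y))"
      by (cases q) (force intro!: continuous_intros c)+
    then have "continuous_on U' (\<lambda>y. ((z y)(k := instr_value q (\<epsilon> y k) (z y))) i)" for i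
      using c by (cases "i = k") auto
    ultimately have "open {y\<in>U'. exec_defined p (Suc k) (\<epsilon> y) ((z y)(k := instr_value q (\<epsilon> y k) (z y)))} \<and>
       continuous_on {y\<in>U'. exec_defined p (Suc k) (\<epsilon> y) ((z y)(k := instr_value q (\<epsilon> y k) (z y)))}
         (\<lambda>y. exec p (Suc k) (\<epsilon> y) ((z y)(k := instr_value q (\<epsilon> y k) (z y))) i)"
      by (intro Cons.IH) auto
    then show ?case by (simp add: U'_def conj_assoc del: fun_upd_apply)
  qed simp
  then show "open {y\<in>U. exec_defined p k (\<epsilon> y) (z y)}"
    "continuous_on {y\<in>U. exec_defined p k (\<epsilon> y) (z y)} (\<lambda>y. exec p k (\<epsilon> y) (z y) i)" by auto
qed

text \<open>The analogue for weak inequalities, which cut out closed sets; this yields closed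
  sublevel sets in a domain that is itself open.\<close>

lemma exec_margin_closed:
  fixes z :: "'a :: topological_space \<Rightarrow> nat \<Rightarrow> real"
  assumes "\<beta> > 0" "closed U" "\<And>i. continuous_on U (\<lambda>y. z y i)"
  shows "closed {y\<in>U. exec_margin \<beta> p k (z y)}"
    and "continuous_on {y\<in>U. exec_margin \<beta> p k (z y)} (\<lambda>y. exec p k (\<lambda>_. 0) (z y) i)"
proof -
  have "closed {y\<in>U. exec_margin \<beta> p k (z y)} \<and>
    continuous_on {y\<in>U. exec_margin \<beta> p k (z y)} (\<lambda>y. exec p k (\<lambda>_. 0) (z y) i)"
    using assms(2,3)
  proof (induction p arbitrary: k z U)
    case (Cons q p)
    define U' where "U' = {y\<in>U. admissible_margin \<beta> q (z y)}"
    have *: "closed {y \<in> U. \<beta> \<le> f y}" if "continuous_on U f" for f :: "'a \<Rightarrow> real"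
    proof -
      have "{y \<in> U. \<beta> \<le> f y} = f -` {\<beta>..} \<inter> U" by auto
      then show ?thesis using that Cons.prems(1) by (simp add: continuous_on_closed_vimage)
    qed
    have "closed U'" unfolding U'_def
      by (cases q) (auto intro!: * continuous_intros Cons.prems)
    moreover have c: "continuous_on U' (\<lambda>y. z y i)" for i
      using Cons.prems(2)[of i] by (auto intro: continuous_on_subset simp: U'_def)
    moreover have "admissible_margin \<beta> q (z y)" if "y \<in> U'" for y using that by (simp add: U'_def)
    then have "continuous_on U' (\<lambda>y. instr_value q 0 (z y))"
      using assms(1) by (cases q) (force intro!: continuous_intros c)+
    then have "continuous_on U' (\<lambda>y. ((z y)(k := instr_value q 0 (z y))) i)" for i
      using c by (cases "i = k") auto
    ultimately have "closed {y\<in>U'. exec_margin \<beta> p (Suc k) ((z y)(k := instr_value q 0 (z y)))} \<and>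
       continuous_on {y\<in>U'. exec_margin \<beta> p (Suc k) ((z y)(k := instr_value q 0 (z y)))}
         (\<lambda>y. exec p (Suc k) (\<lambda>_. 0) ((z y)(k := instr_value q 0 (z y))) i)"
      by (intro Cons.IH) auto
    then show ?case by (simp add: U'_def conj_assoc del: fun_upd_apply)
  qed simp
  then show "closed {y\<in>U. exec_margin \<beta> p k (z y)}"
    "continuous_on {y\<in>U. exec_margin \<beta> p k (z y)} (\<lambda>y. exec p k (\<lambda>_. 0) (z y) i)" by auto
qed

lemma exec_margin_defined: "\<beta> > 0 \<Longrightarrow> exec_margin \<beta> p k z \<Longrightarrow> exec_defined p k (\<lambda>_. 0) z"
proof (induction p arbitrary: k z)
  case (Cons q p)
  then have "admissible q 0 z" by (cases q) auto
  with Cons show ?case by (simp del: fun_upd_apply)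
qed simp

lemma exec_marginI:
  assumes "exec_defined p k (\<lambda>_. 0) z" "wf_prog k p"
    and "\<And>i. i < length p \<Longrightarrow> admissible_margin \<beta> (p ! i) (exec p k (\<lambda>_. 0) z)"
  shows "exec_margin \<beta> p k z"
  using assms
proof (induction p arbitrary: k z)
  case (Cons q p)
  have "z a = exec (q # p) k (\<lambda>_. 0) z a" if "a \<in> operands q" for a
    using that Cons.prems(2) by (auto simp: exec_below)
  then have "admissible_margin \<beta> q z"
    using Cons.prems(3)[of 0] admissible_margin_cong[of q z] by (simp del: exec.simps)
  moreover have "exec_margin \<beta> p (Suc k) (z(k := instr_value q 0 z))"
  proof (rule Cons.IH)
    fix i assume "i < length p"
    then show "admissible_margin \<beta> (p ! i) (exec p (Suc k) (\<lambda>_. 0) (z(k := instr_value q 0 z)))"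
      using Cons.prems(3)[of "Suc i"] by (simp del: fun_upd_apply)
  qed (use Cons.prems in \<open>simp_all del: fun_upd_apply\<close>)
  ultimately show ?case by (simp del: fun_upd_apply)
qed simp

section \<open>Holomorphic extension and the identity theorem\<close>

text \<open>Real analyticity at \<open>s\<close>, phrased by a complex extension to a disc so that
  the identity theorem for holomorphic functions applies.\<close>

definition holomorphic_extension :: "(real \<Rightarrow> real) \<Rightarrow> real \<Rightarrow> bool" where
  "holomorphic_extension f s \<longleftrightarrow> (\<exists>r>0. \<exists>F. F holomorphic_on ball (of_real s) r \<and>
     (\<forall>t. \<bar>t - s\<bar> < r \<longrightarrow> F (of_real t) = of_real (f t)))"

section \<open>Closure properties of analyticity\<close>

lemma holomorphic_extension_const: "holomorphic_extension (\<lambda>_. c) s"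
  unfolding holomorphic_extension_def by (intro exI[of _ 1] conjI exI[of _ "\<lambda>_. of_real c"]) auto

lemma holomorphic_extension_ident: "holomorphic_extension (\<lambda>t. t) s"
  unfolding holomorphic_extension_def by (intro exI[of _ 1] conjI exI[of _ "\<lambda>z. z"]) auto

lemma holomorphic_extension_binary:
  assumes "holomorphic_extension f s" "holomorphic_extension g s"
    and H: "\<And>F G A. F holomorphic_on A \<Longrightarrow> G holomorphic_on A \<Longrightarrow> (\<lambda>z. H (F z) (G z)) holomorphic_on A"
    and h: "\<And>x y. H (of_real x) (of_real y) = of_real (h x y)"
  shows "holomorphic_extension (\<lambda>t. h (f t) (g t)) s"
proof -
  obtain r F where F: "r > 0" "F holomorphic_on ball (of_real s) r" "\<And>t. \<bar>t - s\<bar> < r \<Longrightarrow> F (of_real t) = of_real (f t)"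
    using assms(1) unfolding holomorphic_extension_def by blast
  obtain q G where G: "q > 0" "G holomorphic_on ball (of_real s) q" "\<And>t. \<bar>t - s\<bar> < q \<Longrightarrow> G (of_real t) = of_real (g t)"
    using assms(2) unfolding holomorphic_extension_def by blast
  have "(\<lambda>z. H (F z) (G z)) holomorphic_on ball (of_real s) (min r q)"
    by (rule H) (use F G in \<open>auto intro: holomorphic_on_subset\<close>)
  then show ?thesis unfolding holomorphic_extension_def
    by (intro exI[of _ "min r q"] conjI exI[of _ "\<lambda>z. H (F z) (G z)"]) (use F G h in auto)
qed

lemma holomorphic_extension_add: "holomorphic_extension f s \<Longrightarrow> holomorphic_extension g s \<Longrightarrow> holomorphic_extension (\<lambda>t. f t + g t) s"
  by (rule holomorphic_extension_binary[where H = "(+)"]) (auto intro: holomorphic_intros)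

lemma holomorphic_extension_diff: "holomorphic_extension f s \<Longrightarrow> holomorphic_extension g s \<Longrightarrow> holomorphic_extension (\<lambda>t. f t - g t) s"
  by (rule holomorphic_extension_binary[where H = "(-)"]) (auto intro: holomorphic_intros)

lemma holomorphic_extension_mult: "holomorphic_extension f s \<Longrightarrow> holomorphic_extension g s \<Longrightarrow> holomorphic_extension (\<lambda>t. f t * g t) s"
  by (rule holomorphic_extension_binary[where H = "(*)"]) (auto intro: holomorphic_intros)

lemma holomorphic_extension_sum: "(\<And>i. i \<in> I \<Longrightarrow> holomorphic_extension (f i) s) \<Longrightarrow> holomorphic_extension (\<lambda>t. \<Sum>i\<in>I. f i t) s"
  by (induction I rule: infinite_finite_induct) (auto intro: holomorphic_extension_const holomorphic_extension_add)

lemma holomorphic_extension_compose: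
  assumes "holomorphic_extension f s" "open A" "of_real (f s) \<in> A" "H holomorphic_on A"
    and h: "\<And>x. of_real x \<in> A \<Longrightarrow> H (of_real x) = of_real (h x)"
  shows "holomorphic_extension (\<lambda>t. h (f t)) s"
proof -
  obtain r F where F: "r > 0" "F holomorphic_on ball (of_real s) r" "\<And>t. \<bar>t - s\<bar> < r \<Longrightarrow> F (of_real t) = of_real (f t)"
    using assms(1) unfolding holomorphic_extension_def by blast
  have "open (F -` A \<inter> ball (of_real s) r)"
    using continuous_open_preimage[OF holomorphic_on_imp_continuous_on[OF F(2)] open_ball assms(2)]
    by (simp add: Int_commute)
  moreover have "of_real s \<in> F -` A \<inter> ball (of_real s) r" using F(1) F(3)[of s] assms(3) by simp
  ultimately obtain q where q: "q > 0" "ball (of_real s) q \<subseteq> F -` A \<inter> ball (of_real s) r"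
    using openE by blast
  have "(\<lambda>z. H (F z)) holomorphic_on ball (of_real s) q"
    using holomorphic_on_compose_gen[of F "ball (of_real s) q" H A] F(2) assms(4) q(2)
    by (auto simp: o_def intro: holomorphic_on_subset)
  moreover have "H (F (of_real t)) = of_real (h (f t))" if "\<bar>t - s\<bar> < q" for t
  proof -
    have "(of_real t :: complex) \<in> ball (of_real s) q"
      using that by (simp add: dist_norm norm_minus_commute flip: of_real_diff)
    then have "of_real t \<in> F -` A \<inter> ball (of_real s) r" using q(2) by blast
    then show ?thesis using F(3)[of t] h
      by (auto simp: dist_norm norm_minus_commute simp flip: of_real_diff)
  qed
  ultimately show ?thesis using q(1) unfolding holomorphic_extension_def by blast
qed

lemma holomorphic_extension_inverse: "holomorphic_extension f s \<Longrightarrow> f s \<noteq> 0 \<Longrightarrow> holomorphic_extension (\<lambda>t. 1 / f t) s"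
  by (rule holomorphic_extension_compose[where A = "- {0}" and H = "\<lambda>z. 1 / z"]) (auto intro!: holomorphic_intros)

lemma holomorphic_extension_sqrt: "holomorphic_extension f s \<Longrightarrow> f s > 0 \<Longrightarrow> holomorphic_extension (\<lambda>t. sqrt (f t)) s"
  by (rule holomorphic_extension_compose[where A = "{z. Re z > 0}" and H = csqrt])
    (auto intro!: holomorphic_intros simp: open_halfspace_Re_gt complex_nonpos_Reals_iff)

lemma exec_holomorphic_extension:
  assumes "\<And>i. holomorphic_extension (\<lambda>t. z t i) s" "exec_defined p k (\<lambda>_. 0) (z s)"
  shows "holomorphic_extension (\<lambda>t. exec p k (\<lambda>_. 0) (z t) i) s"
  using assms
proof (induction p arbitrary: k z)
  case (Cons q p)
  have "holomorphic_extension (\<lambda>t. instr_value q 0 (z t)) s"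
    using Cons.prems
    by (cases q) (auto intro!: holomorphic_extension_add holomorphic_extension_mult holomorphic_extension_const holomorphic_extension_inverse holomorphic_extension_sqrt)
  then have "holomorphic_extension (\<lambda>t. ((z t)(k := instr_value q 0 (z t))) i) s" for i
    using Cons.prems(1) by (cases "i = k") auto
  from Cons.IH[of "\<lambda>t. (z t)(k := instr_value q 0 (z t))", OF this] Cons.prems(2) show ?case by (simp del: fun_upd_apply)
qed simp

text \<open>Some point \<open>t\<close> in the disc around \<open>s\<close> has a whole real
  interval of zeros, so the holomorphic extension vanishes on the entire disc.\<close>

lemma holomorphic_extension_zero_propagates:
  assumes ext: "holomorphic_extension f s" and r: "\<And>r. r > 0 \<Longrightarrow> \<exists>t. \<bar>t - s\<bar> < r \<and> (\<forall>\<^sub>F u in nhds t. f u = 0)"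
  shows "\<forall>\<^sub>F u in nhds s. f u = 0"
proof -
  obtain r F where F: "r > 0" "F holomorphic_on ball (of_real s) r" "\<And>t. \<bar>t - s\<bar> < r \<Longrightarrow> F (of_real t) = of_real (f t)"
    using ext unfolding holomorphic_extension_def by blast
  have ball: "(of_real u :: complex) \<in> ball (of_real s) r \<longleftrightarrow> \<bar>u - s\<bar> < r" for u
    by (simp add: dist_norm norm_minus_commute abs_minus_commute flip: of_real_diff)
  obtain t where t: "\<bar>t - s\<bar> < r" "\<forall>\<^sub>F u in nhds t. f u = 0" using r[OF F(1)] by blast
  then obtain d where d: "d > 0" "\<And>u. \<bar>u - t\<bar> < d \<Longrightarrow> f u = 0"
    by (auto simp: eventually_nhds_metric dist_real_def)
  define U where "U = complex_of_real ` {u. \<bar>u - t\<bar> < d \<and> \<bar>u - s\<bar> < r}"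
  have "complex_of_real t islimpt U"
    unfolding islimpt_approachable
  proof (intro allI impI)
    fix e :: real assume "e > 0"
    \<comment> \<open>A point to the right of \<open>t\<close>, closer than \<open>e\<close> and
      \<open>d\<close> and still inside the disc around \<open>s\<close>.\<close>
    define u where "u = t + min e (min d (r - \<bar>t - s\<bar>)) / 2"
    have "u \<noteq> t" "\<bar>u - t\<bar> < e" "\<bar>u - t\<bar> < d" "\<bar>u - s\<bar> < r"
      using \<open>e > 0\<close> d(1) t(1) unfolding u_def by (auto simp: min_def abs_if field_simps split: if_splits)
    then show "\<exists>x'\<in>U. x' \<noteq> complex_of_real t \<and> dist x' (complex_of_real t) < e"
      by (intro bexI[of _ "of_real u"]) (auto simp: U_def dist_norm simp flip: of_real_diff)
  qed
  note limit = this
  have zero: "F z = 0" if "z \<in> ball (of_real s) r" for z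
  proof (rule analytic_continuation[OF F(2) open_ball connected_ball _ _ limit _ that])
    show "U \<subseteq> ball (of_real s) r" "complex_of_real t \<in> ball (of_real s) r"
      using ball t(1) by (auto simp: U_def simp del: mem_ball)
    show "F w = 0" if "w \<in> U" for w using that d(2) F(3) by (auto simp: U_def)
  qed
  have "f u = 0" if "\<bar>u - s\<bar> < r" for u
    using zero[of "of_real u"] ball[of u] F(3)[OF that] that by simp
  then show ?thesis using F(1) by (auto simp: eventually_nhds_metric dist_real_def)
qed

text \<open>The points near which \<open>f\<close> vanishes form a relatively open and, by the
  previous lemma, relatively closed subset of the connected unit interval.\<close>

lemma holomorphic_extension_zero_on_interval:
  assumes "\<And>s. 0 \<le> s \<Longrightarrow> s \<le> 1 \<Longrightarrow> holomorphic_extension f s" "\<forall>\<^sub>F u in nhds 0. f u = 0"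
  shows "f 1 = 0"
proof -
  define Z where "Z = {s\<in>{0..1}. \<forall>\<^sub>F u in nhds s. f u = 0}"
  have "openin (top_of_set {0..1}) Z"
  proof -
    have "Z = {0..1} \<inter> {s. \<forall>\<^sub>F u in nhds s. f u = 0}" by (auto simp: Z_def)
    moreover have "open {s. \<forall>\<^sub>F u in nhds s. f u = 0}"
      by (subst open_subopen) (auto simp: eventually_nhds)
    ultimately show ?thesis by (auto simp: openin_open)
  qed
  moreover have "closedin (top_of_set {0..1}) Z"
  proof -
    have "x \<in> Z" if "x islimpt Z" "x \<in> {0..1}" for x
    proof -
      have "\<forall>\<^sub>F u in nhds x. f u = 0"
      proof (rule holomorphic_extension_zero_propagates)
        show "holomorphic_extension f x" using assms(1) that(2) by simp
        show "\<exists>t. \<bar>t - x\<bar> < r \<and> (\<forall>\<^sub>F u in nhds t. f u = 0)" if "r > 0" for r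
          using \<open>x islimpt Z\<close> that by (auto simp: islimpt_approachable Z_def dist_real_def)
      qed
      then show ?thesis using that(2) by (simp add: Z_def)
    qed
    then show ?thesis unfolding closedin_limpt by (auto simp: Z_def)
  qed
  moreover have "0 \<in> Z" using assms(2) by (simp add: Z_def)
  moreover have "connected {0..1::real}" by simp
  ultimately have "Z = {0..1}" unfolding connected_clopen by blast
  then have "1 \<in> Z" by simp
  then have "\<forall>\<^sub>F u in nhds 1. f u = 0" unfolding Z_def by blast
  then show ?thesis by (rule eventually_nhds_x_imp_x)
qed

section \<open>The identity theorem along segments\<close>

definition line_point :: "(nat \<Rightarrow> real) \<Rightarrow> (nat \<Rightarrow> real) \<Rightarrow> real \<Rightarrow> nat \<Rightarrow> real" where
  "line_point p q s i = p i + s * (q i - p i)"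

lemma continuous_line_point: "continuous_on UNIV (line_point p q)"
  by (rule continuous_on_coordinatewise_then_product) (auto simp: line_point_def intro!: continuous_intros)

lemma holomorphic_extension_line_point: "holomorphic_extension (\<lambda>t. line_point p q t i) s"
  unfolding line_point_def by (intro holomorphic_extension_add holomorphic_extension_mult holomorphic_extension_const holomorphic_extension_ident)

text \<open>In the product topology a box with intervals in finitely many coordinates and no
  restriction elsewhere takes the role of a convex ball.\<close>

lemma segment_neighbourhood:
  assumes "open D" "x \<in> D"
  obtains B where "open B" "x \<in> B" "B \<subseteq> D"
    "\<And>p q s. p \<in> B \<Longrightarrow> q \<in> B \<Longrightarrow> 0 \<le> s \<Longrightarrow> s \<le> 1 \<Longrightarrow> line_point p q s \<in> B"
proof -
  have "openin (product_topology (\<lambda>i. euclidean) UNIV) D"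
    using assms(1) by (simp add: euclidean_product_topology)
  from product_topology_open_contains_basis[OF this assms(2)]
  obtain A where A: "x \<in> PiE UNIV A" "\<And>i. open (A i)" "finite {i. A i \<noteq> UNIV}" "PiE UNIV A \<subseteq> D"
    by auto
  have "\<exists>e>0. ball (x i) e \<subseteq> A i" for i
    using A(1,2) by (auto simp: PiE_iff intro: openE)
  then obtain e where e: "\<And>i. e i > 0" "\<And>i. ball (x i) (e i) \<subseteq> A i" by metis
  define C where "C = (\<lambda>i. if A i = UNIV then UNIV else ball (x i) (e i))"
  have convex: "convex (C i)" for i by (simp add: C_def)
  show ?thesis
  proof (rule that[of "PiE UNIV C"])
    have "{i. C i \<noteq> UNIV} \<subseteq> {i. A i \<noteq> UNIV}" by (auto simp: C_def)
    then have "finite {i. C i \<noteq> UNIV}" using A(3) finite_subset by blast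
    then show "open (PiE UNIV C)" by (intro open_PiE) (simp add: C_def)
    show "x \<in> PiE UNIV C" using e(1) by (auto simp: C_def PiE_iff)
    have "C i \<subseteq> A i" for i using e(2) by (simp add: C_def)
    then have "PiE UNIV C \<subseteq> PiE UNIV A" by (rule PiE_mono)
    with A(4) show "PiE UNIV C \<subseteq> D" by (rule order_trans[rotated])
    fix p q s assume pq: "p \<in> PiE UNIV C" "q \<in> PiE UNIV C" and s: "(0::real) \<le> s" "s \<le> 1"
    have "line_point p q s i \<in> C i" for i
    proof -
      have "(1 - s) *\<^sub>R p i + s *\<^sub>R q i \<in> C i"
        using convexD_alt[OF convex[of i]] pq s by (auto simp: PiE_iff)
      then show ?thesis by (simp add: line_point_def algebra_simps)
    qed
    then show "line_point p q s \<in> PiE UNIV C" by (auto simp: PiE_iff)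
  qed
qed

text \<open>Reduces the identity theorem in many variables to one variable: near its start the
  segment runs inside the open set where \<open>h\<close> vanishes.\<close>

lemma vanishing_along_segment:
  assumes N: "open N" "p \<in> N" "\<And>y. y \<in> N \<Longrightarrow> h y = 0"
    and ext: "\<And>s. 0 \<le> s \<Longrightarrow> s \<le> 1 \<Longrightarrow> holomorphic_extension (\<lambda>t. h (line_point p q t)) s"
  shows "h q = 0"
proof -
  have "open (line_point p q -` N)"
    using continuous_on_open_vimage[of UNIV "line_point p q"] continuous_line_point N(1) by simp
  moreover have "0 \<in> line_point p q -` N" using N(2) by (simp add: line_point_def[abs_def])
  ultimately have "\<forall>\<^sub>F t in nhds 0. h (line_point p q t) = 0"
    using N(3) by (auto simp: eventually_nhds)
  from holomorphic_extension_zero_on_interval[OF ext this] have "h (line_point p q 1) = 0" by simp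
  then show ?thesis by (simp add: line_point_def[abs_def])
qed

section \<open>Perturbed minima and Lagrange systems\<close>

lemma residual_cong: "(\<And>a. a \<in> operands i \<Longrightarrow> z a = z' a) \<Longrightarrow> z k = z' k \<Longrightarrow> residual i k z = residual i k z'"
  by (cases i) auto

lemma residual_deriv_cong: "(\<And>a. a \<in> operands i \<Longrightarrow> z a = z' a) \<Longrightarrow> z k = z' k \<Longrightarrow> residual_deriv i k z j = residual_deriv i k z' j"
  by (cases i) auto

lemma polyfun_residual:
  assumes "k < V" "operands i \<subseteq> {..<V}"
  shows "polyfun V 2 (residual i k)"
proof -
  have mult: "polyfun V 2 (\<lambda>z. z a * z b)" if "a < V" "b < V" for a b
    using polyfun_mult[OF polyfun_var1[OF that(1)] polyfun_var1[OF that(2)]] by (simp add: numeral_2_eq_2)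
  show ?thesis
    using assms
    by (cases i) (auto simp: residual.simps[abs_def] simp del: residual.simps
        intro!: polyfun_diff polyfun_add polyfun_const polyfun_scale polyfun_var mult)
qed

lemma polyfun_residual_deriv:
  assumes "k < V" "operands i \<subseteq> {..<V}"
  shows "polyfun V 1 (\<lambda>z. residual_deriv i k z j)"
  using assms
  by (cases i) (auto intro!: polyfun_diff polyfun_add polyfun_const polyfun_scale polyfun_var)

text \<open>The vector \<open>v\<close> consists of the \<open>L\<close> program variables followed
  by one multiplier per instruction. The first \<open>L\<close> components are the gradient of the
  sum of squares plus the multiplier terms; the remaining ones are the constraints. A derivative of
  a residual has degree at most 1, so the whole system is quadratic.\<close>

definition lagrange :: "nat \<Rightarrow> instr list \<Rightarrow> nat \<Rightarrow> (nat \<Rightarrow> real) \<Rightarrow> real" where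
  "lagrange m p k v = (let L = m + length p in
     if k < L then 2 * v k + (\<Sum>i<length p. v (L + i) * residual_deriv (p ! i) (m + i) v k)
     else residual (p ! (k - L)) (m + (k - L)) v)"

lemma polyfun_lagrange:
  assumes "wf_prog m p" "k < m + 2 * length p"
  shows "polyfun (m + 2 * length p) 2 (lagrange m p k)"
proof (cases "k < m + length p")
  case True
  have "polyfun (m + 2 * length p) 2 (\<lambda>v. v (m + length p + i) * residual_deriv (p ! i) (m + i) v k)" if "i < length p" for i
  proof -
    have "polyfun (m + 2 * length p) 1 (\<lambda>v. v (m + length p + i))"
      "polyfun (m + 2 * length p) 1 (\<lambda>v. residual_deriv (p ! i) (m + i) v k)"
      using that wf_prog_nth[OF assms(1) that]
      by (intro polyfun_var polyfun_residual_deriv; force)+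
    from polyfun_mult[OF this] show ?thesis by (simp only: one_add_one)
  qed
  then have "polyfun (m + 2 * length p) 2
     (\<lambda>v. 2 * v k + (\<Sum>i<length p. v (m + length p + i) * residual_deriv (p ! i) (m + i) v k))"
    using assms(2) by (auto intro!: polyfun_add polyfun_scale polyfun_var polyfun_sum)
  then show ?thesis using True by (simp add: lagrange_def[abs_def])
next
  case False
  define i where "i = k - (m + length p)"
  have "i < length p" using assms(2) False by (simp add: i_def)
  then have "polyfun (m + 2 * length p) 2 (residual (p ! i) (m + i))"
    using wf_prog_nth[OF assms(1), of i] by (auto intro!: polyfun_residual)
  moreover have "lagrange m p k = residual (p ! i) (m + i)"
    using False by (simp add: lagrange_def[abs_def] i_def Let_def)
  ultimately show ?thesis by simp
qed

text \<open>Back substitution: the last equation contains only the last unknown.\<close>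

lemma triangular_system_solvable:
  fixes a :: "nat \<Rightarrow> nat \<Rightarrow> real"
  assumes "\<And>i. i < n \<Longrightarrow> a i i \<noteq> 0" "\<And>i j. j < i \<Longrightarrow> i < n \<Longrightarrow> a i j = 0"
  shows "\<exists>\<mu>. \<forall>i<n. (\<Sum>j<n. \<mu> j * a i j) = b i"
  using assms
proof (induction n arbitrary: b)
  case (Suc n)
  define t where "t = b n / a n n"
  obtain \<mu> where \<mu>: "\<And>i. i < n \<Longrightarrow> (\<Sum>j<n. \<mu> j * a i j) = b i - t * a i n"
    using Suc.IH[of "\<lambda>i. b i - t * a i n"] Suc.prems by auto
  have "(\<Sum>j<Suc n. (\<mu>(n := t)) j * a i j) = b i" if "i < Suc n" for i
  proof -
    have s: "(\<Sum>j<Suc n. (\<mu>(n := t)) j * a i j) = (\<Sum>j<n. \<mu> j * a i j) + t * a i n" by simp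
    show ?thesis
    proof (cases "i = n")
      case True
      then have "(\<Sum>j<n. \<mu> j * a i j) = 0" using Suc.prems(2) by simp
      then show ?thesis using s True Suc.prems(1)[of n] by (simp add: t_def)
    next
      case False
      then show ?thesis using s \<mu>[of i] that by simp
    qed
  qed
  then show ?case by blast
qed simp

text \<open>The parameter \<open>w\<close> of the perturbed problem lists the linear perturbation of the
  objective in its first \<open>m + length p\<close> entries, followed by the errors of the instructions.\<close>

definition errors :: "instr list \<Rightarrow> (nat \<Rightarrow> real) \<Rightarrow> nat \<Rightarrow> real" where
  "errors p w k = w (length p + k)"

definition objective :: "nat \<Rightarrow> instr list \<Rightarrow> (nat \<Rightarrow> real) \<Rightarrow> (nat \<Rightarrow> real) \<Rightarrow> real" where
  "objective m p w x = (\<Sum>k<m + length p. (exec p m (errors p w) x k)\<^sup>2 - w k * exec p m (errors p w) x k)"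

definition shift :: "(nat \<Rightarrow> real) \<Rightarrow> nat \<Rightarrow> real \<Rightarrow> nat \<Rightarrow> real" where
  "shift x i t = x(i := x i + t)"

text \<open>The multipliers are defined by the equations of the computed variables, which form a
  triangular system. The equations of the inputs then follow by shifting one input: the objective
  has derivative 0 at its minimum, and the residuals are constant along the shifted runs.\<close>

lemma critical_point_lagrange:
  assumes wf: "wf_prog m p" and x: "exec_defined p m (errors p w) x"
    and exec_dom: "\<And>i. i < m \<Longrightarrow> \<forall>\<^sub>F t in nhds 0. exec_defined p m (errors p w) (shift x i t)"
    and minim: "\<And>i. i < m \<Longrightarrow> \<forall>\<^sub>F t in nhds 0. objective m p w x \<le> objective m p w (shift x i t)"
  shows "\<exists>v. (\<forall>k<m + 2 * length p. lagrange m p k v = w k) \<and> (\<forall>i<m. v i = x i)"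
proof -
  define M where "M = length p"
  define L where "L = m + M"
  define z where "z = exec p m (errors p w) x"
  define a where "a = (\<lambda>i i'. residual_deriv (p ! i') (m + i') z (m + i))"
  have ops: "operands (p ! i) \<subseteq> {..<m + i}" if "i < M" for i
    using wf_prog_nth[OF wf] that by (simp add: M_def)
  have nth: "admissible (p ! i) (errors p w (m + i)) z" "z (m + i) = instr_value (p ! i) (errors p w (m + i)) z" if "i < M" for i
    using exec_nth[OF x wf] that by (auto simp: M_def z_def)
  have "\<exists>\<mu>. \<forall>i<M. (\<Sum>j<M. \<mu> j * a i j) = w (m + i) - 2 * z (m + i)"
  proof (rule triangular_system_solvable)
    show "a i i \<noteq> 0" if "i < M" for i
      unfolding a_def by (rule residual_deriv_diag_nonzero[OF nth(1)[OF that] ops[OF that] nth(2)[OF that]])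
    show "a i j = 0" if "j < i" "i < M" for i j
      unfolding a_def by (rule residual_deriv_above[OF ops]) (use that in auto)
  qed
  then obtain \<mu> where \<mu>: "\<And>i. i < M \<Longrightarrow> (\<Sum>j<M. \<mu> j * a i j) = w (m + i) - 2 * z (m + i)"
    by blast
  \<comment> \<open>The defect of the Lagrange equation for variable \<open>j\<close>. It vanishes
    for computed variables by the choice of \<open>\<mu>\<close> and has to be shown to vanish for
    inputs.\<close>
  define b where "b = (\<lambda>j. 2 * z j - w j + (\<Sum>i<M. \<mu> i * residual_deriv (p ! i) (m + i) z j))"
  have b_high: "b j = 0" if "m \<le> j" "j < L" for j
    using \<mu>[of "j - m"] that by (simp add: b_def a_def L_def)
  have b_low: "b i = 0" if i: "i < m" for i
  proof -
    define Y where "Y = (\<lambda>t. exec p m (errors p w) (shift x i t))"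
    have Y0: "Y 0 = z" by (simp add: Y_def z_def shift_def)
    have "(\<lambda>t. Y t j) differentiable (at 0)" for j
      unfolding Y_def
    proof (rule exec_differentiable)
      show "(\<lambda>t. shift x i t l) differentiable (at 0)" for l
        by (cases "l = i") (auto simp: shift_def intro!: derivative_intros)
      show "exec_defined p m (errors p w) (shift x i 0)" using x by (simp add: shift_def)
    qed
    then have "\<forall>j. \<exists>D. ((\<lambda>t. Y t j) has_real_derivative D) (at 0)" by (simp add: real_differentiable_def)
    then obtain Y' where Y': "\<And>j. ((\<lambda>t. Y t j) has_real_derivative Y' j) (at 0)" by metis
    have Y'_low: "Y' j = (if j = i then 1 else 0)" if "j < m" for j
    proof -
      have "(\<lambda>t. Y t j) = (\<lambda>t. shift x i t j)" using that by (simp add: Y_def exec_below)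
      moreover have "((\<lambda>t. shift x i t j) has_real_derivative (if j = i then 1 else 0)) (at 0)"
        by (auto simp: shift_def intro!: derivative_eq_intros)
      ultimately show ?thesis using Y'[of j] DERIV_unique by metis
    qed
    \<comment> \<open>Each shifted point is run with the same errors, so every residual keeps its
      value along the curve \<open>Y\<close>.\<close>
    have con0: "(\<Sum>j<L. residual_deriv (p ! l) (m + l) z j * Y' j) = 0" if "l < M" for l
    proof -
      have "((\<lambda>t. residual (p ! l) (m + l) (Y t)) has_real_derivative (\<Sum>j<L. residual_deriv (p ! l) (m + l) (Y 0) j * Y' j)) (at 0)"
        by (rule residual_has_derivative_along[OF Y']) (use that ops[OF that] in \<open>auto simp: L_def\<close>)
      moreover have "((\<lambda>t. residual (p ! l) (m + l) (Y t)) has_real_derivative 0) (at 0)"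
      proof (subst DERIV_cong_ev[OF refl _ refl])
        show "\<forall>\<^sub>F t in nhds 0. residual (p ! l) (m + l) (Y t) = errors p w (m + l)"
          using exec_dom[OF i] by eventually_elim (use exec_residual wf that in \<open>auto simp: Y_def M_def\<close>)
      qed simp
      ultimately show ?thesis using DERIV_unique Y0 by metis
    qed
    have "((\<lambda>t. \<Sum>j<L. (Y t j)\<^sup>2 - w j * Y t j) has_real_derivative (\<Sum>j<L. (2 * z j - w j) * Y' j)) (at 0)"
      by (rule DERIV_sum) (auto intro!: derivative_eq_intros Y' simp: Y0 algebra_simps)
    moreover have "(\<lambda>t. \<Sum>j<L. (Y t j)\<^sup>2 - w j * Y t j) = (\<lambda>t. objective m p w (shift x i t))"
      by (simp add: objective_def Y_def L_def M_def)
    ultimately have D: "((\<lambda>t. objective m p w (shift x i t)) has_real_derivative (\<Sum>j<L. (2 * z j - w j) * Y' j)) (at 0)"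
      by simp
    obtain d where d: "d > 0" "\<And>t. \<bar>t\<bar> < d \<Longrightarrow> objective m p w x \<le> objective m p w (shift x i t)"
      using minim[OF i] by (auto simp: eventually_nhds_metric dist_real_def)
    have "(\<Sum>j<L. (2 * z j - w j) * Y' j) = 0"
      by (rule DERIV_local_min[OF D d(1)]) (use d(2) in \<open>auto simp: shift_def\<close>)
    moreover have swap: "(\<Sum>l<M. \<mu> l * (\<Sum>j<L. residual_deriv (p ! l) (m + l) z j * Y' j))
        = (\<Sum>j<L. (\<Sum>l<M. \<mu> l * residual_deriv (p ! l) (m + l) z j) * Y' j)"
      unfolding sum_distrib_left sum_distrib_right by (subst sum.swap) (simp only: mult.assoc)
    have "(\<Sum>j<L. b j * Y' j) = (\<Sum>j<L. (2 * z j - w j) * Y' j)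
        + (\<Sum>l<M. \<mu> l * (\<Sum>j<L. residual_deriv (p ! l) (m + l) z j * Y' j))"
      unfolding swap by (simp add: b_def distrib_right sum.distrib)
    ultimately have "(\<Sum>j<L. b j * Y' j) = 0" using con0 by simp
    \<comment> \<open>On the computed variables \<open>b\<close> is 0, and on the inputs
      \<open>Y'\<close> is the unit vector of \<open>i\<close>; only the term of \<open>i\<close> is
      left.\<close>
    moreover have "(\<Sum>j<L. b j * Y' j) = (\<Sum>j\<in>{i}. b j * Y' j)"
      using i b_high Y'_low by (intro sum.mono_neutral_right) (auto simp: L_def not_less, metis not_le)
    ultimately show ?thesis using Y'_low[OF i] by simp
  qed
  have b: "b j = 0" if "j < L" for j using b_low b_high that by (cases "j < m") auto
  define v where "v = (\<lambda>k. if k < L then z k else \<mu> (k - L))"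
  have dv: "residual_deriv (p ! i) (m + i) v k = residual_deriv (p ! i) (m + i) z k" if "i < M" for i k
    by (rule residual_deriv_cong) (use ops[OF that] that in \<open>auto simp: v_def L_def\<close>)
  have cv: "residual (p ! i) (m + i) v = residual (p ! i) (m + i) z" if "i < M" for i
    by (rule residual_cong) (use ops[OF that] that in \<open>auto simp: v_def L_def\<close>)
  have "lagrange m p k v = w k" if "k < m + 2 * length p" for k
  proof (cases "k < L")
    case True
    then have "lagrange m p k v = 2 * z k + (\<Sum>i<M. \<mu> i * residual_deriv (p ! i) (m + i) v k)"
      by (simp add: lagrange_def L_def[symmetric] M_def[symmetric] Let_def v_def)
    also have "\<dots> = b k + w k" using dv by (simp add: b_def)
    finally show ?thesis using b[OF True] by simp
  next
    case False
    define i where "i = k - L"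
    have i: "i < M" "k = L + i" using False that by (auto simp: i_def L_def M_def)
    have "lagrange m p k v = residual (p ! i) (m + i) v"
      using i by (simp add: lagrange_def L_def[symmetric] M_def[symmetric] Let_def)
    also have "\<dots> = errors p w (m + i)" using cv[OF i(1)] exec_residual[OF x wf] i(1) by (simp add: z_def M_def)
    also have "\<dots> = w k" by (simp add: errors_def i(2) L_def M_def add.commute add.left_commute)
    finally show ?thesis .
  qed
  moreover have "v i = x i" if "i < m" for i using that by (simp add: v_def L_def z_def exec_below)
  ultimately show ?thesis by blast
qed

text \<open>The guard of a root makes the reciprocal of its radicand one of the computed values, so
  a bounded objective keeps the radicand away from 0 as well. With s of absolute value 1, the
  product of \<open>s\<close> and the divisor is the absolute value of the divisor.\<close>

definition guarded :: "instr list \<Rightarrow> bool" where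
  "guarded p \<longleftrightarrow> (\<forall>s a. Inv s a \<in> set p \<longrightarrow> \<bar>s\<bar> = 1) \<and> (\<forall>a. Root a \<in> set p \<longrightarrow> Inv 1 a \<in> set p)"

section \<open>Compact sublevel sets and the persistence of minima\<close>

lemma compact_box: "compact (PiE UNIV (\<lambda>i. {l i..u i :: real}))"
proof -
  have "compactin (product_topology (\<lambda>i. euclidean) UNIV) (PiE UNIV (\<lambda>i. {l i..u i}))"
    by (subst compactin_PiE) simp
  then show ?thesis by (simp add: euclidean_product_topology)
qed

lemma errors_zero [simp]: "errors p (\<lambda>_. 0) = (\<lambda>_. 0)"
  by (simp add: errors_def[abs_def])

lemma objective_zero: "objective m p (\<lambda>_. 0) x = (\<Sum>k<m + length p. (exec p m (\<lambda>_. 0) x k)\<^sup>2)"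
  by (simp add: objective_def)

lemma objective_bounds_values:
  assumes "objective m p (\<lambda>_. 0) x \<le> B" "k < m + length p"
  shows "\<bar>exec p m (\<lambda>_. 0) x k\<bar> \<le> B + 1"
proof -
  let ?y = "exec p m (\<lambda>_. 0) x k"
  have "?y\<^sup>2 \<le> (\<Sum>k<m + length p. (exec p m (\<lambda>_. 0) x k)\<^sup>2)"
    by (rule member_le_sum) (use assms(2) in auto)
  then have "?y\<^sup>2 \<le> B" using assms(1) by (simp add: objective_zero)
  moreover have "2 * \<bar>?y\<bar> \<le> ?y\<^sup>2 + 1" using zero_le_power2[of "\<bar>?y\<bar> - 1"] by (simp add: power2_diff)
  moreover have "0 \<le> ?y\<^sup>2" by simp
  ultimately show ?thesis by linarith
qed

text \<open>Each \<open>Inv s a\<close> puts \<open>1 / z\<^sub>a\<^sup>2\<close> into the objective, so its sublevel sets stay away from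
  the boundary of the domain.\<close>

lemma sublevel_exec_margin:
  assumes wf: "wf_prog m p" and g: "guarded p" and x: "exec_defined p m (\<lambda>_. 0) x"
    and B: "objective m p (\<lambda>_. 0) x \<le> B"
  shows "exec_margin (1 / (B + 1)) p m x"
proof (rule exec_marginI[OF x wf])
  let ?z = "exec p m (\<lambda>_. 0) x"
  have inv: "s * ?z a \<ge> 1 / (B + 1)" if Inv: "Inv s a \<in> set p" for s a
  proof -
    obtain i where i: "i < length p" "p ! i = Inv s a" using Inv by (auto simp: in_set_conv_nth)
    have "0 < s * ?z a" "?z (m + i) = 1 / ?z a" using exec_nth[OF x wf i(1)] i(2) by auto
    moreover have "\<bar>s\<bar> = 1" using g Inv by (auto simp: guarded_def)
    ultimately have pos: "\<bar>?z a\<bar> > 0" and sz: "s * ?z a = \<bar>?z a\<bar>" and "\<bar>?z (m + i)\<bar> = 1 / \<bar>?z a\<bar>"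
      by (auto simp: abs_if split: if_splits)
    moreover have "\<bar>?z (m + i)\<bar> \<le> B + 1" by (rule objective_bounds_values[OF B]) (use i in simp)
    ultimately have "1 / \<bar>?z a\<bar> \<le> B + 1" by simp
    moreover have "1 / \<bar>?z a\<bar> > 0" using pos by simp
    ultimately have "B + 1 > 0" by linarith
    then show ?thesis using \<open>1 / \<bar>?z a\<bar> \<le> B + 1\<close> pos by (simp add: sz field_simps)
  qed
  show "admissible_margin (1 / (B + 1)) (p ! i) ?z" if "i < length p" for i
  proof (cases "p ! i")
    case (Root a)
    then have "Inv 1 a \<in> set p" using g that by (metis guarded_def nth_mem)
    from inv[OF this] show ?thesis by (simp add: Root)
  qed (use inv that in \<open>auto simp: in_set_conv_nth\<close>)
qed

lemma continuous_on_coordinate: "continuous_on S (\<lambda>x :: nat \<Rightarrow> real. x i)"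
  by (rule continuous_on_subset[OF continuous_on_product_coordinates]) simp

lemma continuous_shift: "continuous_on UNIV (\<lambda>t. shift x i t)"
proof (rule continuous_on_coordinatewise_then_product)
  show "continuous_on UNIV (\<lambda>t. shift x i t j)" for j
    by (cases "j = i") (auto simp: shift_def intro!: continuous_intros)
qed

lemma eventually_shift:
  assumes "open U" "x \<in> U"
  shows "\<forall>\<^sub>F t in nhds 0. shift x i t \<in> U"
proof -
  have "open ((\<lambda>t. shift x i t) -` U)"
    using continuous_open_vimage[OF assms(1)] continuous_shift by (metis continuous_on_eq_continuous_at open_UNIV UNIV_I)
  moreover have "0 \<in> (\<lambda>t. shift x i t) -` U" using assms(2) by (simp add: shift_def)
  ultimately show ?thesis by (auto simp: eventually_nhds)
qed

text \<open>The set \<open>Q\<close> is the part of a sublevel set that lies in \<open>K\<close>. It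
  is compact, since the margins keep it inside the domain, where \<open>K\<close> is relatively
  closed. Conversely \<open>Q\<close> contains all points of \<open>K\<close> below the level, up to
  coordinates that are no inputs. A minimizer on \<open>Q\<close> strictly below the level is thus a
  local minimizer in every input direction, and no boundary condition is active.\<close>

lemma perturbed_minimum:
  assumes wf: "wf_prog m p" and g: "guarded p"
    and K: "open K" "x0 \<in> K" "K \<subseteq> {x. exec_defined p m (\<lambda>_. 0) x}" "{x. exec_defined p m (\<lambda>_. 0) x} \<inter> closure K \<subseteq> K"
  shows "\<exists>W. open W \<and> (\<lambda>_. 0) \<in> W \<and>
    (\<forall>w\<in>W. \<exists>x\<in>K. \<exists>v. (\<forall>k<m + 2 * length p. lagrange m p k v = w k) \<and> (\<forall>i<m. v i = x i))"
proof -
  define \<Phi> where "\<Phi> = objective m p (\<lambda>_. 0)"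
  define D where "D = {x. exec_defined p m (\<lambda>_. 0) x}"
  \<comment> \<open>On \<open>Q\<close> the perturbation will change the objective by less than 1/2,
    so a perturbed minimizer has old value below \<Phi> x0 + 1 and stays under this level.\<close>
  define B where "B = \<Phi> x0 + 2"
  have "\<Phi> x \<ge> 0" for x by (simp add: \<Phi>_def objective_zero sum_nonneg)
  from this[of x0] have Bpos: "B + 1 > 0" by (simp add: B_def)
  \<comment> \<open>Points have infinitely many coordinates; those from \<open>m\<close> on are
    frozen at their values in \<open>x0\<close>.\<close>
  define box where "box = PiE UNIV (\<lambda>i. {if i < m then - (B + 1) else x0 i..if i < m then B + 1 else x0 i})"
  define S where "S = {x\<in>box. exec_margin (1 / (B + 1)) p m x}"
  define Q where "Q = {x\<in>S. \<Phi> x \<le> B} \<inter> closure K"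
  have "compact box" unfolding box_def by (rule compact_box)
  moreover have "closed box"
  proof -
    have "box = (\<Inter>i. {x. (if i < m then - (B + 1) else x0 i) \<le> x i \<and> x i \<le> (if i < m then B + 1 else x0 i)})"
      by (auto simp: box_def PiE_iff)
    moreover have "closed {x :: nat \<Rightarrow> real. l \<le> x i \<and> x i \<le> u}" for l u i
      by (intro closed_Collect_conj closed_Collect_le continuous_intros continuous_on_product_coordinates)
    ultimately show ?thesis by auto
  qed
  ultimately have S: "closed S" "continuous_on S (\<lambda>x. exec p m (\<lambda>_. 0) x i)" for i
    unfolding S_def using exec_margin_closed[of "1 / (B + 1)" box "\<lambda>x. x" p m] Bpos
    by (auto simp: continuous_on_coordinate)
  have "continuous_on S \<Phi>" unfolding \<Phi>_def objective_zero[abs_def] by (intro continuous_intros S)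
  have "closed {x\<in>S. \<Phi> x \<le> B}"
  proof -
    have "{x\<in>S. \<Phi> x \<le> B} = \<Phi> -` {..B} \<inter> S" by auto
    then show ?thesis using S(1) \<open>continuous_on S \<Phi>\<close> by (simp add: continuous_on_closed_vimage)
  qed
  then have "closed Q" by (simp add: Q_def closed_Int)
  have Qbox: "Q \<subseteq> box" by (auto simp: Q_def S_def)
  then have "compact Q" using \<open>compact box\<close> \<open>closed Q\<close> by (metis compact_Int_closed inf.absorb2)
  have QK: "Q \<subseteq> K" using K(4) Bpos exec_margin_defined[of "1 / (B + 1)" p m]
    by (auto simp: Q_def S_def)
  have KD: "K \<subseteq> D" using K(3) by (simp add: D_def)
  have in_Q: "x \<in> Q" if "x \<in> K" "\<Phi> x \<le> B" "\<And>i. i \<ge> m \<Longrightarrow> x i = x0 i" for x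
  proof -
    have "x \<in> D" using that KD by blast
    then have "exec_margin (1 / (B + 1)) p m x"
      using sublevel_exec_margin[OF wf g] that(2) by (simp add: D_def \<Phi>_def)
    moreover have "\<bar>x i\<bar> \<le> B + 1" if "i < m" for i
      using objective_bounds_values[of m p x B i] that \<open>\<Phi> x \<le> B\<close> by (simp add: \<Phi>_def exec_below)
    then have "x \<in> box" using that(3) by (auto simp: box_def abs_le_iff, smt)
    ultimately show ?thesis using that closure_subset by (auto simp: Q_def S_def)
  qed
  have "x0 \<in> Q" by (rule in_Q) (use K in \<open>auto simp: B_def\<close>)
  have coord: "continuous_on UNIV (\<lambda>y :: (nat \<Rightarrow> real) \<times> (nat \<Rightarrow> real). snd y i)"
    "continuous_on UNIV (\<lambda>y :: (nat \<Rightarrow> real) \<times> (nat \<Rightarrow> real). fst y i)" for i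
    by (rule continuous_on_product_then_coordinatewise, intro continuous_intros)+
  define E where "E = {y. exec_defined p m (errors p (fst y)) (snd y)}"
  define E0 where "E0 = {y :: (nat \<Rightarrow> real) \<times> (nat \<Rightarrow> real). exec_defined p m (\<lambda>_. 0) (snd y)}"
  have E: "open E" "continuous_on E (\<lambda>y. exec p m (errors p (fst y)) (snd y) i)" for i
    using exec_continuous[of UNIV snd "\<lambda>y. errors p (fst y)" p m] coord by (auto simp: E_def errors_def)
  have E0: "open E0" "continuous_on E0 (\<lambda>y. exec p m (\<lambda>_. 0) (snd y) i)" for i
    using exec_continuous[of UNIV "snd :: (nat \<Rightarrow> real) \<times> (nat \<Rightarrow> real) \<Rightarrow> _" "\<lambda>_ _. 0" p m] coord by (auto simp: E0_def)
  have D: "open D" "continuous_on D (\<lambda>x. exec p m (\<lambda>_. 0) x i)" for i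
    using exec_continuous[of UNIV "\<lambda>x. x" "\<lambda>_ _. 0" p m] by (auto simp: D_def)
  have cE: "continuous_on E (\<lambda>y. objective m p (fst y) (snd y))"
    unfolding objective_def using coord(2) by (intro continuous_intros E(2)) (auto intro: continuous_on_subset)
  have cE0: "continuous_on E0 (\<lambda>y. \<Phi> (snd y))"
    unfolding \<Phi>_def objective_zero by (intro continuous_intros E0(2))
  have cD: "continuous_on D \<Phi>"
    unfolding \<Phi>_def objective_zero[abs_def] by (intro continuous_intros D(2))
  \<comment> \<open>Pairs of a parameter and a point where both the perturbed and the unperturbed
    run are defined and their objectives differ by less than 1/2.\<close>
  define T where "T = {y\<in>E \<inter> E0. objective m p (fst y) (snd y) - \<Phi> (snd y) \<in> {-1/2<..<1/2}}"
  have "open T"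
  proof -
    have "continuous_on (E \<inter> E0) (\<lambda>y. objective m p (fst y) (snd y) - \<Phi> (snd y))"
      by (intro continuous_intros continuous_on_subset[OF cE] continuous_on_subset[OF cE0]) auto
    moreover have "T = (\<lambda>y. objective m p (fst y) (snd y) - \<Phi> (snd y)) -` {-1/2<..<1/2} \<inter> (E \<inter> E0)"
      by (auto simp: T_def)
    moreover have "open (E \<inter> E0)" using E(1) E0(1) by blast
    ultimately show ?thesis by (simp only: continuous_on_open_vimage open_greaterThanLessThan)
  qed
  have "{\<lambda>_. 0} \<times> Q \<subseteq> T"
    using QK K(3) by (auto simp: T_def E_def E0_def \<Phi>_def)
  \<comment> \<open>Compactness of \<open>Q\<close> gives one neighbourhood of the zero parameter
    that works for all its points.\<close>
  from Elementary_Topology.tube_lemma[OF \<open>compact Q\<close> \<open>open T\<close> this]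
  obtain W where W: "(\<lambda>_. 0) \<in> W" "open W" "W \<times> Q \<subseteq> T" by blast
  have "\<exists>x\<in>K. \<exists>v. (\<forall>k<m + 2 * length p. lagrange m p k v = w k) \<and> (\<forall>i<m. v i = x i)" if w: "w \<in> W" for w
  proof -
    have QT: "(w, x) \<in> T" if "x \<in> Q" for x using W(3) w that by blast
    have "continuous_on Q (\<lambda>x. objective m p w x)"
    proof -
      have "continuous_on Q ((\<lambda>y. objective m p (fst y) (snd y)) \<circ> (\<lambda>x. (w, x)))"
        by (rule continuous_on_compose[OF _ continuous_on_subset[OF cE]])
          (use QT in \<open>auto intro!: continuous_intros simp: T_def\<close>)
      then show ?thesis by (simp add: o_def)
    qed
    from continuous_attains_inf[OF \<open>compact Q\<close> _ this] \<open>x0 \<in> Q\<close>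
    obtain x where x: "x \<in> Q" "\<And>y. y \<in> Q \<Longrightarrow> objective m p w x \<le> objective m p w y" by blast
    have close: "\<bar>objective m p w y - \<Phi> y\<bar> < 1/2" if "y \<in> Q" for y
    proof -
      have "objective m p w y - \<Phi> y \<in> {-1/2<..<1/2}" using QT[OF that] by (simp only: T_def mem_Collect_eq fst_conv snd_conv)
      then show ?thesis unfolding greaterThanLessThan_iff by linarith
    qed
    have "\<Phi> x < B" using close[OF x(1)] close[OF \<open>x0 \<in> Q\<close>] x(2)[OF \<open>x0 \<in> Q\<close>] unfolding B_def by linarith
    have "open (K \<inter> \<Phi> -` {..<B})"
      using continuous_open_preimage[OF continuous_on_subset[OF cD KD] K(1), of "{..<B}"] by simp
    then have "\<forall>\<^sub>F t in nhds 0. shift x i t \<in> K \<inter> \<Phi> -` {..<B}" for i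
      by (rule eventually_shift) (use x(1) QK \<open>\<Phi> x < B\<close> in auto)
    then have in_Q': "\<forall>\<^sub>F t in nhds 0. shift x i t \<in> Q" if "i < m" for i
    proof (rule eventually_mono)
      fix t assume *: "shift x i t \<in> K \<inter> \<Phi> -` {..<B}"
      have "x j = x0 j" if "j \<ge> m" for j
      proof -
        have "x j \<in> {if j < m then - (B + 1) else x0 j..if j < m then B + 1 else x0 j}"
          using subsetD[OF Qbox x(1)] unfolding box_def PiE_iff by blast
        then show ?thesis using that by simp
      qed
      then show "shift x i t \<in> Q" using * \<open>i < m\<close> by (intro in_Q) (auto simp: shift_def)
    qed
    have exec: "\<forall>\<^sub>F t in nhds 0. (w, shift x i t) \<in> T \<and> objective m p w x \<le> objective m p w (shift x i t)"
      if "i < m" for i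
      using in_Q'[OF that] by (rule eventually_mono) (use QT x(2) in blast)
    have "\<exists>v. (\<forall>k<m + 2 * length p. lagrange m p k v = w k) \<and> (\<forall>i<m. v i = x i)"
    proof (rule critical_point_lagrange[OF wf])
      show "exec_defined p m (errors p w) x" using QT[OF x(1)] by (auto simp: T_def E_def)
      show "\<forall>\<^sub>F t in nhds 0. exec_defined p m (errors p w) (shift x i t)" if "i < m" for i
        using exec[OF that] by (rule eventually_mono) (auto simp: T_def E_def)
      show "\<forall>\<^sub>F t in nhds 0. objective m p w x \<le> objective m p w (shift x i t)" if "i < m" for i
        using exec[OF that] by (rule eventually_mono) auto
    qed
    then show ?thesis using x(1) QK by blast
  qed
  then show ?thesis using W(1,2) by blast
qed

text \<open>For one common small \<open>w\<close>, each part contributes a solution of the same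
  Lagrange system. Solutions from different parts differ already in their first \<open>m\<close>
  entries, the inputs, so the bound on fibres counts the parts.\<close>

theorem clopen_parts_bound:
  assumes wf: "wf_prog m p" and g: "guarded p" and m: "m \<ge> 1" and I: "finite I"
    and K: "\<And>i. i \<in> I \<Longrightarrow> open (K i)" "\<And>i. i \<in> I \<Longrightarrow> K i \<noteq> {}"
      "\<And>i. i \<in> I \<Longrightarrow> K i \<subseteq> {x. exec_defined p m (\<lambda>_. 0) x}"
      "\<And>i. i \<in> I \<Longrightarrow> {x. exec_defined p m (\<lambda>_. 0) x} \<inter> closure (K i) \<subseteq> K i"
    and disj: "\<And>i j x y. i \<in> I \<Longrightarrow> j \<in> I \<Longrightarrow> x \<in> K i \<Longrightarrow> y \<in> K j \<Longrightarrow> (\<And>k. k < m \<Longrightarrow> x k = y k) \<Longrightarrow> i = j"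
  shows "card I \<le> 256 ^ (m + 2 * length p)"
proof -
  let ?N = "m + 2 * length p"
  have "\<forall>i\<in>I. \<exists>W. open W \<and> (\<lambda>_. 0) \<in> W \<and>
      (\<forall>w\<in>W. \<exists>x\<in>K i. \<exists>v. (\<forall>k<?N. lagrange m p k v = w k) \<and> (\<forall>i<m. v i = x i))"
  proof
    fix i assume i: "i \<in> I"
    obtain x where "x \<in> K i" using K(2)[OF i] by blast
    then show "\<exists>W. open W \<and> (\<lambda>_. 0) \<in> W \<and>
      (\<forall>w\<in>W. \<exists>x\<in>K i. \<exists>v. (\<forall>k<?N. lagrange m p k v = w k) \<and> (\<forall>i<m. v i = x i))"
      using perturbed_minimum[OF wf g K(1)[OF i] _ K(3)[OF i] K(4)[OF i]] by blast
  qed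
  then obtain W where W: "\<And>i. i \<in> I \<Longrightarrow> open (W i)" "\<And>i. i \<in> I \<Longrightarrow> (\<lambda>_. 0) \<in> W i"
    "\<And>i w. i \<in> I \<Longrightarrow> w \<in> W i \<Longrightarrow> \<exists>x\<in>K i. \<exists>v. (\<forall>k<?N. lagrange m p k v = w k) \<and> (\<forall>i<m. v i = x i)"
    by (metis (no_types, lifting) bchoice)
  have "open (\<Inter>i\<in>I. W i)" using I W(1) by (intro open_INT) auto
  then have "openin (product_topology (\<lambda>i. euclidean) UNIV) (\<Inter>i\<in>I. W i)"
    by (simp add: euclidean_product_topology)
  from product_topology_open_contains_basis[OF this, of "\<lambda>_. 0"] W(2)
  obtain A where A: "(\<lambda>_. 0) \<in> PiE UNIV A" "\<And>i. open (A i)" "PiE UNIV A \<subseteq> (\<Inter>i\<in>I. W i)"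
    by auto
  have A0: "(0::real) \<in> A k" for k using A(1) by (auto simp: PiE_iff)
  have "infinite (A k)" for k using A0[of k] A(2)[of k] finite_imp_not_open by blast
  moreover have "1 \<le> ?N" using m by simp
  ultimately have "\<exists>w. (\<forall>k<?N. w k \<in> A k) \<and>
    (\<forall>X. finite X \<longrightarrow> inj_on (\<lambda>v. restrict v {..<?N}) X \<longrightarrow>
      (\<forall>v\<in>X. \<forall>k<?N. lagrange m p k v = w k) \<longrightarrow> card X \<le> 256 ^ ?N)"
    using polyfun_lagrange[OF wf] by (intro quadratic_map_fibre_bound)
  then obtain w0 where w0: "\<And>k. k < ?N \<Longrightarrow> w0 k \<in> A k"
    and fib: "\<And>X. finite X \<Longrightarrow> inj_on (\<lambda>v. restrict v {..<?N}) X \<Longrightarrow>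
      (\<forall>v\<in>X. \<forall>k<?N. lagrange m p k v = w0 k) \<Longrightarrow> card X \<le> 256 ^ ?N"
    by blast
  \<comment> \<open>The bound on fibres controls only the first entries of \<open>w0\<close>; zeros
    elsewhere put the point into the whole box \<open>A\<close>.\<close>
  define w where "w = (\<lambda>k. if k < ?N then w0 k else 0)"
  have "w \<in> PiE UNIV A" using w0 A0 by (auto simp: w_def PiE_iff)
  then have "w \<in> W i" if "i \<in> I" for i using A(3) that by blast
  then have "\<forall>i\<in>I. \<exists>v. \<exists>x\<in>K i. (\<forall>k<?N. lagrange m p k v = w k) \<and> (\<forall>i<m. v i = x i)"
    using W(3) by blast
  from bchoice[OF this] obtain v where
    v: "\<And>i. i \<in> I \<Longrightarrow> \<exists>x\<in>K i. (\<forall>k<?N. lagrange m p k (v i) = w k) \<and> (\<forall>k<m. v i k = x k)" by blast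
  have inj: "i = j" if "i \<in> I" "j \<in> I" "\<And>k. k < m \<Longrightarrow> v i k = v j k" for i j
  proof -
    obtain x y where "x \<in> K i" "\<forall>k<m. v i k = x k" "y \<in> K j" "\<forall>k<m. v j k = y k"
      using v[OF \<open>i \<in> I\<close>] v[OF \<open>j \<in> I\<close>] by blast
    then show ?thesis using disj[OF that(1,2), of x y] that(3) by auto
  qed
  have "card (v ` I) \<le> 256 ^ ?N"
  proof (rule fib)
    show "finite (v ` I)" using I by simp
    show "inj_on (\<lambda>v. restrict v {..<?N}) (v ` I)"
    proof (rule inj_onI, clarify)
      fix i j assume ij: "i \<in> I" "j \<in> I" "restrict (v i) {..<?N} = restrict (v j) {..<?N}"
      have "v i k = v j k" if "k < m" for k
        using fun_cong[OF ij(3), of k] that by simp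
      then show "v i = v j" using inj[OF ij(1,2)] by simp
    qed
    show "\<forall>v\<in>v ` I. \<forall>k<?N. lagrange m p k v = w0 k"
      using v by (force simp: w_def)
  qed
  moreover have "inj_on v I" using inj by (intro inj_onI) auto
  ultimately show ?thesis by (simp add: card_image)
qed

section \<open>The paths of a computation tree\<close>

text \<open>A computation vertex may take two instructions and tests insert further ones, so the
  list \<open>js\<close> records which program variable holds the value of each computation
  vertex.\<close>

primrec operand_index :: "nat list \<Rightarrow> operand \<Rightarrow> nat" where
  "operand_index js (Input i) = i"
| "operand_index js (Computed j) = js ! j"

text \<open>The alternatives cover the possible signs, and the second component lists variables
  required to vanish. Division splits by the sign of the divisor and multiplies by its reciprocal,
  which \<open>Inv\<close> has just written to variable \<open>k\<close>.\<close>

primrec binary_steps :: "arith_op \<Rightarrow> nat \<Rightarrow> nat \<Rightarrow> nat \<Rightarrow> (instr list \<times> nat set) set" where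
  "binary_steps Plus k a b = {([Lin 0 1 a 1 b], {})}"
| "binary_steps Minus k a b = {([Lin 0 1 a (-1) b], {})}"
| "binary_steps Times k a b = {([Mul a b], {})}"
| "binary_steps Divide k a b = {([Inv 1 b, Mul a k], {}), ([Inv (-1) b, Mul a k], {})}"

primrec const_steps :: "arith_op \<Rightarrow> nat \<Rightarrow> real \<Rightarrow> nat \<Rightarrow> (instr list \<times> nat set) set" where
  "const_steps Plus k c a = {([Lin c 1 a 0 a], {})}"
| "const_steps Minus k c a = {([Lin c (-1) a 0 a], {})}"
| "const_steps Times k c a = {([Lin 0 c a 0 a], {})}"
| "const_steps Divide k c a = {([Inv 1 a, Lin 0 c k 0 k], {}), ([Inv (-1) a, Lin 0 c k 0 k], {})}"

text \<open>A radicand is either positive, with the guard that \<open>guarded\<close> asks for, or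
  zero; in the latter case the root is written as the constant 0 by a linear instruction.\<close>

primrec steps :: "computation \<Rightarrow> nat \<Rightarrow> nat list \<Rightarrow> (instr list \<times> nat set) set" where
  "steps (Binary f p q) k js = binary_steps f k (operand_index js p) (operand_index js q)"
| "steps (Const_Binary f c p) k js = const_steps f k c (operand_index js p)"
| "steps (Sqrt p) k js = {([Inv 1 (operand_index js p), Root (operand_index js p)], {}),
     ([Lin 0 0 (operand_index js p) 0 (operand_index js p)], {operand_index js p})}"

primrec test_operand :: "test \<Rightarrow> operand" where
  "test_operand (Positive p) = p"
| "test_operand (Nonnegative p) = p"
| "test_operand (Is_Zero p) = p"

primrec sign_passes :: "test \<Rightarrow> real \<Rightarrow> bool" where
  "sign_passes (Positive p) x \<longleftrightarrow> x > 0"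
| "sign_passes (Nonnegative p) x \<longleftrightarrow> x \<ge> 0"
| "sign_passes (Is_Zero p) x \<longleftrightarrow> x = 0"

text \<open>A constant output has factor 0 and an arbitrary variable, here 0.\<close>

primrec output_form :: "nat list \<Rightarrow> leaf_output \<Rightarrow> real \<times> real \<times> nat" where
  "output_form js (Output p) = (0, 1, operand_index js p)"
| "output_form js (Output_Const c) = (c, 0, 0)"

type_synonym path = "instr list \<times> nat set \<times> real \<times> real \<times> nat"

definition extend :: "instr list \<Rightarrow> nat set \<Rightarrow> path set \<Rightarrow> path set" where
  "extend q Y P = (\<lambda>(p, Z, out). (q @ p, Y \<union> Z, out)) ` P"

text \<open>A path \<open>(p, Z, c, r, a)\<close> consists of a program whose domain records the strict sign
  conditions met on the way to a leaf, the set \<open>Z\<close> of values that were found to vanish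
  identically, and the output \<open>c + r * z a\<close>.\<close>

primrec paths :: "act \<Rightarrow> nat \<Rightarrow> nat list \<Rightarrow> path set" where
  "paths (Leaf out) k js = {([], {}, output_form js out)}"
| "paths (Compute f t) k js =
     (\<Union>(q, Y)\<in>steps f k js. extend q Y (paths t (k + length q) (js @ [k + length q - 1])))"
| "paths (Branch c t u) k js = (let a = operand_index js (test_operand c) in
     extend [Inv 1 a] {} ((if sign_passes c 1 then paths t else paths u) (Suc k) js) \<union>
     extend [Inv (-1) a] {} ((if sign_passes c (-1) then paths t else paths u) (Suc k) js) \<union>
     extend [] {a} ((if sign_passes c 0 then paths t else paths u) k js))"

section \<open>Number, length and shape of the paths\<close>

lemma steps_finite_card: "finite (steps f k js) \<and> card (steps f k js) \<le> 2"
proof (cases f)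
  case (Binary g p q) then show ?thesis by (cases g) (auto simp: card_insert_if)
next
  case (Const_Binary g p q) then show ?thesis by (cases g) (auto simp: card_insert_if)
qed (auto simp: card_insert_if)

lemma extend_finite_card:
  "finite P \<and> card P \<le> b \<Longrightarrow> finite (extend q Y P) \<and> card (extend q Y P) \<le> b"
  by (auto simp: extend_def intro: order_trans[OF card_image_le])

text \<open>A branching vertex has three sign alternatives and a computation vertex at most two,
  hence base 3.\<close>

lemma paths_finite_card: "finite (paths t k js) \<and> card (paths t k js) \<le> 3 ^ depth t"
proof (induction t arbitrary: k js)
  case (Compute f t)
  let ?P = "\<lambda>(q, Y). extend q Y (paths t (k + length q) (js @ [k + length q - 1]))"
  have P: "finite (?P s) \<and> card (?P s) \<le> 3 ^ depth t" for s
    unfolding case_prod_beta' by (intro extend_finite_card Compute.IH)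
  have "card (\<Union>s\<in>steps f k js. ?P s) \<le> (\<Sum>s\<in>steps f k js. card (?P s))"
    using steps_finite_card by (intro card_UN_le) blast
  also have "\<dots> \<le> card (steps f k js) * 3 ^ depth t"
    using P sum_bounded_above[of "steps f k js" "\<lambda>s. card (?P s)"] by simp
  also have "\<dots> \<le> 2 * 3 ^ depth t" using steps_finite_card by simp
  finally show ?case using P steps_finite_card by auto
next
  case (Branch c t u)
  define d where "d = max (depth t) (depth u)"
  have *: "finite ((if b then paths t else paths u) k js) \<and> card ((if b then paths t else paths u) k js) \<le> 3 ^ d" for b k js
    using Branch.IH[of k js] power_increasing[of "depth t" d "3::nat"] power_increasing[of "depth u" d "3::nat"]
    by (auto simp: d_def intro: order_trans)
  define e where "e = (\<lambda>q Y b k. extend q Y ((if b then paths t else paths u) k js))"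
  have e: "finite (e q Y b k) \<and> card (e q Y b k) \<le> 3 ^ d" for q Y b k
    unfolding e_def by (intro extend_finite_card *)
  have *: "card (A \<union> B \<union> C) \<le> 3 * 3 ^ d" if "card A \<le> 3 ^ d" "card B \<le> 3 ^ d" "card C \<le> 3 ^ d" for A B C :: "path set"
    using that card_Un_le[of A B] card_Un_le[of "A \<union> B" C] by linarith
  define a where "a = operand_index js (test_operand c)"
  have "paths (Branch c t u) k js = e [Inv 1 a] {} (sign_passes c 1) (Suc k) \<union>
      e [Inv (-1) a] {} (sign_passes c (-1)) (Suc k) \<union> e [] {a} (sign_passes c 0) k"
    by (simp only: paths.simps Let_def e_def a_def)
  moreover have "(3::nat) ^ depth (Branch c t u) = 3 * 3 ^ d" by (simp add: d_def)
  ultimately show ?case using e * by simp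
qed simp

lemma exec_append: "exec (q @ p) k \<epsilon> z = exec p (k + length q) \<epsilon> (exec q k \<epsilon> z)"
  by (induction q arbitrary: k z) (auto simp del: fun_upd_apply)

lemma exec_defined_append: "exec_defined (q @ p) k \<epsilon> z \<longleftrightarrow> exec_defined q k \<epsilon> z \<and> exec_defined p (k + length q) \<epsilon> (exec q k \<epsilon> z)"
  by (induction q arbitrary: k z) (auto simp del: fun_upd_apply)

lemma wf_prog_append: "wf_prog k (q @ p) \<longleftrightarrow> wf_prog k q \<and> wf_prog (k + length q) p"
  by (induction q arbitrary: k) auto

lemma guarded_append: "guarded q \<Longrightarrow> guarded p \<Longrightarrow> guarded (q @ p)"
  unfolding guarded_def by auto

definition valid_state :: "nat \<Rightarrow> nat \<Rightarrow> nat list \<Rightarrow> bool" where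
  "valid_state m k js \<longleftrightarrow> m \<le> k \<and> (\<forall>j\<in>set js. j < k)"

lemma operand_index_less: "valid_state m k js \<Longrightarrow> wf_operand m (length js) p \<Longrightarrow> operand_index js p < k"
  by (cases p) (auto simp: valid_state_def)

lemma steps_wf:
  assumes "(q, Y) \<in> steps f k js" "valid_state m k js"
    "\<forall>p\<in>operands_computation f. wf_operand m (length js) p"
  shows "wf_prog k q \<and> guarded q \<and> 1 \<le> length q \<and> length q \<le> 2 \<and> Y \<subseteq> {..<k}"
proof -
  note i = operand_index_less[OF assms(2)]
  show ?thesis
  proof (cases f)
    case (Binary g a b) then show ?thesis using assms(1,3) i[of a] i[of b]
      by (cases g) (auto simp: guarded_def)
  next
    case (Const_Binary g c a) then show ?thesis using assms(1,3) i[of a]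
      by (cases g) (auto simp: guarded_def)
  next
    case (Sqrt a) then show ?thesis using assms(1,3) i[of a] by (auto simp: guarded_def)
  qed
qed

lemma valid_state_extend:
  "valid_state m k js \<Longrightarrow> 1 \<le> n \<Longrightarrow> valid_state m (k + n) (js @ [k + n - 1])"
  by (auto simp: valid_state_def)

lemma valid_state_mono: "valid_state m k js \<Longrightarrow> k \<le> k' \<Longrightarrow> valid_state m k' js"
  by (auto simp: valid_state_def)

lemma wf_test_operand: "\<forall>p\<in>operands_test c. wf_operand m k p \<Longrightarrow> wf_operand m k (test_operand c)"
  by (cases c) auto

lemma paths_Branch_cases:
  assumes "(p, Z, out) \<in> paths (Branch c t u) k js"
  obtains q Y e p' Z' where "p = q @ p'" "Z = Y \<union> Z'"
    "(p', Z', out) \<in> paths (if sign_passes c e then t else u) (k + length q) js"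
    "q = [Inv 1 (operand_index js (test_operand c))] \<and> Y = {} \<and> e = 1 \<or>
     q = [Inv (-1) (operand_index js (test_operand c))] \<and> Y = {} \<and> e = -1 \<or>
     q = [] \<and> Y = {operand_index js (test_operand c)} \<and> e = 0"
proof -
  define b where "b = operand_index js (test_operand c)"
  have *: "\<exists>p' Z'. p = q @ p' \<and> Z = Y \<union> Z' \<and> (p', Z', out) \<in> P"
    if "(p, Z, out) \<in> extend q Y P" for q Y P
    using that unfolding extend_def by fastforce
  have "paths (Branch c t u) k js =
      extend [Inv 1 b] {} (paths (if sign_passes c 1 then t else u) (k + length [Inv 1 b]) js) \<union>
      extend [Inv (-1) b] {} (paths (if sign_passes c (-1) then t else u) (k + length [Inv (-1) b]) js) \<union>
      extend [] {b} (paths (if sign_passes c 0 then t else u) (k + length ([] :: instr list)) js)"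
    by (simp add: Let_def b_def)
  then consider
    "(p, Z, out) \<in> extend [Inv 1 b] {} (paths (if sign_passes c 1 then t else u) (k + length [Inv 1 b]) js)"
  | "(p, Z, out) \<in> extend [Inv (-1) b] {} (paths (if sign_passes c (-1) then t else u) (k + length [Inv (-1) b]) js)"
  | "(p, Z, out) \<in> extend [] {b} (paths (if sign_passes c 0 then t else u) (k + length ([] :: instr list)) js)"
    using assms by blast
  then show ?thesis
    by cases (drule *, elim exE conjE, rule that, assumption+, simp add: b_def)+
qed

lemma paths_wf:
  assumes "(p, Z, out) \<in> paths t k js" "valid_state m k js" "wf_act m (length js) t"
  shows "wf_prog k p \<and> guarded p \<and> length p \<le> 2 * depth t"
  using assms
proof (induction t arbitrary: k js p Z)
  case (Leaf out)
  then show ?case by (simp add: guarded_def)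
next
  case (Compute f t)
  obtain q Y p' Z' where q: "(q, Y) \<in> steps f k js"
    and p': "(p', Z', out) \<in> paths t (k + length q) (js @ [k + length q - 1])" "p = q @ p'"
    using Compute.prems(1) by (auto simp: extend_def)
  have wq: "wf_prog k q \<and> guarded q \<and> 1 \<le> length q \<and> length q \<le> 2"
    using steps_wf[OF q Compute.prems(2)] Compute.prems(3) by simp
  then have "wf_prog (k + length q) p' \<and> guarded p' \<and> length p' \<le> 2 * depth t"
    using Compute.prems valid_state_extend by (intro Compute.IH[OF p'(1)]) auto
  then show ?case using wq by (auto simp: p'(2) wf_prog_append guarded_append)
next
  case (Branch c t u)
  define a where "a = operand_index js (test_operand c)"
  have a: "a < k" using Branch.prems(2,3) wf_test_operand operand_index_less by (auto simp: a_def)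
  from Branch.prems(1) obtain q Y e p' Z' where q: "p = q @ p'"
    "(p', Z', out) \<in> paths (if sign_passes c e then t else u) (k + length q) js"
    "q = [Inv 1 a] \<or> q = [Inv (-1) a] \<or> q = []"
    by (rule paths_Branch_cases) (use a_def in blast)
  have "valid_state m (k + length q) js" using Branch.prems(2) valid_state_mono by simp
  then have "wf_prog (k + length q) p' \<and> guarded p' \<and> length p' \<le> 2 * max (depth t) (depth u)"
    using Branch.IH q(2) Branch.prems(3) by (fastforce split: if_splits)
  then show ?case using q(1,3) a by (auto simp: wf_prog_append guarded_def)
qed

definition represents :: "nat \<Rightarrow> nat list \<Rightarrow> real list \<Rightarrow> real list \<Rightarrow> (nat \<Rightarrow> real) \<Rightarrow> bool" where
  "represents m js xs vs z \<longleftrightarrow> length vs = length js \<and> (\<forall>i<m. z i = xs ! i) \<and>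
     (\<forall>j<length js. z (js ! j) = vs ! j)"

section \<open>Soundness of paths\<close>

lemma represents_operand:
  "represents m js xs vs z \<Longrightarrow> wf_operand m (length js) p \<Longrightarrow> operand_value xs vs p = z (operand_index js p)"
  by (cases p) (auto simp: represents_def)

lemma represents_cong:
  assumes "represents m js xs vs z" "valid_state m k js" "\<And>i. i < k \<Longrightarrow> z' i = z i"
  shows "represents m js xs vs z'"
  using assms unfolding represents_def valid_state_def by (metis less_le_trans nth_mem)

lemma represents_extend:
  assumes "represents m js xs vs z" "valid_state m k js" "\<And>i. i < k \<Longrightarrow> z' i = z i"
  shows "represents m (js @ [l]) xs (vs @ [z' l]) z'"
  using represents_cong[OF assms] by (auto simp: represents_def nth_append)

lemma steps_sound:
  assumes "(q, Y) \<in> steps f k js" "valid_state m k js"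
    "\<forall>p\<in>operands_computation f. wf_operand m (length js) p"
    "represents m js xs vs z" "exec_defined q k (\<lambda>_. 0) z" "\<forall>a\<in>Y. z a = 0"
  shows "computation_value xs vs f = Some (exec q k (\<lambda>_. 0) z (k + length q - 1))"
proof -
  note i = operand_index_less[OF assms(2)] and r = represents_operand[OF assms(4)]
  show ?thesis
  proof (cases f)
    case (Binary g a b) then show ?thesis using assms i[of a] i[of b] r[of a] r[of b]
      by (cases g) auto
  next
    case (Const_Binary g c a) then show ?thesis using assms i[of a] r[of a]
      by (cases g) auto
  next
    case (Sqrt a) then show ?thesis using assms i[of a] r[of a] by auto
  qed
qed

lemma test_holds_sign:
  assumes "represents m js xs vs z" "\<forall>p\<in>operands_test c. wf_operand m (length js) p"
  shows "test_holds xs vs c \<longleftrightarrow> sign_passes c (z (operand_index js (test_operand c)))"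
  using represents_operand[OF assms(1)] assms(2) by (cases c) auto

lemma sign_passes_sgn: "sgn x = sgn y \<Longrightarrow> sign_passes c x \<longleftrightarrow> sign_passes c y"
  by (cases c) (auto simp: sgn_if split: if_splits)

text \<open>The domain of the program fixes the nonzero signs and \<open>Z\<close> fixes the zeros,
  so an input that meets both conditions takes exactly these turns in the tree.\<close>

lemma paths_sound:
  assumes "(p, Z, c, r, a) \<in> paths t k js" "valid_state m k js" "wf_act m (length js) t"
    "represents m js xs vs z" "exec_defined p k (\<lambda>_. 0) z" "\<forall>a\<in>Z. exec p k (\<lambda>_. 0) z a = 0"
  shows "run xs vs t = Some (c + r * exec p k (\<lambda>_. 0) z a)"
  using assms
proof (induction t arbitrary: k js p Z vs z)
  case (Leaf out)
  then show ?case using represents_operand by (cases out) auto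
next
  case (Compute f t)
  obtain q Y p' Z' where q: "(q, Y) \<in> steps f k js" "p = q @ p'" "Z = Y \<union> Z'"
    and p': "(p', Z', c, r, a) \<in> paths t (k + length q) (js @ [k + length q - 1])"
    using Compute.prems(1) by (auto simp: extend_def)
  have wq: "1 \<le> length q" "Y \<subseteq> {..<k}"
    using steps_wf[OF q(1) Compute.prems(2)] Compute.prems(3) by auto
  let ?z = "exec q k (\<lambda>_. 0) z"
  have "\<forall>a\<in>Y. z a = 0"
  proof
    fix b assume "b \<in> Y"
    then show "z b = 0" using Compute.prems(6) wq(2) q(3) exec_below[of b k p "\<lambda>_. 0" z] by auto
  qed
  then have "computation_value xs vs f = Some (?z (k + length q - 1))"
    using steps_sound[OF q(1) Compute.prems(2) _ Compute.prems(4)] Compute.prems(3,5)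
    by (simp add: q(2) exec_defined_append)
  moreover have "run xs (vs @ [?z (k + length q - 1)]) t = Some (c + r * exec p' (k + length q) (\<lambda>_. 0) ?z a)"
  proof (rule Compute.IH[OF p'])
    show "valid_state m (k + length q) (js @ [k + length q - 1])"
      using valid_state_extend Compute.prems(2) wq by blast
    show "represents m (js @ [k + length q - 1]) xs (vs @ [?z (k + length q - 1)]) ?z"
      using Compute.prems(4,2) by (rule represents_extend) (simp add: exec_below)
  qed (use Compute.prems q in \<open>auto simp: exec_defined_append exec_append\<close>)
  ultimately show ?case by (simp add: q(2) exec_append)
next
  case (Branch d t u)
  define b where "b = operand_index js (test_operand d)"
  have b: "b < k" using Branch.prems(2,3) wf_test_operand operand_index_less by (auto simp: b_def)
  have test: "test_holds xs vs d \<longleftrightarrow> sign_passes d (z b)"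
    using test_holds_sign[OF Branch.prems(4)] Branch.prems(3) by (simp add: b_def)
  from Branch.prems(1) obtain q Y e p' Z' where q: "p = q @ p'" "Z = Y \<union> Z'"
    "(p', Z', c, r, a) \<in> paths (if sign_passes d e then t else u) (k + length q) js"
    "q = [Inv 1 b] \<and> Y = {} \<and> e = 1 \<or> q = [Inv (-1) b] \<and> Y = {} \<and> e = - 1 \<or> q = [] \<and> Y = {b} \<and> e = 0"
    by (rule paths_Branch_cases) (use b_def in blast)
  have "sgn (z b) = sgn e"
    using q(4) Branch.prems(5,6) b by (auto simp: q(1,2) sgn_if exec_below)
  then have s: "sign_passes d (z b) = sign_passes d e" by (rule sign_passes_sgn)
  let ?z = "exec q k (\<lambda>_. 0) z"
  have "represents m js xs vs ?z"
    using Branch.prems(4,2) by (rule represents_cong) (simp add: exec_below)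
  moreover have "valid_state m (k + length q) js" using Branch.prems(2) valid_state_mono by simp
  moreover have "exec_defined p' (k + length q) (\<lambda>_. 0) ?z" "\<forall>a\<in>Z'. exec p' (k + length q) (\<lambda>_. 0) ?z a = 0"
    using Branch.prems(5,6) by (auto simp: q(1,2) exec_defined_append exec_append)
  ultimately have "run xs vs (if sign_passes d e then t else u) = Some (c + r * exec p' (k + length q) (\<lambda>_. 0) ?z a)"
    using Branch.IH[of p' Z' "k + length q" js vs ?z] q(3) Branch.prems(3) by (simp split: if_splits)
  then show ?case using test s by (simp add: q(1) exec_append split: if_splits)
qed

section \<open>Open sets of inputs that follow one path\<close>

lemma constant_sign_part:
  fixes f :: "'a :: topological_space \<Rightarrow> real"
  assumes "open U" "U \<noteq> {}" "continuous_on U f"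
  obtains V s where "open V" "V \<noteq> {}" "V \<subseteq> U" "s \<in> {-1, 0, 1}" "\<And>y. y \<in> V \<Longrightarrow> sgn (f y) = s"
proof (cases "\<forall>y\<in>U. f y = 0")
  case True
  then show ?thesis using that[of U 0] assms by auto
next
  case False
  then obtain y where y: "y \<in> U" "f y \<noteq> 0" by blast
  have "open (U \<inter> f -` {0<..})" "open (U \<inter> f -` {..<0})"
    using continuous_open_preimage[OF assms(3,1)] by auto
  then show ?thesis
    using that[of "U \<inter> f -` {0<..}" 1] that[of "U \<inter> f -` {..<0}" "-1"] y
    by (cases rule: linorder_cases[of "f y" 0]) (auto simp: sgn_if)
qed

text \<open>The tree never fails on these inputs, so a divisor has no zero in \<open>U\<close> and a
  radicand is nowhere negative. After shrinking, its sign is constant and selects one of the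
  alternatives in \<open>steps\<close>.\<close>

lemma steps_cover:
  fixes z :: "'a :: topological_space \<Rightarrow> nat \<Rightarrow> real"
  assumes "open U" "U \<noteq> {}" "\<And>i. continuous_on U (\<lambda>y. z y i)" "valid_state m k js"
    "\<forall>p\<in>operands_computation f. wf_operand m (length js) p"
    "\<And>y. y \<in> U \<Longrightarrow> represents m js (xs y) (vs y) (z y)"
    "\<And>y. y \<in> U \<Longrightarrow> computation_value (xs y) (vs y) f \<noteq> None"
  obtains V q Y where "open V" "V \<noteq> {}" "V \<subseteq> U" "(q, Y) \<in> steps f k js"
    "\<And>y. y \<in> V \<Longrightarrow> exec_defined q k (\<lambda>_. 0) (z y) \<and> (\<forall>a\<in>Y. z y a = 0)"
proof -
  define P where "P = (\<lambda>V q Y. open V \<and> V \<noteq> {} \<and> V \<subseteq> U \<and> (q, Y) \<in> steps f k js \<and>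
    (\<forall>y\<in>V. exec_defined q k (\<lambda>_. 0) (z y) \<and> (\<forall>a\<in>Y. z y a = 0)))"
  have r: "operand_value (xs y) (vs y) p = z y (operand_index js p)"
    if "y \<in> U" "p \<in> operands_computation f" for y p
    using represents_operand[OF assms(6)[OF that(1)]] assms(5) that(2) by blast
  have sgn1: "x = 1 \<or> x = -1 \<or> x = 0" if "x \<in> {-1, 0, 1}" for x :: real using that by auto
  have trivial: "\<exists>V q Y. P V q Y" if "([Lin c' r' a' s' b'], {}) \<in> steps f k js \<or> ([Mul a' b'], {}) \<in> steps f k js" for c' r' a' s' b'
    using that assms(1,2) unfolding P_def by (elim disjE) (intro exI conjI, assumption+, simp, assumption, simp)+
  have divide: "\<exists>V q Y. P V q Y"
    if "([Inv 1 b, i], {}) \<in> steps f k js" "([Inv (-1) b, i], {}) \<in> steps f k js"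
      "\<And>y. y \<in> U \<Longrightarrow> z y b \<noteq> 0" "\<And>e z. admissible i e z" for b i
  proof -
    obtain V s where V: "open V" "V \<noteq> {}" "V \<subseteq> U" "s \<in> {-1, 0, 1}" "\<And>y. y \<in> V \<Longrightarrow> sgn (z y b) = s"
      using constant_sign_part[OF assms(1,2,3)] by metis
    have "s \<noteq> 0" using V(2,3,5) that(3) by (metis ex_in_conv sgn_0_0 subsetD)
    have "s * z y b > 0" if "y \<in> V" for y
    proof -
      have "s * z y b = \<bar>z y b\<bar>" using V(5)[OF that] by (metis abs_sgn mult.commute)
      moreover have "z y b \<noteq> 0" using V(3) that \<open>\<And>y. y \<in> U \<Longrightarrow> z y b \<noteq> 0\<close> by blast
      ultimately show ?thesis by simp
    qed
    moreover have "([Inv s b, i], {}) \<in> steps f k js"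
      using that(1,2) sgn1[OF V(4)] \<open>s \<noteq> 0\<close> by auto
    ultimately have "P V [Inv s b, i] {}"
      using V(1-3) that(4) unfolding P_def by simp
    then show ?thesis by blast
  qed
  have "\<exists>V q Y. P V q Y"
  proof (cases f)
    case (Binary g a b)
    show ?thesis
    proof (cases g)
      case Divide
      have "z y (operand_index js b) \<noteq> 0" if "y \<in> U" for y
        using assms(7)[OF that] r[OF that] Binary Divide by (auto split: if_splits)
      then show ?thesis using Binary Divide by (intro divide) auto
    qed (use Binary in \<open>auto intro!: trivial\<close>)
  next
    case (Const_Binary g c b)
    show ?thesis
    proof (cases g)
      case Divide
      have "z y (operand_index js b) \<noteq> 0" if "y \<in> U" for y
        using assms(7)[OF that] r[OF that] Const_Binary Divide by (auto split: if_splits)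
      then show ?thesis using Const_Binary Divide by (intro divide) auto
    qed (use Const_Binary in \<open>auto intro!: trivial\<close>)
  next
    case (Sqrt b)
    let ?b = "operand_index js b"
    have nonneg: "z y ?b \<ge> 0" if "y \<in> U" for y
      using assms(7)[OF that] r[OF that] Sqrt by (auto split: if_splits)
    have b: "?b < k" using operand_index_less[OF assms(4)] assms(5) Sqrt by simp
    obtain V s where V: "open V" "V \<noteq> {}" "V \<subseteq> U" "s \<in> {-1, 0, 1}" "\<And>y. y \<in> V \<Longrightarrow> sgn (z y ?b) = s"
      using constant_sign_part[OF assms(1,2,3)] by metis
    obtain y0 where "y0 \<in> V" using V(2) by blast
    then have "s \<noteq> -1" using V(3) V(5)[of y0] nonneg[of y0] by (auto simp: sgn_if split: if_splits)
    then consider "s = 0" | "s = 1" using V(4) by auto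
    then show ?thesis
    proof cases
      case 1
      then have "P V [Lin 0 0 ?b 0 ?b] {?b}"
        using V(1-3,5) Sqrt unfolding P_def by (simp add: sgn_0_0)
      then show ?thesis by blast
    next
      case 2
      then have "P V [Inv 1 ?b, Root ?b] {}"
        using V(1-3,5) Sqrt b unfolding P_def by (simp add: sgn_1_pos)
      then show ?thesis by blast
    qed
  qed
  then show ?thesis using that unfolding P_def by blast
qed

text \<open>The open set shrinks at each sign decision and never becomes empty. An equality is taken
  only if the value vanishes on the whole current set, which is why the conditions in
  \<open>Z\<close> hold on an open set.\<close>

lemma paths_cover:
  fixes z :: "'a :: topological_space \<Rightarrow> nat \<Rightarrow> real"
  assumes "open U" "U \<noteq> {}" "\<And>i. continuous_on U (\<lambda>y. z y i)" "valid_state m k js"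
    "wf_act m (length js) t"
    "\<And>y. y \<in> U \<Longrightarrow> represents m js (xs y) (vs y) (z y)"
    "\<And>y. y \<in> U \<Longrightarrow> run (xs y) (vs y) t \<noteq> None"
  shows "\<exists>V p Z out. open V \<and> V \<noteq> {} \<and> V \<subseteq> U \<and> (p, Z, out) \<in> paths t k js \<and>
    (\<forall>y\<in>V. exec_defined p k (\<lambda>_. 0) (z y) \<and> (\<forall>a\<in>Z. exec p k (\<lambda>_. 0) (z y) a = 0))"
  using assms
proof (induction t arbitrary: U z k js vs)
  case (Leaf out)
  then show ?case by (intro exI[of _ U] exI[of _ "[]"] exI[of _ "{}"] exI[of _ "output_form js out"]) auto
next
  case (Compute f t)
  have wf: "\<forall>p\<in>operands_computation f. wf_operand m (length js) p" using Compute.prems(5) by simp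
  have "computation_value (xs y) (vs y) f \<noteq> None" if "y \<in> U" for y
    using Compute.prems(7)[OF that] by (auto split: option.splits)
  from steps_cover[OF Compute.prems(1-4) wf Compute.prems(6) this]
  obtain V q Y where V: "open V" "V \<noteq> {}" "V \<subseteq> U" and q: "(q, Y) \<in> steps f k js"
    and d: "\<And>y. y \<in> V \<Longrightarrow> exec_defined q k (\<lambda>_. 0) (z y) \<and> (\<forall>a\<in>Y. z y a = 0)"
    by (metis (no_types, lifting))
  have wq: "1 \<le> length q" "Y \<subseteq> {..<k}"
    using steps_wf[OF q Compute.prems(4) wf] by auto
  define z' where "z' = (\<lambda>y. exec q k (\<lambda>_. 0) (z y))"
  define l where "l = k + length q - 1"
  have "V = {y\<in>V. exec_defined q k (\<lambda>_. 0) (z y)}" using d by auto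
  then have "continuous_on V (\<lambda>y. z' y i)" for i
    using exec_continuous(2)[OF V(1), of z "\<lambda>_ _. 0" q k i] continuous_on_subset[OF Compute.prems(3) V(3)]
    by (simp add: z'_def)
  moreover have "valid_state m (k + length q) (js @ [l])"
    using valid_state_extend Compute.prems(4) wq unfolding l_def by blast
  moreover have "wf_act m (length (js @ [l])) t" using Compute.prems(5) by simp
  moreover have "represents m (js @ [l]) (xs y) (vs y @ [z' y l]) (z' y)" if "y \<in> V" for y
    by (rule represents_extend[OF Compute.prems(6) Compute.prems(4)]) (use that V(3) in \<open>auto simp: z'_def exec_below\<close>)
  moreover have "run (xs y) (vs y @ [z' y l]) t \<noteq> None" if "y \<in> V" for y
    using Compute.prems(7)[of y] steps_sound[OF q Compute.prems(4) wf Compute.prems(6)] d that V(3)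
    by (auto simp: z'_def l_def)
  ultimately have "\<exists>W p Z out. open W \<and> W \<noteq> {} \<and> W \<subseteq> V \<and> (p, Z, out) \<in> paths t (k + length q) (js @ [l]) \<and>
    (\<forall>y\<in>W. exec_defined p (k + length q) (\<lambda>_. 0) (z' y) \<and> (\<forall>a\<in>Z. exec p (k + length q) (\<lambda>_. 0) (z' y) a = 0))"
    by (intro Compute.IH[OF V(1,2), where vs = "\<lambda>y. vs y @ [z' y l]"])
  then obtain W p Z out where W: "open W" "W \<noteq> {}" "W \<subseteq> V" "(p, Z, out) \<in> paths t (k + length q) (js @ [l])"
    and p: "\<And>y. y \<in> W \<Longrightarrow> exec_defined p (k + length q) (\<lambda>_. 0) (z' y) \<and> (\<forall>a\<in>Z. exec p (k + length q) (\<lambda>_. 0) (z' y) a = 0)"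
    by blast
  have "(q @ p, Y \<union> Z, out) \<in> paths (Compute f t) k js"
    using q W(4) by (force simp: extend_def l_def)
  moreover have "exec_defined (q @ p) k (\<lambda>_. 0) (z y) \<and> (\<forall>a\<in>Y \<union> Z. exec (q @ p) k (\<lambda>_. 0) (z y) a = 0)" if "y \<in> W" for y
  proof -
    have "y \<in> V" using that W(3) by blast
    have "exec p (k + length q) (\<lambda>_. 0) (z' y) a = 0" if "a \<in> Y" for a
      using d[OF \<open>y \<in> V\<close>] that wq(2) by (auto simp: z'_def exec_below)
    then show ?thesis using p[OF that] d[OF \<open>y \<in> V\<close>] by (auto simp: exec_defined_append exec_append z'_def)
  qed
  ultimately show ?case using W(1-3) V(3) by (intro exI[of _ W] exI[of _ "q @ p"] exI[of _ "Y \<union> Z"] exI[of _ out]) auto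
next
  case (Branch c t u)
  define b where "b = operand_index js (test_operand c)"
  have wf: "\<forall>p\<in>operands_test c. wf_operand m (length js) p" using Branch.prems(5) by simp
  have b: "b < k" using Branch.prems(4) wf wf_test_operand operand_index_less by (auto simp: b_def)
  obtain V s where V: "open V" "V \<noteq> {}" "V \<subseteq> U" "s \<in> {-1, 0, 1}" "\<And>y. y \<in> V \<Longrightarrow> sgn (z y b) = s"
    using constant_sign_part[OF Branch.prems(1,2,3)] by metis
  define q where "q = (if s = 0 then [] else [Inv s b])"
  define Y where "Y = (if s = 0 then {b} else {})"
  define t' where "t' = (if sign_passes c s then t else u)"
  have d: "exec_defined q k (\<lambda>_. 0) (z y)" "\<forall>a\<in>Y. z y a = 0" if "y \<in> V" for y
    using V(4) V(5)[OF that] by (auto simp: q_def Y_def sgn_if split: if_splits)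
  have test: "test_holds (xs y) (vs y) c \<longleftrightarrow> sign_passes c s" if "y \<in> V" for y
  proof -
    have "test_holds (xs y) (vs y) c \<longleftrightarrow> sign_passes c (z y b)"
      unfolding b_def by (rule test_holds_sign[OF Branch.prems(6) wf]) (use that V(3) in auto)
    moreover have "sgn (z y b) = sgn s" using V(4) V(5)[OF that] by auto
    ultimately show ?thesis using sign_passes_sgn by blast
  qed
  define z' where "z' = (\<lambda>y. exec q k (\<lambda>_. 0) (z y))"
  have "V = {y\<in>V. exec_defined q k (\<lambda>_. 0) (z y)}" using d by auto
  then have cont: "continuous_on V (\<lambda>y. z' y i)" for i
    using exec_continuous(2)[OF V(1), of z "\<lambda>_ _. 0" q k i] continuous_on_subset[OF Branch.prems(3) V(3)]
    by (simp add: z'_def)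
  have valid: "valid_state m (k + length q) js"
    using valid_state_mono Branch.prems(4) by simp
  have wf': "wf_act m (length js) t'" using Branch.prems(5) by (simp add: t'_def)
  have rep: "represents m js (xs y) (vs y) (z' y)" if "y \<in> V" for y
    by (rule represents_cong[OF Branch.prems(6) Branch.prems(4)]) (use that V(3) in \<open>auto simp: z'_def exec_below\<close>)
  have run: "run (xs y) (vs y) t' \<noteq> None" if "y \<in> V" for y
    using Branch.prems(7)[of y] test[OF that] that V(3) by (auto simp: t'_def)
  have "\<exists>W p Z out. open W \<and> W \<noteq> {} \<and> W \<subseteq> V \<and> (p, Z, out) \<in> paths t' (k + length q) js \<and>
    (\<forall>y\<in>W. exec_defined p (k + length q) (\<lambda>_. 0) (z' y) \<and> (\<forall>a\<in>Z. exec p (k + length q) (\<lambda>_. 0) (z' y) a = 0))"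
  proof (cases "sign_passes c s")
    case True
    then have t': "t' = t" by (simp add: t'_def)
    from Branch.IH(1)[OF V(1,2) cont valid wf'[unfolded t'] rep run[unfolded t']]
    show ?thesis unfolding t' .
  next
    case False
    then have t': "t' = u" by (simp add: t'_def)
    from Branch.IH(2)[OF V(1,2) cont valid wf'[unfolded t'] rep run[unfolded t']]
    show ?thesis unfolding t' .
  qed
  then obtain W p Z out where W: "open W" "W \<noteq> {}" "W \<subseteq> V" "(p, Z, out) \<in> paths t' (k + length q) js"
    and p: "\<And>y. y \<in> W \<Longrightarrow> exec_defined p (k + length q) (\<lambda>_. 0) (z' y) \<and> (\<forall>a\<in>Z. exec p (k + length q) (\<lambda>_. 0) (z' y) a = 0)"
    by blast
  have "(q @ p, Y \<union> Z, out) \<in> extend q Y (paths t' (k + length q) js)"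
    using W(4) by (force simp: extend_def)
  then have "(q @ p, Y \<union> Z, out) \<in> paths (Branch c t u) k js"
    using V(4) by (auto simp: Let_def b_def[symmetric] q_def Y_def t'_def split: if_splits)
  moreover have "exec_defined (q @ p) k (\<lambda>_. 0) (z y) \<and> (\<forall>a\<in>Y \<union> Z. exec (q @ p) k (\<lambda>_. 0) (z y) a = 0)" if "y \<in> W" for y
  proof -
    have "y \<in> V" using that W(3) by blast
    have "exec p (k + length q) (\<lambda>_. 0) (z' y) a = 0" if "a \<in> Y" for a
      using d(2)[OF \<open>y \<in> V\<close>] that b by (auto simp: z'_def exec_below Y_def split: if_splits)
    then show ?thesis using p[OF that] d[OF \<open>y \<in> V\<close>] by (auto simp: exec_defined_append exec_append z'_def)
  qed
  ultimately show ?case using W(1-3) V(3) by (intro exI[of _ W] exI[of _ "q @ p"] exI[of _ "Y \<union> Z"] exI[of _ out]) auto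
qed

section \<open>Sorting cones\<close>

definition cone :: "nat \<Rightarrow> (nat \<Rightarrow> nat) \<Rightarrow> (nat \<Rightarrow> real) set" where
  "cone m \<pi> = {x. \<forall>r s. r < s \<and> s < m \<longrightarrow> x (\<pi> r) < x (\<pi> s)}"

abbreviation inputs :: "nat \<Rightarrow> (nat \<Rightarrow> real) \<Rightarrow> real list" where
  "inputs m x \<equiv> map x [0..<m]"

lemma open_cone: "open (cone m \<pi>)"
proof -
  have "cone m \<pi> = (\<Inter>s\<in>{..<m}. \<Inter>r\<in>{..<s}. {x. x (\<pi> r) < x (\<pi> s)})"
    by (auto simp: cone_def)
  moreover have "open {x :: nat \<Rightarrow> real. x i < x j}" for i j
    by (intro open_Collect_less continuous_on_product_coordinates)
  ultimately show ?thesis by (auto intro!: open_INT)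
qed

lemma cone_nonempty: "\<pi> permutes {..<m} \<Longrightarrow> (\<lambda>i. real (inv \<pi> i)) \<in> cone m \<pi>"
  by (auto simp: cone_def permutes_inverses)

lemma closure_cone_le:
  assumes "x \<in> closure (cone m \<pi>)" "r < s" "s < m"
  shows "x (\<pi> r) \<le> x (\<pi> s)"
proof -
  have "closed {x :: nat \<Rightarrow> real. x i \<le> x j}" for i j
    by (intro closed_Collect_le continuous_on_product_coordinates)
  moreover have "cone m \<pi> \<subseteq> {x. x (\<pi> r) \<le> x (\<pi> s)}" using assms by (auto simp: cone_def less_imp_le)
  ultimately show ?thesis using assms(1) closure_minimal by blast
qed

lemma sorting_permutation_inputs:
  assumes "\<pi> permutes {..<m}" "\<And>r s. r < s \<Longrightarrow> s < m \<Longrightarrow> x (\<pi> r) \<le> x (\<pi> s)"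
  shows "sorting_permutation \<pi> (inputs m x)"
proof -
  have "\<pi> i < m" if "i < m" for i using permutes_in_image[OF assms(1)] that by auto
  moreover have "x (\<pi> i) \<le> x (\<pi> j)" if "i \<le> j" "j < m" for i j
    using assms(2)[of i j] that by (cases "i = j") auto
  ultimately show ?thesis using assms(1) by (auto simp: sorting_permutation_def)
qed

lemma even_rank_sum_inputs:
  assumes "\<pi> permutes {..<2 * n}" "\<And>r s. r < s \<Longrightarrow> s < 2 * n \<Longrightarrow> x (\<pi> r) \<le> x (\<pi> s)"
  shows "even_rank_sum (inputs (2 * n) x) = (\<Sum>k = 1..n. x (\<pi> (2 * k - 1)))"
proof -
  have "\<pi> (2 * k - 1) < 2 * n" if "k \<in> {1..n}" for k
    using permutes_in_image[OF assms(1), of "2 * k - 1"] that by auto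
  then show ?thesis
    using even_rank_sum_eq[OF sorting_permutation_inputs[of \<pi> "2 * n" x, OF assms]]
    by (auto intro!: sum.cong)
qed

text \<open>Comparing the two orders gives a strictly increasing permutation \<open>g\<close> of an
  initial segment, which must be the identity.\<close>

lemma in_cone_unique:
  assumes "\<pi> permutes {..<m}" "\<sigma> permutes {..<m}" "x \<in> cone m \<pi>" "y \<in> cone m \<sigma>"
    "\<And>k. k < m \<Longrightarrow> x k = y k"
  shows "\<pi> = \<sigma>"
proof -
  define g where "g = inv \<pi> \<circ> \<sigma>"
  have g: "g permutes {..<m}" unfolding g_def by (intro permutes_compose permutes_inv assms)
  have mono: "g r < g s" if "r < s" "s < m" for r s
  proof (rule ccontr)
    assume "\<not> g r < g s"
    have lt: "g r < m" "g s < m" using permutes_in_image[OF g] that by auto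
    have "g r \<noteq> g s" using that permutes_inj[OF g] by (metis injD less_irrefl)
    then have "g s < g r" using \<open>\<not> g r < g s\<close> by simp
    then have "x (\<pi> (g s)) < x (\<pi> (g r))" using assms(3) lt by (simp add: cone_def)
    then have "x (\<sigma> s) < x (\<sigma> r)" using permutes_inverses(1)[OF assms(1)] by (simp add: g_def)
    moreover have "\<sigma> s < m" "\<sigma> r < m" using permutes_in_image[OF assms(2)] that by auto
    ultimately have "y (\<sigma> s) < y (\<sigma> r)" using assms(5) by simp
    then show False using assms(4) that by (force simp: cone_def)
  qed
  have le: "r \<le> g r" if "r < m" for r
    using that
  proof (induction r)
    case (Suc r) then show ?case using mono[of r "Suc r"] by simp
  qed simp
  have "g r = r" if "r < m" for r
  proof -
    \<comment> \<open>The upper bound on \<open>g\<close> is obtained by counting down from the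
      largest index.\<close>
    have "g (m - 1 - r) \<le> m - 1 - r" if "r < m" for r
      using that
    proof (induction r)
      case 0
      then show ?case using permutes_in_image[OF g, of "m - 1"] by auto
    next
      case (Suc r)
      have "g (m - 1 - Suc r) < g (m - 1 - r)" using Suc.prems by (intro mono) auto
      then show ?case using Suc by linarith
    qed
    from this[of "m - 1 - r"] show ?thesis using le[OF that] that by simp
  qed
  then have "\<sigma> r = \<pi> r" for r
  proof (cases "r < m")
    case True
    then have "\<pi> (g r) = \<pi> r" using \<open>\<And>r. r < m \<Longrightarrow> g r = r\<close> by simp
    then show ?thesis using permutes_inverses(1)[OF assms(1)] by (simp add: g_def)
  next
    case False
    then show ?thesis using assms(1,2) by (simp add: permutes_def)
  qed
  then show ?thesis by auto
qed

text \<open>A tie \<open>x (\<pi> r) = x (\<pi> (r + 1))\<close> can be broken both ways, and the two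
  orders put different terms at the even ranks.\<close>

lemma strict_order_of_linear_even_rank_sum:
  assumes \<pi>: "\<pi> permutes {..<2 * n}" and B: "open B" "x \<in> B"
    and ers: "\<And>y. y \<in> B \<Longrightarrow> even_rank_sum (inputs (2 * n) y) = (\<Sum>k = 1..n. y (\<pi> (2 * k - 1)))"
    and le: "\<And>r s. r < s \<Longrightarrow> s < 2 * n \<Longrightarrow> x (\<pi> r) \<le> x (\<pi> s)"
  shows "x \<in> cone (2 * n) \<pi>"
proof (rule ccontr)
  assume "x \<notin> cone (2 * n) \<pi>"
  then obtain r s where rs: "r < s" "s < 2 * n" "\<not> x (\<pi> r) < x (\<pi> s)" by (auto simp: cone_def)
  have r1: "Suc r < 2 * n" using rs by simp
  have tie: "x (\<pi> r) = x (\<pi> (Suc r))"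
  proof -
    have "x (\<pi> (Suc r)) \<le> x (\<pi> s)" using rs le[of "Suc r" s] by (cases "Suc r = s") auto
    then show ?thesis using rs(3) le[of r "Suc r"] r1 by simp
  qed
  define \<tau> where "\<tau> = \<pi> \<circ> Transposition.transpose r (Suc r)"
  have \<tau>: "\<tau> permutes {..<2 * n}"
    unfolding \<tau>_def using r1 by (intro permutes_compose[OF permutes_swap_id \<pi>]) auto
  have \<tau>_simps: "\<tau> r = \<pi> (Suc r)" "\<tau> (Suc r) = \<pi> r" "\<And>k. k \<noteq> r \<Longrightarrow> k \<noteq> Suc r \<Longrightarrow> \<tau> k = \<pi> k"
    by (auto simp: \<tau>_def transpose_def)
  have x\<tau>: "x (\<tau> k) = x (\<pi> k)" for k
    using tie \<tau>_simps by (cases "k = r"; cases "k = Suc r") auto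
  \<comment> \<open>Adds \<eta> times the rank in the order \<open>\<tau>\<close>: a small
    perturbation of \<open>x\<close> that is sorted by \<open>\<tau>\<close> for positive
    \<eta>.\<close>
  define y where "y = (\<lambda>\<eta> i. x i + \<eta> * real (inv \<tau> i))"
  have y\<tau>: "y \<eta> (\<tau> k) = x (\<pi> k) + \<eta> * real k" for \<eta> k
    using permutes_inverses(2)[OF \<tau>] by (simp add: y_def x\<tau>)
  have "continuous_on UNIV y"
    by (rule continuous_on_coordinatewise_then_product) (auto simp: y_def intro!: continuous_intros)
  then have "open (y -` B)" using continuous_on_open_vimage[of UNIV y] B(1) by simp
  moreover have "0 \<in> y -` B" using B(2) by (simp add: y_def)
  ultimately obtain d where d: "d > 0" "\<And>\<eta>. \<bar>\<eta>\<bar> < d \<Longrightarrow> y \<eta> \<in> B"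
    unfolding open_dist dist_real_def by (metis diff_zero vimageD)
  define \<eta> where "\<eta> = d / 2"
  have \<eta>: "\<eta> > 0" "y \<eta> \<in> B" using d by (auto simp: \<eta>_def)
  have "(\<Sum>k = 1..n. y \<eta> (\<tau> (2 * k - 1))) = (\<Sum>k = 1..n. y \<eta> (\<pi> (2 * k - 1)))"
  proof -
    have "even_rank_sum (inputs (2 * n) (y \<eta>)) = (\<Sum>k = 1..n. y \<eta> (\<tau> (2 * k - 1)))"
    proof (rule even_rank_sum_inputs[OF \<tau>])
      show "y \<eta> (\<tau> r) \<le> y \<eta> (\<tau> s)" if "r < s" "s < 2 * n" for r s
        using le[OF that] \<eta>(1) that(1) by (simp add: y\<tau> add_mono)
    qed
    then show ?thesis using ers[OF \<eta>(2)] by simp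
  qed
  then have zero: "(\<Sum>k = 1..n. y \<eta> (\<tau> (2 * k - 1)) - y \<eta> (\<pi> (2 * k - 1))) = 0"
    by (simp add: sum_subtractf)
  \<comment> \<open>Positions are 0-based, so the even ranks sit at the odd positions, and exactly
    one of \<open>r\<close> and \<open>Suc r\<close> is odd. Only that term differs between the two
    sums, by \<eta> up to sign.\<close>
  obtain k0 where k0: "k0 \<in> {1..n}" "2 * k0 - 1 = r \<or> 2 * k0 - 1 = Suc r"
  proof (cases "even r")
    case True
    then obtain h where "r = 2 * h" by blast
    then show ?thesis using that[of "Suc h"] r1 by auto
  next
    case False
    then obtain h where "r = 2 * h + 1" using oddE by blast
    then show ?thesis using that[of "Suc h"] r1 by auto
  qed
  have "(\<Sum>k = 1..n. y \<eta> (\<tau> (2 * k - 1)) - y \<eta> (\<pi> (2 * k - 1)))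
      = (\<Sum>k\<in>{k0}. y \<eta> (\<tau> (2 * k - 1)) - y \<eta> (\<pi> (2 * k - 1)))"
  proof (rule sum.mono_neutral_right)
    show "\<forall>k\<in>{1..n} - {k0}. y \<eta> (\<tau> (2 * k - 1)) - y \<eta> (\<pi> (2 * k - 1)) = 0"
    proof
      fix k assume "k \<in> {1..n} - {k0}"
      then have "1 \<le> k" "1 \<le> k0" "k \<noteq> k0" using k0(1) by auto
      with k0(2) have "2 * k - 1 \<noteq> r" "2 * k - 1 \<noteq> Suc r" by presburger+
      then show "y \<eta> (\<tau> (2 * k - 1)) - y \<eta> (\<pi> (2 * k - 1)) = 0" using \<tau>_simps(3) by simp
    qed
  qed (use k0 in auto)
  moreover have "y \<eta> (\<pi> r) = y \<eta> (\<tau> (Suc r))" "y \<eta> (\<pi> (Suc r)) = y \<eta> (\<tau> r)"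
    using \<tau>_simps by simp_all
  ultimately show False using zero k0(2) \<eta>(1) tie by (auto simp: y\<tau> algebra_simps)
qed

text \<open>The equations in \<open>Z\<close> do not define an open set; the interior selects the
  inputs around which they hold identically.\<close>

definition part :: "nat \<Rightarrow> path \<Rightarrow> (nat \<Rightarrow> nat) \<Rightarrow> (nat \<Rightarrow> real) set" where
  "part m P \<pi> = (case P of (p, Z, out) \<Rightarrow> cone m \<pi> \<inter>
     interior {x. exec_defined p m (\<lambda>_. 0) x \<and> (\<forall>a\<in>Z. exec p m (\<lambda>_. 0) x a = 0)})"

text \<open>Around a limit point \<open>x\<close> in the domain, a convex box meets the part in some
  \<open>q\<close>. Along segments from \<open>q\<close> the identity theorem extends two facts to
  the whole box: the values in \<open>Z\<close> vanish, and the output is the linear form of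
  \<open>\<pi>\<close>. So the path computes the even-rank sum near \<open>x\<close>, the sum is
  linear there, and \<open>x\<close> has no ties.\<close>

lemma part_relatively_closed:
  assumes t: "wf_act (2 * n) 0 t" "\<And>xs. length xs = 2 * n \<Longrightarrow> run xs [] t = Some (even_rank_sum xs)"
    and P: "(p, Z, c, r, a) \<in> paths t (2 * n) []" and \<pi>: "\<pi> permutes {..<2 * n}"
  shows "{x. exec_defined p (2 * n) (\<lambda>_. 0) x} \<inter> closure (part (2 * n) (p, Z, c, r, a) \<pi>) \<subseteq> part (2 * n) (p, Z, c, r, a) \<pi>"
proof
  define m where "m = 2 * n"
  define K where "K = part m (p, Z, c, r, a) \<pi>"
  define D where "D = {x. exec_defined p m (\<lambda>_. 0) x}"
  let ?exec = "exec p m (\<lambda>_. 0)"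
  have Kcone: "K \<subseteq> cone m \<pi>" and Kzero: "\<And>y. y \<in> K \<Longrightarrow> y \<in> D \<and> (\<forall>a\<in>Z. ?exec y a = 0)"
    using interior_subset by (fastforce simp: K_def part_def D_def)+
  have "open K" by (simp add: K_def part_def open_cone open_Int)
  have "open D"
    using exec_continuous(1)[of UNIV "\<lambda>x. x" "\<lambda>_ _. 0" p m] by (simp add: D_def)
  have out: "even_rank_sum (inputs m y) = c + r * ?exec y a" if "y \<in> D" "\<forall>a\<in>Z. ?exec y a = 0" for y
  proof -
    have "run (inputs m y) [] t = Some (c + r * ?exec y a)"
      by (rule paths_sound[OF P[folded m_def]])
        (use that t(1) in \<open>auto simp: valid_state_def represents_def m_def D_def\<close>)
    then show ?thesis using t(2)[of "inputs m y"] by (simp add: m_def)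
  qed
  fix x assume "x \<in> {x. exec_defined p (2 * n) (\<lambda>_. 0) x} \<inter> closure (part (2 * n) (p, Z, c, r, a) \<pi>)"
  then have x: "x \<in> D" "x \<in> closure K" by (auto simp: D_def K_def m_def)
  obtain B where B: "open B" "x \<in> B" "B \<subseteq> D"
    "\<And>p q s. p \<in> B \<Longrightarrow> q \<in> B \<Longrightarrow> 0 \<le> s \<Longrightarrow> s \<le> 1 \<Longrightarrow> line_point p q s \<in> B"
    using segment_neighbourhood[OF \<open>open D\<close> x(1)] by blast
  obtain q where q: "q \<in> B" "q \<in> K"
    using x(2) B(1,2) open_Int_closure_eq_empty[OF B(1)] by blast
  have ext: "holomorphic_extension (\<lambda>t. ?exec (line_point q y t) i) s" if "y \<in> B" "0 \<le> s" "s \<le> 1" for y i s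
  proof (rule exec_holomorphic_extension[OF holomorphic_extension_line_point])
    show "exec_defined p m (\<lambda>_. 0) (line_point q y s)" using B(3,4) q(1) that by (auto simp: D_def)
  qed
  have zero: "?exec y a = 0" if "y \<in> B" "a \<in> Z" for y a
    by (rule vanishing_along_segment[OF \<open>open K\<close> q(2), where h = "\<lambda>y. ?exec y a"])
      (use Kzero that ext in auto)
  \<comment> \<open>On the part the tree is correct and the order is \<open>\<pi>\<close>; this
    identity spreads before it is known that other points of the box have that order.\<close>
  have "c + r * ?exec y a - (\<Sum>k = 1..n. y (\<pi> (2 * k - 1))) = 0" if "y \<in> B" for y
  proof (rule vanishing_along_segment[OF \<open>open K\<close> q(2), where h = "\<lambda>y. c + r * ?exec y a - (\<Sum>k = 1..n. y (\<pi> (2 * k - 1)))"])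
    fix y assume "y \<in> K"
    then have "even_rank_sum (inputs m y) = (\<Sum>k = 1..n. y (\<pi> (2 * k - 1)))"
      unfolding m_def using Kcone by (intro even_rank_sum_inputs[OF \<pi>]) (force simp: cone_def m_def)
    then show "c + r * ?exec y a - (\<Sum>k = 1..n. y (\<pi> (2 * k - 1))) = 0"
      using out[of y] Kzero[OF \<open>y \<in> K\<close>] by simp
  next
    fix s :: real assume "0 \<le> s" "s \<le> 1"
    then show "holomorphic_extension (\<lambda>t. c + r * ?exec (line_point q y t) a - (\<Sum>k = 1..n. line_point q y t (\<pi> (2 * k - 1)))) s"
      using that by (intro holomorphic_extension_diff holomorphic_extension_add holomorphic_extension_mult holomorphic_extension_const holomorphic_extension_sum holomorphic_extension_line_point ext)
  qed
  then have ers: "even_rank_sum (inputs (2 * n) y) = (\<Sum>k = 1..n. y (\<pi> (2 * k - 1)))" if "y \<in> B" for y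
    using out[of y] zero B(3) that by (auto simp: m_def)
  have "x \<in> closure (cone m \<pi>)" using x(2) Kcone closure_mono by blast
  then have "x \<in> cone m \<pi>"
    using strict_order_of_linear_even_rank_sum[OF \<pi> B(1,2) ers] closure_cone_le by (simp add: m_def)
  moreover have "B \<subseteq> {x. exec_defined p m (\<lambda>_. 0) x \<and> (\<forall>a\<in>Z. ?exec x a = 0)}"
    using B(3) zero by (auto simp: D_def)
  then have "x \<in> interior {x. exec_defined p m (\<lambda>_. 0) x \<and> (\<forall>a\<in>Z. ?exec x a = 0)}"
    using B(1,2) interiorI by blast
  ultimately show "x \<in> part (2 * n) (p, Z, c, r, a) \<pi>" by (simp add: part_def m_def)
qed

text \<open>Every order is met by a nonempty part of some path, and a single path has at most as
  many nonempty parts as the Lagrange bound allows.\<close>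

theorem fact_le_paths:
  assumes n: "n \<ge> 1" and t: "solves t (2 * n) even_rank_sum"
  shows "fact (2 * n) \<le> (3::nat) ^ depth t * 256 ^ (2 * n + 4 * depth t)"
proof -
  define m where "m = 2 * n"
  define S where "S = {\<pi>. \<pi> permutes {..<m}}"
  define R where "R = (\<lambda>P. {\<pi>\<in>S. part m P \<pi> \<noteq> {}})"
  have wf: "wf_act m 0 t" and run: "\<And>xs. length xs = m \<Longrightarrow> run xs [] t = Some (even_rank_sum xs)"
    using t by (auto simp: solves_def m_def)
  have "finite S" by (simp add: S_def finite_permutations)
  have cover: "S \<subseteq> (\<Union>P\<in>paths t m []. R P)"
  proof
    fix \<pi> assume "\<pi> \<in> S"
    then have \<pi>: "\<pi> permutes {..<m}" by (simp add: S_def)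
    have "\<exists>V p Z out. open V \<and> V \<noteq> {} \<and> V \<subseteq> cone m \<pi> \<and> (p, Z, out) \<in> paths t m [] \<and>
      (\<forall>y\<in>V. exec_defined p m (\<lambda>_. 0) y \<and> (\<forall>a\<in>Z. exec p m (\<lambda>_. 0) y a = 0))"
      by (rule paths_cover[OF open_cone, where z = "\<lambda>y. y" and xs = "inputs m" and vs = "\<lambda>_. []" and m = m and js = "[]"])
        (use cone_nonempty[OF \<pi>] wf run in \<open>auto simp: valid_state_def represents_def continuous_on_coordinate\<close>)
    then obtain V p Z out where V: "open V" "V \<noteq> {}" "V \<subseteq> cone m \<pi>" "(p, Z, out) \<in> paths t m []"
      "V \<subseteq> {x. exec_defined p m (\<lambda>_. 0) x \<and> (\<forall>a\<in>Z. exec p m (\<lambda>_. 0) x a = 0)}" by blast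
    then have "V \<subseteq> part m (p, Z, out) \<pi>" by (simp add: part_def interior_maximal)
    then have "\<pi> \<in> R (p, Z, out)" using V(2) \<open>\<pi> \<in> S\<close> by (auto simp: R_def)
    then show "\<pi> \<in> (\<Union>P\<in>paths t m []. R P)" using V(4) by blast
  qed
  have bound: "card (R P) \<le> 256 ^ (m + 4 * depth t)" if P: "P \<in> paths t m []" for P
  proof -
    obtain p Z c r a where P_eq: "P = (p, Z, c, r, a)" by (cases P) auto
    have wfp: "wf_prog m p \<and> guarded p \<and> length p \<le> 2 * depth t"
      using paths_wf[OF P[unfolded P_eq], of m] wf by (simp add: valid_state_def)
    have "card (R P) \<le> 256 ^ (m + 2 * length p)"
    proof (rule clopen_parts_bound[where K = "part m P"])
      show "wf_prog m p" "guarded p" using wfp by auto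
      show "1 \<le> m" using n by (simp add: m_def)
      show "finite (R P)" using \<open>finite S\<close> by (simp add: R_def)
      show "open (part m P \<pi>)" for \<pi> by (simp add: P_eq part_def open_cone open_Int)
      show "part m P \<pi> \<noteq> {}" if "\<pi> \<in> R P" for \<pi> using that by (simp add: R_def)
      show "part m P \<pi> \<subseteq> {x. exec_defined p m (\<lambda>_. 0) x}" for \<pi>
        using interior_subset by (fastforce simp: P_eq part_def)
      show "{x. exec_defined p m (\<lambda>_. 0) x} \<inter> closure (part m P \<pi>) \<subseteq> part m P \<pi>" if "\<pi> \<in> R P" for \<pi>
        unfolding P_eq m_def
        by (rule part_relatively_closed) (use wf run P that in \<open>auto simp: R_def S_def P_eq m_def\<close>)
      show "\<pi> = \<sigma>" if "\<pi> \<in> R P" "\<sigma> \<in> R P" "x \<in> part m P \<pi>" "y \<in> part m P \<sigma>" "\<And>k. k < m \<Longrightarrow> x k = y k" for \<pi> \<sigma> x y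
        by (rule in_cone_unique[of \<pi> m \<sigma> x y]) (use that in \<open>auto simp: R_def S_def P_eq part_def\<close>)
    qed
    \<comment> \<open>The program has at most \<open>2 * depth t\<close> instructions, and each
      counts twice in the number of unknowns.\<close>
    also have "\<dots> \<le> 256 ^ (m + 4 * depth t)" using wfp by (intro power_increasing) auto
    finally show ?thesis .
  qed
  have fin: "finite (paths t m [])" "card (paths t m []) \<le> 3 ^ depth t" using paths_finite_card by auto
  have "fact m = card S" by (simp add: S_def card_permutations)
  also have "\<dots> \<le> card (\<Union>P\<in>paths t m []. R P)"
    by (rule card_mono[OF _ cover]) (use fin \<open>finite S\<close> in \<open>auto simp: R_def\<close>)
  also have "\<dots> \<le> (\<Sum>P\<in>paths t m []. card (R P))" by (rule card_UN_le[OF fin(1)])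
  also have "\<dots> \<le> card (paths t m []) * 256 ^ (m + 4 * depth t)"
    using sum_bounded_above[of "paths t m []" "\<lambda>P. card (R P)"] bound by simp
  also have "\<dots> \<le> 3 ^ depth t * 256 ^ (m + 4 * depth t)" using fin(2) by simp
  finally show ?thesis by (simp add: m_def)
qed

section \<open>Insertion sort\<close>

type_synonym continuation = "nat \<Rightarrow> nat list \<Rightarrow> act"

text \<open>Trees are built in continuation-passing style. A continuation receives the number of
  computation vertices so far, which is the index of the next computed value.\<close>

function insertion_tree ::
  "nat list \<Rightarrow> nat list \<Rightarrow> nat list \<Rightarrow> nat \<Rightarrow> nat \<Rightarrow> continuation \<Rightarrow> act" where
  "insertion_tree ps zs ss i k cont =
    (if zs = [] then cont k (ps @ i # ss)
     else let h = length zs div 2 in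
       Compute (Binary Minus (Input (zs ! h)) (Input i)) (Branch (Nonnegative (Computed k))
         (insertion_tree ps (take h zs) (drop h zs @ ss) i (Suc k) cont)
         (insertion_tree (ps @ take (Suc h) zs) (drop (Suc h) zs) ss i (Suc k) cont)))"
  by auto
termination by (relation "Wellfounded.measure (\<lambda>(ps, zs, ss, i, k, cont). length zs)") auto

declare insertion_tree.simps [simp del]

lemma insertion_tree_Nil [simp]: "insertion_tree ps [] ss i k cont = cont k (ps @ i # ss)"
  by (subst insertion_tree.simps) simp

lemma insertion_tree_nonempty:
  assumes "zs \<noteq> []" "h = length zs div 2"
  shows "insertion_tree ps zs ss i k cont =
    Compute (Binary Minus (Input (zs ! h)) (Input i)) (Branch (Nonnegative (Computed k))
      (insertion_tree ps (take h zs) (drop h zs @ ss) i (Suc k) cont)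
      (insertion_tree (ps @ take (Suc h) zs) (drop (Suc h) zs) ss i (Suc k) cont))"
  using assms by (subst insertion_tree.simps) (simp add: Let_def)

text \<open>Each halving costs two vertices, a difference and a test of its sign.\<close>

lemma depth_insertion_tree:
  assumes "length zs < 2 ^ b"
    "\<And>k l. length l = Suc (length ps + length zs + length ss) \<Longrightarrow> depth (cont k l) \<le> d"
  shows "depth (insertion_tree ps zs ss i k cont) \<le> d + 2 * b"
  using assms
proof (induction b arbitrary: ps zs ss k)
  case 0
  then show ?case by simp
next
  case (Suc b)
  show ?case
  proof (cases "zs = []")
    case True
    then show ?thesis using Suc.prems(2)[of "ps @ i # ss" k] by simp
  next
    case False
    define h where "h = length zs div 2"
    have h: "h < length zs" "h < 2 ^ b" "length zs - Suc h < 2 ^ b"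
      using False Suc.prems(1) by (auto simp: h_def)
    have "depth (insertion_tree ps (take h zs) (drop h zs @ ss) i (Suc k) cont) \<le> d + 2 * b"
      by (rule Suc.IH) (use h Suc.prems(2) in auto)
    moreover have "depth (insertion_tree (ps @ take (Suc h) zs) (drop (Suc h) zs) ss i (Suc k) cont) \<le> d + 2 * b"
      by (rule Suc.IH) (use h Suc.prems(2) in auto)
    ultimately show ?thesis
      by (simp add: insertion_tree_nonempty[OF False h_def])
  qed
qed

lemma wf_insertion_tree:
  assumes "set (i # ps @ zs @ ss) \<subseteq> {..<m}"
    "\<And>k l. length l = Suc (length ps + length zs + length ss) \<Longrightarrow> set l \<subseteq> {..<m} \<Longrightarrow> wf_act m k (cont k l)"
  shows "wf_act m k (insertion_tree ps zs ss i k cont)"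
  using assms
proof (induction "length zs" arbitrary: ps zs ss k rule: less_induct)
  case less
  show ?case
  proof (cases "zs = []")
    case True
    then show ?thesis using less.prems by simp
  next
    case False
    define h where "h = length zs div 2"
    have h: "h < length zs" using False by (auto simp: h_def)
    have "wf_act m (Suc k) (insertion_tree ps (take h zs) (drop h zs @ ss) i (Suc k) cont)"
      by (rule less.hyps) (use h less.prems set_take_subset[of h zs] set_drop_subset[of h zs] in auto)
    moreover have "wf_act m (Suc k) (insertion_tree (ps @ take (Suc h) zs) (drop (Suc h) zs) ss i (Suc k) cont)"
      by (rule less.hyps) (use h less.prems set_take_subset[of "Suc h" zs] set_drop_subset[of "Suc h" zs] in auto)
    moreover have "zs ! h < m" "i < m" using less.prems(1) nth_mem[OF h] by auto
    ultimately show ?thesis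
      by (simp add: insertion_tree_nonempty[OF False h_def])
  qed
qed

text \<open>Invariant of the binary search: entries at \<open>ps\<close> are at most the new entry,
  those at \<open>ss\<close> are at least as large, and \<open>zs\<close> is the undecided middle.
  The lists contain indices into the input.\<close>

lemma run_insertion_tree:
  assumes "sorted (map ((!) xs) (ps @ zs @ ss))"
    "\<forall>p\<in>set ps. xs ! p \<le> xs ! i" "\<forall>s\<in>set ss. xs ! i \<le> xs ! s"
  shows "\<exists>vs' l. run xs vs (insertion_tree ps zs ss i (length vs) cont) = run xs vs' (cont (length vs') l) \<and>
    mset l = mset (i # ps @ zs @ ss) \<and> sorted (map ((!) xs) l)"
  using assms
proof (induction "length zs" arbitrary: ps zs ss vs rule: less_induct)
  case less
  show ?case
  proof (cases "zs = []")
    case True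
    then show ?thesis using less.prems
      by (intro exI[of _ vs] exI[of _ "ps @ i # ss"]) (auto simp: sorted_append)
  next
    case nonempty: False
    define h where "h = length zs div 2"
    have h: "h < length zs" using nonempty by (auto simp: h_def)
    define v where "v = xs ! (zs ! h) - xs ! i"
    have sz: "sorted (map ((!) xs) zs)" using less.prems(1) by (simp add: sorted_append)
    have le: "xs ! (zs ! a) \<le> xs ! (zs ! b)" if "a \<le> b" "b < length zs" for a b
      using sorted_nth_mono[OF sz that(1)] that by simp
    show ?thesis
    proof (cases "v \<ge> 0")
      case True
      have "xs ! i \<le> xs ! s" if "s \<in> set (drop h zs)" for s
      proof -
        obtain a where "s = zs ! (h + a)" "h + a < length zs"
          using \<open>s \<in> set (drop h zs)\<close> by (auto simp: in_set_conv_nth)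
        then show ?thesis using le[of h "h + a"] True by (simp add: v_def)
      qed
      moreover have e: "ps @ take h zs @ drop h zs @ ss = ps @ zs @ ss"
        by (metis append_assoc append_take_drop_id)
      ultimately have IH: "\<exists>vs' l. run xs (vs @ [v]) (insertion_tree ps (take h zs) (drop h zs @ ss) i (length (vs @ [v])) cont) =
          run xs vs' (cont (length vs') l) \<and> mset l = mset (i # ps @ take h zs @ drop h zs @ ss) \<and> sorted (map ((!) xs) l)"
      proof (intro less.hyps)
        show "sorted (map ((!) xs) (ps @ take h zs @ drop h zs @ ss))" unfolding e by (rule less.prems(1))
      qed (use h less.prems in auto)
      show ?thesis using True IH[unfolded e]
        by (simp add: insertion_tree_nonempty[OF nonempty h_def] v_def[symmetric])
    next
      case False
      have "xs ! s \<le> xs ! i" if "s \<in> set (take (Suc h) zs)" for s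
      proof -
        obtain a where "s = zs ! a" "a \<le> h"
          using \<open>s \<in> set (take (Suc h) zs)\<close> by (auto simp: in_set_conv_nth less_Suc_eq_le)
        then show ?thesis using le[of a h] h False by (simp add: v_def)
      qed
      moreover have e: "(ps @ take (Suc h) zs) @ drop (Suc h) zs @ ss = ps @ zs @ ss"
        by (metis append_assoc append_take_drop_id)
      ultimately have IH: "\<exists>vs' l. run xs (vs @ [v]) (insertion_tree (ps @ take (Suc h) zs) (drop (Suc h) zs) ss i (length (vs @ [v])) cont) =
          run xs vs' (cont (length vs') l) \<and> mset l = mset (i # (ps @ take (Suc h) zs) @ drop (Suc h) zs @ ss) \<and> sorted (map ((!) xs) l)"
      proof (intro less.hyps)
        show "sorted (map ((!) xs) ((ps @ take (Suc h) zs) @ drop (Suc h) zs @ ss))" unfolding e by (rule less.prems(1))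
      qed (use h less.prems in auto)
      show ?thesis using False IH[unfolded e]
        by (simp add: insertion_tree_nonempty[OF nonempty h_def] v_def[symmetric])
    qed
  qed
qed

section \<open>Sorting by repeated insertion and summing the even ranks\<close>

primrec sorting_tree :: "nat list \<Rightarrow> nat list \<Rightarrow> nat \<Rightarrow> continuation \<Rightarrow> act" where
  "sorting_tree [] zs k cont = cont k zs"
| "sorting_tree (i # is) zs k cont =
     insertion_tree [] zs [] i k (\<lambda>k' zs'. sorting_tree is zs' k' cont)"

lemma depth_sorting_tree:
  assumes "length is + length zs < 2 ^ b"
    "\<And>k l. length l = length is + length zs \<Longrightarrow> depth (cont k l) \<le> d"
  shows "depth (sorting_tree is zs k cont) \<le> d + 2 * b * length is"
  using assms
proof (induction "is" arbitrary: zs k)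
  case (Cons i "is")
  have "depth (sorting_tree (i # is) zs k cont) \<le> (d + 2 * b * length is) + 2 * b"
    unfolding sorting_tree.simps
    by (rule depth_insertion_tree) (use Cons in auto)
  then show ?case by simp
qed auto

lemma wf_sorting_tree:
  assumes "set (is @ zs) \<subseteq> {..<m}"
    "\<And>k l. length l = length is + length zs \<Longrightarrow> set l \<subseteq> {..<m} \<Longrightarrow> wf_act m k (cont k l)"
  shows "wf_act m k (sorting_tree is zs k cont)"
  using assms
proof (induction "is" arbitrary: zs k)
  case (Cons i "is")
  show ?case
    unfolding sorting_tree.simps
    by (rule wf_insertion_tree) (use Cons in auto)
qed auto

lemma run_sorting_tree:
  assumes "sorted (map ((!) xs) zs)"
  shows "\<exists>vs' l. run xs vs (sorting_tree is zs (length vs) cont) = run xs vs' (cont (length vs') l) \<and>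
    mset l = mset (is @ zs) \<and> sorted (map ((!) xs) l)"
  using assms
proof (induction "is" arbitrary: zs vs)
  case (Cons i "is")
  obtain vs' l where l: "run xs vs (sorting_tree (i # is) zs (length vs) cont) = run xs vs' (sorting_tree is l (length vs') cont)"
    "mset l = mset (i # zs)" "sorted (map ((!) xs) l)"
    using run_insertion_tree[of xs "[]" zs "[]" i vs "\<lambda>k' zs'. sorting_tree is zs' k' cont"] Cons.prems by auto
  obtain vs'' l' where l': "run xs vs' (sorting_tree is l (length vs') cont) = run xs vs'' (cont (length vs'') l')"
    "mset l' = mset (is @ l)" "sorted (map ((!) xs) l')"
    using Cons.IH[OF l(3)] by blast
  then show ?case using l by (intro exI[of _ vs''] exI[of _ l']) simp
qed auto

primrec sum_tree :: "nat list \<Rightarrow> nat \<Rightarrow> operand \<Rightarrow> act" where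
  "sum_tree [] k p = Leaf (Output p)"
| "sum_tree (j # js) k p = Compute (Binary Plus p (Input j)) (sum_tree js (Suc k) (Computed k))"

lemma depth_sum_tree: "depth (sum_tree js k p) = length js"
  by (induction js arbitrary: k p) auto

lemma wf_sum_tree: "wf_operand m k p \<Longrightarrow> set js \<subseteq> {..<m} \<Longrightarrow> wf_act m k (sum_tree js k p)"
  by (induction js arbitrary: k p) auto

lemma run_sum_tree:
  "run xs vs (sum_tree js (length vs) p) = Some (operand_value xs vs p + (\<Sum>j\<leftarrow>js. xs ! j))"
proof (induction js arbitrary: vs p)
  case (Cons j js)
  have "run xs (vs @ [v]) (sum_tree js (Suc (length vs)) (Computed (length vs))) = Some (v + (\<Sum>j\<leftarrow>js. xs ! j))" for v
    using Cons.IH[of "vs @ [v]" "Computed (length vs)"] by simp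
  then show ?case by (simp add: add.assoc)
qed simp

lemma even_rank_sum_sort: "even_rank_sum A = (\<Sum>k = 1..length A div 2. sort A ! (2 * k - 1))"
proof -
  obtain \<pi> where \<pi>: "sorting_permutation \<pi> A" using sorting_permutation_exists by blast
  show ?thesis
    unfolding even_rank_sum_eq[OF \<pi>]
    by (intro sum.cong sorting_permutation_nth[OF \<pi>]) auto
qed

lemma exists_even_rank_sum_tree:
  assumes n: "n \<ge> 1" and b: "2 * n < 2 ^ b"
  shows "\<exists>t. solves t (2 * n) even_rank_sum \<and> depth t \<le> n + 4 * n * b"
proof -
  \<comment> \<open>The term of rank 2 starts the running sum, which is possible because n \<ge> 1;
    the list supplies the ranks from 4 on.\<close>
  define cont where "cont = (\<lambda>k l. sum_tree (map (\<lambda>j. l ! (2 * j - 1)) [2..<Suc n]) k (Input (l ! 1)))"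
  define t where "t = sorting_tree [0..<2 * n] [] 0 cont"
  have "depth t \<le> n + 2 * b * length [0..<2 * n]"
    unfolding t_def by (rule depth_sorting_tree) (use b in \<open>auto simp: cont_def depth_sum_tree\<close>)
  moreover have "wf_act (2 * n) 0 t"
    unfolding t_def
  proof (rule wf_sorting_tree)
    fix k :: nat and l :: "nat list"
    assume l: "length l = length [0..<2 * n] + length ([] :: nat list)" "set l \<subseteq> {..<2 * n}"
    have "l ! j < 2 * n" if "j < 2 * n" for j
    proof -
      have "l ! j \<in> set l" using l(1) that by (intro nth_mem) simp
      then show ?thesis using l(2) by blast
    qed
    then show "wf_act (2 * n) k (cont k l)"
      unfolding cont_def using n by (intro wf_sum_tree) auto
  qed auto
  moreover have "run xs [] t = Some (even_rank_sum xs)" if xs: "length xs = 2 * n" for xs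
  proof -
    obtain vs l where l: "run xs [] t = run xs vs (cont (length vs) l)"
      "mset l = mset [0..<2 * n]" "sorted (map ((!) xs) l)"
      using run_sorting_tree[of xs "[]" "[]" "[0..<2 * n]" cont] by (auto simp: t_def)
    have "mset (map ((!) xs) l) = mset (map ((!) xs) [0..<2 * n])" using l(2) by (metis mset_map)
    also have "\<dots> = mset xs" using map_nth[of xs] xs by simp
    finally have sort: "sort xs = map ((!) xs) l"
      using l(3) by (intro properties_for_sort) auto
    have len: "length l = 2 * n" using l(2) by (metis diff_zero length_upt mset_eq_length)
    have "run xs [] t = Some (xs ! (l ! 1) + (\<Sum>j\<leftarrow>[2..<Suc n]. xs ! (l ! (2 * j - 1))))"
      unfolding l(1) cont_def run_sum_tree by (simp add: o_def)
    also have "(\<Sum>j\<leftarrow>[2..<Suc n]. xs ! (l ! (2 * j - 1))) = (\<Sum>j\<in>{2..n}. xs ! (l ! (2 * j - 1)))"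
      by (simp only: interv_sum_list_conv_sum_set_nat set_upt atLeastLessThanSuc_atLeastAtMost)
    also have "xs ! (l ! 1) + \<dots> = (\<Sum>j = 1..n. xs ! (l ! (2 * j - 1)))"
      using n sum.atLeast_Suc_atMost[of 1 n "\<lambda>j. xs ! (l ! (2 * j - 1))"] by (simp add: numeral_2_eq_2)
    also have "\<dots> = even_rank_sum xs"
      unfolding even_rank_sum_sort sort by (intro sum.cong) (auto simp: xs len)
    finally show ?thesis .
  qed
  ultimately show ?thesis unfolding solves_def by (intro exI[of _ t]) (auto simp: algebra_simps)
qed

section \<open>The time complexity\<close>

text \<open>For k = n this gives n ^ n \<le> fact (2 * n), strong enough to avoid Stirling's
  formula.\<close>

lemma power_le_fact_add: "n ^ k \<le> (fact (n + k) :: nat)"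
proof (induction k)
  case (Suc k)
  then have "n * n ^ k \<le> (n + Suc k) * fact (n + k)" by (intro mult_le_mono) auto
  then show ?case by simp
qed (simp add: fact_ge_1)

lemma exists_two_power_between:
  assumes "n \<ge> 1" shows "\<exists>b. n < 2 ^ b \<and> 2 ^ b \<le> 2 * (n :: nat)"
proof -
  define b where "b = (LEAST b. n < 2 ^ b)"
  have b: "n < 2 ^ b" unfolding b_def by (rule LeastI[of _ n]) simp
  then have "b \<noteq> 0" using assms by (cases b) auto
  then have "\<not> n < 2 ^ (b - 1)" unfolding b_def using not_less_Least[of "b - 1" "\<lambda>b. n < 2 ^ b"] b_def by simp
  then have "2 * 2 ^ (b - 1) \<le> 2 * n" by simp
  then have "2 ^ b \<le> 2 * n" using \<open>b \<noteq> 0\<close> by (cases b) auto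
  with b show ?thesis by blast
qed

theorem theorem1:
  shows "(\<forall>n\<ge>1. \<exists>t. solves t (2 * n) even_rank_sum) \<and>
    (\<lambda>n. real (time_complexity (2 * n) even_rank_sum)) \<in> \<Theta>(\<lambda>n. real n * ln (real n))"
proof
  define T where "T = (\<lambda>n. time_complexity (2 * n) even_rank_sum)"
  have tree: "\<exists>t b. solves t (2 * n) even_rank_sum \<and> depth t \<le> n + 4 * n * b \<and> 2 ^ b \<le> 4 * n" if "n \<ge> 1" for n
    using exists_two_power_between[of "2 * n"] exists_even_rank_sum_tree[OF that] that by fastforce
  then show "\<forall>n\<ge>1. \<exists>t. solves t (2 * n) even_rank_sum" by blast
  have optimal: "\<exists>t. solves t (2 * n) even_rank_sum \<and> depth t = T n" if "n \<ge> 1" for n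
    unfolding T_def time_complexity_def by (rule LeastI_ex) (use tree[OF that] in blast)
  have T_le: "T n \<le> depth t" if "solves t (2 * n) even_rank_sum" for n t
    unfolding T_def time_complexity_def by (rule Least_le) (use that in blast)
  have large: "\<forall>\<^sub>F n in sequentially. C \<le> ln (real n)" for C :: real
    using filterlim_compose[OF ln_at_top filterlim_real_sequentially] by (simp add: filterlim_at_top)
  have upper: "(\<lambda>n. real (T n)) \<in> O(\<lambda>n. real n * ln (real n))"
  \<comment> \<open>The depth is at most n + 4 * n * b, and from 2 ^ b \<le> 4 * n follows b \<le> 2
    * ln n / ln 2 as soon as n \<ge> 4.\<close>
  proof (rule bigoI[of _ "1 + 8 / ln 2"])
    show "\<forall>\<^sub>F n in sequentially. norm (real (T n)) \<le> (1 + 8 / ln 2) * norm (real n * ln (real n))"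
      using large[of 1] large[of "ln 4"] eventually_ge_at_top[of 1]
    proof eventually_elim
      case (elim n)
      obtain t b where t: "solves t (2 * n) even_rank_sum" "depth t \<le> n + 4 * n * b" "2 ^ b \<le> 4 * n"
        using tree[OF elim(3)] by blast
      have "(2::real) ^ b \<le> 4 * real n" using t(3) by (metis of_nat_le_iff of_nat_mult of_nat_numeral of_nat_power)
      then have "ln ((2::real) ^ b) \<le> ln (4 * real n)" using elim(3) by (subst ln_le_cancel_iff) auto
      then have "real b * ln 2 \<le> ln 4 + ln (real n)" using elim(3) by (simp add: ln_realpow ln_mult)
      then have "real b * ln 2 \<le> 2 * ln (real n)" using elim(2) by linarith
      then have b: "real b \<le> 2 * ln (real n) / ln 2" by (simp add: field_simps)
      have "real (T n) \<le> real (n + 4 * n * b)" using T_le[OF t(1)] t(2) by (intro of_nat_mono) simp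
      also have "\<dots> = real n * 1 + 4 * real n * real b" by simp
      also have "\<dots> \<le> real n * ln (real n) + 4 * real n * (2 * ln (real n) / ln 2)"
        using elim(1) b by (intro add_mono mult_left_mono) auto
      also have "\<dots> = (1 + 8 / ln 2) * (real n * ln (real n))" by (simp add: field_simps)
      finally show ?case using elim(1) by simp
    qed
  qed
  \<comment> \<open>The factor of \<open>T n\<close> in the logarithm of 3 ^ T n * 256 ^ (2 * n + 4
    * T n).\<close>
  define C where "C = ln 3 + 4 * ln (256::real)"
  have C: "C > 0" by (simp add: C_def add_pos_pos)
  have lower: "(\<lambda>n. real (T n)) \<in> \<Omega>(\<lambda>n. real n * ln (real n))"
  \<comment> \<open>The remaining term 2 * n * ln 256 is at most half of n * ln n once ln n \<ge> 4
    * ln 256; the other half leaves the factor 1 / (2 * C).\<close>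
  proof (rule landau_omega.bigI[of "1 / (2 * C)"])
    show "\<forall>\<^sub>F n in sequentially. 1 / (2 * C) * norm (real n * ln (real n)) \<le> norm (real (T n))"
      using large[of "4 * ln 256"] large[of 0] eventually_ge_at_top[of 1]
    proof eventually_elim
      case (elim n)
      obtain t where t: "solves t (2 * n) even_rank_sum" "depth t = T n" using optimal[OF elim(3)] by blast
      have "n ^ n \<le> fact (2 * n)" using power_le_fact_add[of n n] by (simp only: mult_2)
      also have "\<dots> \<le> 3 ^ T n * 256 ^ (2 * n + 4 * T n)"
        using fact_le_paths[OF elim(3) t(1)] by (simp only: t(2))
      finally have "n ^ n \<le> 3 ^ T n * 256 ^ (2 * n + 4 * T n)" .
      then have "real (n ^ n) \<le> real (3 ^ T n * 256 ^ (2 * n + 4 * T n))" by (rule of_nat_mono)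
      then have "ln (real n ^ n) \<le> ln (3 ^ T n * 256 ^ (2 * n + 4 * T n))"
        using elim(3) by (subst ln_le_cancel_iff) auto
      then have "real n * ln (real n) \<le> real (T n) * ln 3 + real (2 * n + 4 * T n) * ln 256"
        using elim(3) by (simp add: ln_realpow ln_mult)
      also have "\<dots> = C * real (T n) + real n * (2 * ln 256)" by (simp add: C_def algebra_simps)
      also have "\<dots> \<le> C * real (T n) + real n * (ln (real n) / 2)"
        using elim(1) by (intro add_left_mono mult_left_mono) auto
      finally have "real n * ln (real n) \<le> 2 * C * real (T n)" by (simp add: field_simps)
      then show ?case using C elim(2) by (simp add: field_simps)
    qed
  qed (use C in simp)
  show "(\<lambda>n. real (time_complexity (2 * n) even_rank_sum)) \<in> \<Theta>(\<lambda>n. real n * ln (real n))"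
    using upper lower unfolding T_def by (rule bigthetaI)
qed

end
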